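(* Let $\Lambda$ be a cofinal row-finite $k$-graph with no sources, and let $c\in\underline{Z}^2(\Lambda,\mathbb{T})$. Fix $\mathcal{P}\subseteq\{(\mu,\nu)\in\Lambda\times\Lambda:s(\mu)=s(\nu)\}$ such that $(\lambda,s(\lambda))\in\mathcal{P}$ for all $\lambda\in\Lambda$ and $\mathcal{G}_\Lambda=\bigsqcup_{(\mu,\nu)\in\mathcal{P}}Z(\mu,\nu)$, and let $\sigma_c\in Z^2(\mathcal{G}_\Lambda,\mathbb{T})$ be the cocycle determined by $c$ and $\mathcal{P}$. For $x\in\Lambda^\infty$, define $\sigma_c^x\in Z^2(\operatorname{Per}(\Lambda),\mathbb{T})$ by $\sigma_c^x(p,q)=\sigma_c((x,p,x),(x,q,x))$. Then there is a bicharacter $\omega$ of $\operatorname{Per}(\Lambda)$ such that $\sigma_c^x$ is cohomologous to $\omega$ for every $x\in\Lambda^\infty$. For any such bicharacter $\omega$, there exists a cocycle $\sigma\in Z^2(\mathcal{G}_\Lambda,\mathbb{T})$ such that $\sigma$ is cohomologous to $\sigma_c$ and $\sigma|_{\mathcal{I}_\Lambda}=\omega\times1_{\Lambda^\infty}$, that is, $\sigma((x,p,x),(x,q,x))=\omega(p,q)$ for all $x\in\Lambda^\infty$, $p,q\in\operatorname{Per}(\Lambda)$.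
   Context: **$k$-graphs.** $0\in\mathbb{N}$. A $k$-graph is a countable small category $\Lambda$ with a functor $d:\Lambda\to\mathbb{N}^k$ such that, writing $\Lambda^n=d^{-1}(n)$, for all $m,n$ the map $(\mu,\nu)\mapsto\mu\nu$ is a bijection of $\{(\mu,\nu)\in\Lambda^m\times\Lambda^n: s(\mu)=r(\nu)\}$ onto $\Lambda^{m+n}$. $\Lambda^0$ is identified with the objects; $r,s$ are the codomain and domain maps. $v\Lambda^n=\{\lambda\in\Lambda^n:r(\lambda)=v\}$; $\Lambda$ is row-finite with no sources if $0<|v\Lambda^n|<\infty$ for all $v\in\Lambda^0$, $n\in\mathbb{N}^k$. $\Omega_k=\{(m,n)\in\mathbb{N}^k\times\mathbb{N}^k:m\le n\}$ is the $k$-graph with $r(m,n)=(m,m)$, $s(m,n)=(n,n)$, $(m,n)(n,p)=(m,p)$, $d(m,n)=n-m$. $\Lambda^\infty$ is the set of degree-preserving functors $x:\Omega_k\to\Lambda$; $x(n):=x(n,n)$, $r(x):=x(0)$; $(T^px)(m,n)=x(m+p,n+p)$; for $s(\lambda)=r(x)$, $\lambda x$ is the unique element of $\Lambda^\infty$ with $(\lambda x)(0,d(\lambda))=\lambda$ and $T^{d(\lambda)}(\lambda x)=x$. $\Lambda$ is cofinal if for all $x\in\Lambda^\infty$, $v\in\Lambda^0$ there are $n\in\mathbb{N}^k$ and $\lambda\in\Lambda$ with $r(\lambda)=v$, $s(\lambda)=x(n)$. **Groupoid.** $\mathcal{G}_\Lambda=\{(x,l-m,y)\in\Lambda^\infty\times\mathbb{Z}^k\times\Lambda^\infty: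 l,m\in\mathbb{N}^k,\ T^lx=T^my\}$ with $r(x,n,y)=x$, $s(x,n,y)=y$ (identifying $(x,0,x)$ with $x$), $(x,n,y)(y,p,z)=(x,n+p,z)$, $(x,n,y)^{-1}=(y,-n,x)$. The sets $Z(\mu,\nu)=\{(\mu x,d(\mu)-d(\nu),\nu x):r(x)=s(\mu)\}$ for $s(\mu)=s(\nu)$ form a basis for its locally compact Hausdorff étale topology; its unit space is $\Lambda^\infty$. $\mathcal{I}_\Lambda$ is the interior of the isotropy $\{g:r(g)=s(g)\}$. Write $\mu\sim\nu$ if $s(\mu)=s(\nu)$ and $\mu x=\nu x$ for all $x\in\Lambda^\infty$ with $r(x)=s(\mu)$; $\operatorname{Per}(\Lambda)=\{d(\mu)-d(\nu):\mu\sim\nu\}$, a subgroup of $\mathbb{Z}^k$ when $\Lambda$ is cofinal; then $\mathcal{I}_\Lambda=\{(x,m,x):x\in\Lambda^\infty,m\in\operatorname{Per}(\Lambda)\}$. **2-cocycles.** For a small category $\mathcal{C}$, a $\mathbb{T}$-valued 2-cocycle is a map $c$ on composable pairs with $c(\lambda,s(\lambda))=c(r(\lambda),\lambda)=1$ and $c(\mu,\nu)c(\lambda,\mu\nu)=c(\lambda,\mu)c(\lambda\mu,\nu)$. $\underline{Z}^2(\Lambda,\mathbb{T})$ denotes those on $\Lambda$; $Z^2(\mathcal{G},\mathbb{T})$ denotes the continuous ones on a topological groupoid $\mathcal{G}$ (all of them for a discrete group). Two continuous 2-cocycles on $\mathcal{G}$ are cohomologous if they differ by some $\delta^1b(g,h)=b(g)b(h)\overline{b(gh)}$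 with $b:\mathcal{G}\to\mathbb{T}$ continuous and $b\equiv1$ on $\mathcal{G}^{(0)}$. A bicharacter of an abelian group is a $\mathbb{T}$-valued map of two variables that is a homomorphism in each variable. **$\sigma_c$.** Given $\mathcal{P}$ as in the claim and $g\in\mathcal{G}_\Lambda$, $(\mu_g,\nu_g)$ is the unique element of $\mathcal{P}$ with $g\in Z(\mu_g,\nu_g)$; $\tilde d(x,n,y)=n$. For composable $g,h$ there are $\alpha,\beta,\gamma\in\Lambda$ and $y\in\Lambda^\infty$ with $\nu_g\alpha=\mu_h\beta$, $\mu_g\alpha=\mu_{gh}\gamma$, $\nu_h\beta=\nu_{gh}\gamma$, $g=(\mu_g\alpha y,\tilde d(g),\nu_g\alpha y)$, $h=(\mu_h\beta y,\tilde d(h),\nu_h\beta y)$, $gh=(\mu_{gh}\gamma y,\tilde d(gh),\nu_{gh}\gamma y)$. Then $$\sigma_c(g,h)=c(\mu_g,\alpha)\overline{c(\nu_g,\alpha)}c(\mu_h,\beta)\overline{c(\nu_h,\beta)}\,\overline{c(\mu_{gh},\gamma)}c(\nu_{gh},\gamma),$$ which is independent of the choice of $\alpha,\beta,\gamma$ and is a continuous 2-cocycle. *)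

theory Defs
  imports "HOL-Analysis.Analysis" "HOL-Library.Function_Algebras" "HOL-Library.Disjoint_Sets"
begin

section \<open>Small categories\<close>

text \<open>
  A category is given by its morphisms only, an object being identified with its identity
  morphism: \<open>src\<close> and \<open>rng\<close> are the domain and codomain maps with values in the identities.
  The composite \<open>cmp C a b\<close> (written \<open>ab\<close> in mathematical notation) is meaningful
  if \<open>src C a = rng C b\<close>.
\<close>

record 'a cat =
  mor :: "'a set"
  src :: "'a \<Rightarrow> 'a"
  rng :: "'a \<Rightarrow> 'a"
  cmp :: "'a \<Rightarrow> 'a \<Rightarrow> 'a"

definition category :: "('a, 'm) cat_scheme \<Rightarrow> bool" where
  "category C \<longleftrightarrow>
     (\<forall>a\<in>mor C. src C a \<in> mor C \<and> rng C a \<in> mor C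
        \<and> src C (src C a) = src C a \<and> rng C (src C a) = src C a
        \<and> src C (rng C a) = rng C a \<and> rng C (rng C a) = rng C a
        \<and> cmp C (rng C a) a = a \<and> cmp C a (src C a) = a) \<and>
     (\<forall>a\<in>mor C. \<forall>b\<in>mor C. src C a = rng C b \<longrightarrow>
        cmp C a b \<in> mor C \<and> rng C (cmp C a b) = rng C a \<and> src C (cmp C a b) = src C b) \<and>
     (\<forall>a\<in>mor C. \<forall>b\<in>mor C. \<forall>e\<in>mor C. src C a = rng C b \<longrightarrow> src C b = rng C e \<longrightarrow>
        cmp C (cmp C a b) e = cmp C a (cmp C b e))"

definition objects :: "('a, 'm) cat_scheme \<Rightarrow> 'a set" where
  "objects C = src C ` mor C \<union> rng C ` mor C"

definition composable :: "('a, 'm) cat_scheme \<Rightarrow> ('a \<times> 'a) set" where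
  "composable C = {(a, b). a \<in> mor C \<and> b \<in> mor C \<and> src C a = rng C b}"

definition is_functor :: "('a, 'm) cat_scheme \<Rightarrow> ('b, 'n) cat_scheme \<Rightarrow> ('a \<Rightarrow> 'b) \<Rightarrow> bool" where
  "is_functor C D f \<longleftrightarrow>
     (\<forall>a\<in>mor C. f a \<in> mor D \<and> f (src C a) = src D (f a) \<and> f (rng C a) = rng D (f a)) \<and>
     (\<forall>(a, b)\<in>composable C. f (cmp C a b) = cmp D (f a) (f b))"

section \<open>Circle-valued 2-cocycles\<close>

text \<open>The circle \<open>\<bbbT>\<close> is \<open>sphere 0 1\<close> in the complex plane.\<close>

definition two_cocycle :: "('a, 'm) cat_scheme \<Rightarrow> ('a \<Rightarrow> 'a \<Rightarrow> complex) \<Rightarrow> bool" where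
  "two_cocycle C c \<longleftrightarrow>
     (\<forall>(a, b)\<in>composable C. c a b \<in> sphere 0 1) \<and>
     (\<forall>a\<in>mor C. c a (src C a) = 1 \<and> c (rng C a) a = 1) \<and>
     (\<forall>a b e. (a, b) \<in> composable C \<longrightarrow> (b, e) \<in> composable C \<longrightarrow>
        c b e * c a (cmp C b e) = c a b * c (cmp C a b) e)"

definition continuous_two_cocycle ::
  "('a, 'm) cat_scheme \<Rightarrow> 'a topology \<Rightarrow> ('a \<Rightarrow> 'a \<Rightarrow> complex) \<Rightarrow> bool" where
  "continuous_two_cocycle G X c \<longleftrightarrow>
     two_cocycle G c \<and>
     continuous_map (subtopology (prod_topology X X) (composable G)) (top_of_set (sphere 0 1))
       (\<lambda>(g, h). c g h)"

definition coboundary1 :: "('a, 'm) cat_scheme \<Rightarrow> ('a \<Rightarrow> complex) \<Rightarrow> 'a \<Rightarrow> 'a \<Rightarrow> complex" where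
  "coboundary1 G b g h = b g * b h * cnj (b (cmp G g h))"

definition cohomologous ::
  "('a, 'm) cat_scheme \<Rightarrow> 'a topology \<Rightarrow> ('a \<Rightarrow> 'a \<Rightarrow> complex) \<Rightarrow> ('a \<Rightarrow> 'a \<Rightarrow> complex) \<Rightarrow> bool" where
  "cohomologous G X c c' \<longleftrightarrow>
     continuous_two_cocycle G X c \<and> continuous_two_cocycle G X c' \<and>
     (\<exists>b. continuous_map X (top_of_set (sphere 0 1)) b \<and> (\<forall>v\<in>objects G. b v = 1) \<and>
          (\<forall>(g, h)\<in>composable G. c g h = coboundary1 G b g h * c' g h))"

definition bicharacter :: "'a::ab_group_add set \<Rightarrow> ('a \<Rightarrow> 'a \<Rightarrow> complex) \<Rightarrow> bool" where
  "bicharacter A w \<longleftrightarrow>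
     (\<forall>p\<in>A. \<forall>q\<in>A. w p q \<in> sphere 0 1) \<and>
     (\<forall>p\<in>A. \<forall>p'\<in>A. \<forall>q\<in>A. w (p + p') q = w p q * w p' q) \<and>
     (\<forall>p\<in>A. \<forall>q\<in>A. \<forall>q'\<in>A. w p (q + q') = w p q * w p q')"

section \<open>Graphs of rank k\<close>

text \<open>
  Elements of \<open>\<nat>\<^sup>k\<close> and \<open>\<int>\<^sup>k\<close> are functions on \<open>nat\<close> vanishing outside \<open>{..<k}\<close>; the order and
  the operations are the pointwise ones. The case \<open>k = 0\<close> is included.
\<close>

definition Nk :: "nat \<Rightarrow> (nat \<Rightarrow> nat) set" where
  "Nk k = {n. \<forall>i\<ge>k. n i = 0}"

definition zdiff :: "(nat \<Rightarrow> nat) \<Rightarrow> (nat \<Rightarrow> nat) \<Rightarrow> (nat \<Rightarrow> int)" where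
  "zdiff l m = (\<lambda>i. int (l i) - int (m i))"

text \<open>An additive monoid, viewed as a category with the single object \<open>0\<close>.\<close>

definition monoid_cat :: "'a::monoid_add set \<Rightarrow> 'a cat" where
  "monoid_cat A = \<lparr>mor = A, src = (\<lambda>_. 0), rng = (\<lambda>_. 0), cmp = (+)\<rparr>"

record 'a graded_cat = "'a cat" +
  deg :: "'a \<Rightarrow> nat \<Rightarrow> nat"

definition level :: "'a graded_cat \<Rightarrow> (nat \<Rightarrow> nat) \<Rightarrow> 'a set" where
  "level \<Lambda> n = {l \<in> mor \<Lambda>. deg \<Lambda> l = n}"

definition k_graph :: "nat \<Rightarrow> 'a graded_cat \<Rightarrow> bool" where
  "k_graph k \<Lambda> \<longleftrightarrow>
     category \<Lambda> \<and> countable (mor \<Lambda>) \<and> is_functor \<Lambda> (monoid_cat (Nk k)) (deg \<Lambda>) \<and>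
     (\<forall>m\<in>Nk k. \<forall>n\<in>Nk k.
        bij_betw (\<lambda>(\<mu>, \<nu>). cmp \<Lambda> \<mu> \<nu>)
          {(\<mu>, \<nu>) \<in> level \<Lambda> m \<times> level \<Lambda> n. src \<Lambda> \<mu> = rng \<Lambda> \<nu>} (level \<Lambda> (m + n)))"

definition row_finite_no_sources :: "nat \<Rightarrow> 'a graded_cat \<Rightarrow> bool" where
  "row_finite_no_sources k \<Lambda> \<longleftrightarrow>
     (\<forall>v\<in>level \<Lambda> 0. \<forall>n\<in>Nk k.
        finite {l \<in> level \<Lambda> n. rng \<Lambda> l = v} \<and> {l \<in> level \<Lambda> n. rng \<Lambda> l = v} \<noteq> {})"

definition Omega :: "nat \<Rightarrow> ((nat \<Rightarrow> nat) \<times> (nat \<Rightarrow> nat)) graded_cat" where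
  "Omega k = \<lparr>mor = {(m, n). m \<in> Nk k \<and> n \<in> Nk k \<and> m \<le> n},
              src = (\<lambda>(m, n). (n, n)), rng = (\<lambda>(m, n). (m, m)),
              cmp = (\<lambda>(m, n) (n', p). (m, p)), deg = (\<lambda>(m, n). n - m)\<rparr>"

text \<open>
  Infinite paths are extensional functions (\<open>undefined\<close> outside \<open>Omega k\<close>), so that equality
  of paths is equality of functions.
\<close>

definition inf_paths ::
  "nat \<Rightarrow> 'a graded_cat \<Rightarrow> ((nat \<Rightarrow> nat) \<times> (nat \<Rightarrow> nat) \<Rightarrow> 'a) set" where
  "inf_paths k \<Lambda> = {x \<in> extensional (mor (Omega k)).
     is_functor (Omega k) \<Lambda> x \<and> (\<forall>w\<in>mor (Omega k). deg \<Lambda> (x w) = deg (Omega k) w)}"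

definition path_range :: "((nat \<Rightarrow> nat) \<times> (nat \<Rightarrow> nat) \<Rightarrow> 'a) \<Rightarrow> 'a" where
  "path_range x = x (0, 0)"

definition shift ::
  "nat \<Rightarrow> (nat \<Rightarrow> nat) \<Rightarrow> ((nat \<Rightarrow> nat) \<times> (nat \<Rightarrow> nat) \<Rightarrow> 'a) \<Rightarrow> (nat \<Rightarrow> nat) \<times> (nat \<Rightarrow> nat) \<Rightarrow> 'a" where
  "shift k p x = restrict (\<lambda>(m, n). x (m + p, n + p)) (mor (Omega k))"

text \<open>The path \<open>\<lambda>x\<close>, for \<open>x \<in> \<Lambda>\<^sup>\<infinity>\<close> with \<open>s(\<lambda>) = r(x)\<close>.\<close>

definition prepend ::
  "nat \<Rightarrow> 'a graded_cat \<Rightarrow> 'a \<Rightarrow> ((nat \<Rightarrow> nat) \<times> (nat \<Rightarrow> nat) \<Rightarrow> 'a) \<Rightarrow>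
   (nat \<Rightarrow> nat) \<times> (nat \<Rightarrow> nat) \<Rightarrow> 'a" where
  "prepend k \<Lambda> l x =
     (THE z. z \<in> inf_paths k \<Lambda> \<and> z (0, deg \<Lambda> l) = l \<and> shift k (deg \<Lambda> l) z = x)"

definition cofinal_graph :: "nat \<Rightarrow> 'a graded_cat \<Rightarrow> bool" where
  "cofinal_graph k \<Lambda> \<longleftrightarrow>
     (\<forall>x\<in>inf_paths k \<Lambda>. \<forall>v\<in>level \<Lambda> 0. \<exists>n\<in>Nk k. \<exists>l\<in>mor \<Lambda>. rng \<Lambda> l = v \<and> src \<Lambda> l = x (n, n))"

section \<open>Periodicity\<close>

definition path_equiv :: "nat \<Rightarrow> 'a graded_cat \<Rightarrow> 'a \<Rightarrow> 'a \<Rightarrow> bool" where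
  "path_equiv k \<Lambda> \<mu> \<nu> \<longleftrightarrow>
     \<mu> \<in> mor \<Lambda> \<and> \<nu> \<in> mor \<Lambda> \<and> src \<Lambda> \<mu> = src \<Lambda> \<nu> \<and>
     (\<forall>x\<in>inf_paths k \<Lambda>. path_range x = src \<Lambda> \<mu> \<longrightarrow> prepend k \<Lambda> \<mu> x = prepend k \<Lambda> \<nu> x)"

definition Per :: "nat \<Rightarrow> 'a graded_cat \<Rightarrow> (nat \<Rightarrow> int) set" where
  "Per k \<Lambda> = {zdiff (deg \<Lambda> \<mu>) (deg \<Lambda> \<nu>) | \<mu> \<nu>. path_equiv k \<Lambda> \<mu> \<nu>}"

section \<open>The path groupoid\<close>

type_synonym 'a path_arrow =
  "((nat \<Rightarrow> nat) \<times> (nat \<Rightarrow> nat) \<Rightarrow> 'a) \<times> (nat \<Rightarrow> int) \<times> ((nat \<Rightarrow> nat) \<times> (nat \<Rightarrow> nat) \<Rightarrow> 'a)"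

text \<open>A unit \<open>x\<close> is represented by the arrow \<open>(x, 0, x)\<close>.\<close>

definition path_groupoid :: "nat \<Rightarrow> 'a graded_cat \<Rightarrow> 'a path_arrow cat" where
  "path_groupoid k \<Lambda> =
     \<lparr>mor = {(x, zdiff l m, y) | x l m y. x \<in> inf_paths k \<Lambda> \<and> y \<in> inf_paths k \<Lambda> \<and>
               l \<in> Nk k \<and> m \<in> Nk k \<and> shift k l x = shift k m y},
      src = (\<lambda>(x, n, y). (y, 0, y)), rng = (\<lambda>(x, n, y). (x, 0, x)),
      cmp = (\<lambda>(x, n, y) (y', p, z). (x, n + p, z))\<rparr>"

definition cylinder :: "nat \<Rightarrow> 'a graded_cat \<Rightarrow> 'a \<Rightarrow> 'a \<Rightarrow> 'a path_arrow set" where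
  "cylinder k \<Lambda> \<mu> \<nu> =
     {(prepend k \<Lambda> \<mu> x, zdiff (deg \<Lambda> \<mu>) (deg \<Lambda> \<nu>), prepend k \<Lambda> \<nu> x) | x.
        x \<in> inf_paths k \<Lambda> \<and> path_range x = src \<Lambda> \<mu>}"

definition path_groupoid_topology :: "nat \<Rightarrow> 'a graded_cat \<Rightarrow> 'a path_arrow topology" where
  "path_groupoid_topology k \<Lambda> =
     topology_generated_by {cylinder k \<Lambda> \<mu> \<nu> | \<mu> \<nu>. \<mu> \<in> mor \<Lambda> \<and> \<nu> \<in> mor \<Lambda> \<and> src \<Lambda> \<mu> = src \<Lambda> \<nu>}"

section \<open>The cocycle determined by c and a partition into cylinder sets\<close>

definition cylinder_partition :: "nat \<Rightarrow> 'a graded_cat \<Rightarrow> ('a \<times> 'a) set \<Rightarrow> bool" where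
  "cylinder_partition k \<Lambda> P \<longleftrightarrow>
     P \<subseteq> {(\<mu>, \<nu>) \<in> mor \<Lambda> \<times> mor \<Lambda>. src \<Lambda> \<mu> = src \<Lambda> \<nu>} \<and>
     (\<forall>l\<in>mor \<Lambda>. (l, src \<Lambda> l) \<in> P) \<and>
     mor (path_groupoid k \<Lambda>) = (\<Union>(\<mu>, \<nu>)\<in>P. cylinder k \<Lambda> \<mu> \<nu>) \<and>
     disjoint_family_on (\<lambda>(\<mu>, \<nu>). cylinder k \<Lambda> \<mu> \<nu>) P"

definition label ::
  "nat \<Rightarrow> 'a graded_cat \<Rightarrow> ('a \<times> 'a) set \<Rightarrow> 'a path_arrow \<Rightarrow> 'a \<times> 'a" where
  "label k \<Lambda> P g = (THE w. w \<in> P \<and> g \<in> cylinder k \<Lambda> (fst w) (snd w))"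

definition degree_of :: "'a path_arrow \<Rightarrow> nat \<Rightarrow> int" where
  "degree_of g = fst (snd g)"

text \<open>
  The relation between composable \<open>g\<close>, \<open>h\<close> and the data \<open>\<alpha>\<close>, \<open>\<beta>\<close>, \<open>\<gamma>\<close>, \<open>y\<close>; the conditions on sources
  and ranges say that the composites in the equations are defined.
\<close>

definition factors ::
  "nat \<Rightarrow> 'a graded_cat \<Rightarrow> ('a \<times> 'a) set \<Rightarrow> 'a path_arrow \<Rightarrow> 'a path_arrow \<Rightarrow>
   'a \<Rightarrow> 'a \<Rightarrow> 'a \<Rightarrow> ((nat \<Rightarrow> nat) \<times> (nat \<Rightarrow> nat) \<Rightarrow> 'a) \<Rightarrow> bool" where
  "factors k \<Lambda> P g h \<alpha> \<beta> \<gamma> y \<longleftrightarrow>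
     (let gh = cmp (path_groupoid k \<Lambda>) g h;
          (\<mu>g, \<nu>g) = label k \<Lambda> P g; (\<mu>h, \<nu>h) = label k \<Lambda> P h; (\<mu>gh, \<nu>gh) = label k \<Lambda> P gh
      in \<alpha> \<in> mor \<Lambda> \<and> \<beta> \<in> mor \<Lambda> \<and> \<gamma> \<in> mor \<Lambda> \<and> y \<in> inf_paths k \<Lambda> \<and>
         rng \<Lambda> \<alpha> = src \<Lambda> \<mu>g \<and> rng \<Lambda> \<beta> = src \<Lambda> \<mu>h \<and> rng \<Lambda> \<gamma> = src \<Lambda> \<mu>gh \<and>
         src \<Lambda> \<alpha> = path_range y \<and> src \<Lambda> \<beta> = path_range y \<and> src \<Lambda> \<gamma> = path_range y \<and>
         cmp \<Lambda> \<nu>g \<alpha> = cmp \<Lambda> \<mu>h \<beta> \<and>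
         cmp \<Lambda> \<mu>g \<alpha> = cmp \<Lambda> \<mu>gh \<gamma> \<and>
         cmp \<Lambda> \<nu>h \<beta> = cmp \<Lambda> \<nu>gh \<gamma> \<and>
         g = (prepend k \<Lambda> (cmp \<Lambda> \<mu>g \<alpha>) y, degree_of g, prepend k \<Lambda> (cmp \<Lambda> \<nu>g \<alpha>) y) \<and>
         h = (prepend k \<Lambda> (cmp \<Lambda> \<mu>h \<beta>) y, degree_of h, prepend k \<Lambda> (cmp \<Lambda> \<nu>h \<beta>) y) \<and>
         gh = (prepend k \<Lambda> (cmp \<Lambda> \<mu>gh \<gamma>) y, degree_of gh, prepend k \<Lambda> (cmp \<Lambda> \<nu>gh \<gamma>) y))"

text \<open>The definite description expresses that the value does not depend on the choice of
  \<open>\<alpha>\<close>, \<open>\<beta>\<close>, \<open>\<gamma>\<close>.\<close>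

definition sigma_c ::
  "nat \<Rightarrow> 'a graded_cat \<Rightarrow> ('a \<times> 'a) set \<Rightarrow> ('a \<Rightarrow> 'a \<Rightarrow> complex) \<Rightarrow>
   'a path_arrow \<Rightarrow> 'a path_arrow \<Rightarrow> complex" where
  "sigma_c k \<Lambda> P c g h =
     (let gh = cmp (path_groupoid k \<Lambda>) g h;
          (\<mu>g, \<nu>g) = label k \<Lambda> P g; (\<mu>h, \<nu>h) = label k \<Lambda> P h; (\<mu>gh, \<nu>gh) = label k \<Lambda> P gh
      in THE t. \<exists>\<alpha> \<beta> \<gamma> y. factors k \<Lambda> P g h \<alpha> \<beta> \<gamma> y \<and>
           t = c \<mu>g \<alpha> * cnj (c \<nu>g \<alpha>) * c \<mu>h \<beta> * cnj (c \<nu>h \<beta>) * cnj (c \<mu>gh \<gamma>) * c \<nu>gh \<gamma>)"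

definition sigma_c_at ::
  "nat \<Rightarrow> 'a graded_cat \<Rightarrow> ('a \<times> 'a) set \<Rightarrow> ('a \<Rightarrow> 'a \<Rightarrow> complex) \<Rightarrow>
   ((nat \<Rightarrow> nat) \<times> (nat \<Rightarrow> nat) \<Rightarrow> 'a) \<Rightarrow> (nat \<Rightarrow> int) \<Rightarrow> (nat \<Rightarrow> int) \<Rightarrow> complex" where
  "sigma_c_at k \<Lambda> P c x p q = sigma_c k \<Lambda> P c (x, p, x) (x, q, x)"

end

theory Submission
  imports Defs
begin

text \<open>
  Write \<open>[x, p] = (x, p, x)\<close>. Near an arrow \<open>g = (x, m, y)\<close> the cocycle \<open>\<sigma>\<^sub>c\<close> is a coboundary: once a
  large degree \<open>l\<close> is fixed, \<open>\<sigma>\<^sub>c(g, h) = f\<^sub>l(g) f\<^sub>l\<^sub>'(h) / f\<^sub>l(gh)\<close> with \<open>f\<^sub>l(g) = c(\<mu>\<^sub>g, \<alpha>) / c(\<nu>\<^sub>g, \<alpha>)\<close>,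
  where \<open>\<mu>\<^sub>g\<alpha>\<close> is the initial segment of \<open>x\<close> of degree \<open>l\<close> and \<open>l - l' = m\<close>. The right-hand side does not
  depend on \<open>l\<close>, so \<open>\<sigma>\<^sub>c\<close> is a well-defined locally constant cocycle.

  The commutators \<open>\<sigma>\<^sub>c([x, p], [x, q]) / \<sigma>\<^sub>c([x, q], [x, p])\<close> form an alternating bicharacter of \<open>Per\<close>, which
  is locally constant in \<open>x\<close> and constant on orbits. By cofinality orbits are dense, so it does not depend
  on \<open>x\<close>. As \<open>Per\<close> is free abelian, it is the commutator of a bicharacter \<open>\<omega>\<close>. For every bicharacter with
  these commutators, the quotients \<open>\<sigma>\<^sub>c\<^sup>x / \<omega>\<close> form a symmetric cocycle on \<open>Per\<close> with values in the locally
  constant functions of \<open>x\<close>, and this is trivial because \<open>Per\<close> is free. The trivialising cochain lives on the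
  open and closed subgroupoid of all \<open>[x, p]\<close>; extended by 1 it turns \<open>\<sigma>\<^sub>c\<close> into the required \<open>\<sigma>\<close>.
\<close>

section \<open>Cocycles on subgroups of a free abelian group\<close>

text \<open>Trivialising each cocycle \<open>sigma_c_at k \<Lambda> P c x\<close> on its own would
  give cochains without any control in \<open>x\<close>, whereas the cochain on the groupoid has to
  be continuous. The group theory is therefore done with coefficients in a group \<open>M\<close> of
  functions: the cochains are built from values of the cocycle by products and conjugates, and so
  they stay in \<open>M\<close>. Freeness of Per enters only through splittings: a subgroup of Z^k
  with a nonzero coordinate is the kernel of that coordinate plus a cyclic group, and one induction
  over coordinates serves both for finding \<omega> and for trivialising symmetric cocycles. The
  value of \<open>sigma_c\<close> is a definite description over all \<open>\<alpha>\<close>,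
  \<open>\<beta>\<close>, \<open>\<gamma>\<close>, \<open>y\<close>; but every admissible choice
  consists of segments of the paths involved, so a choice amounts to a degree. Raising the degree
  multiplies each of the three factors by boundary terms, one for each end path, and these cancel
  around the triangle \<open>g\<close>, \<open>h\<close>, \<open>gh\<close>.\<close>

lemma circle_cnj: "norm z = 1 \<Longrightarrow> z * cnj z = 1" "norm z = 1 \<Longrightarrow> cnj z * z = 1" for z :: complex
  by (simp_all add: complex_norm_square [symmetric] mult.commute)

definition additive_subgroup :: "'g::ab_group_add set \<Rightarrow> bool" where
  "additive_subgroup A \<longleftrightarrow> 0 \<in> A \<and> (\<forall>p\<in>A. \<forall>q\<in>A. p - q \<in> A)"

lemma additive_subgroupD:
  assumes "additive_subgroup A"
  shows "0 \<in> A" "p \<in> A \<Longrightarrow> q \<in> A \<Longrightarrow> p - q \<in> A" "p \<in> A \<Longrightarrow> - p \<in> A"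
    "p \<in> A \<Longrightarrow> q \<in> A \<Longrightarrow> p + q \<in> A"
proof -
  show z: "0 \<in> A" and d: "\<And>p q. p \<in> A \<Longrightarrow> q \<in> A \<Longrightarrow> p - q \<in> A"
    using assms by (auto simp: additive_subgroup_def)
  show m: "\<And>p. p \<in> A \<Longrightarrow> - p \<in> A" using d[OF z] by simp
  show "p \<in> A \<Longrightarrow> q \<in> A \<Longrightarrow> p + q \<in> A" using d[of p "- q"] m by simp
qed

text \<open>The ring structure is a device for integer multiples: on integer-valued functions
  \<open>of_int n\<close> is the constant function with value \<open>n\<close>, so
  \<open>of_int n * a\<close> is the n-fold sum of \<open>a\<close>.\<close>

lemma additive_subgroup_multiple:
  fixes a :: "'g::ring_1"
  assumes A: "additive_subgroup A" and a: "a \<in> A"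
  shows "of_int n * a \<in> A"
proof (induction n rule: int_induct[where k=0])
  case base
  then show ?case using additive_subgroupD[OF A] by simp
next
  case (step1 i)
  then show ?case using additive_subgroupD(4)[OF A] a by (simp add: algebra_simps)
next
  case (step2 i)
  then show ?case using additive_subgroupD(2)[OF A] a by (simp add: algebra_simps)
qed

text \<open>Conjugation is the inverse at points of \<open>X\<close>, where the values have norm 1;
  outside \<open>X\<close> the values are left free because the functions are total.\<close>

definition circle_function_group :: "'x set \<Rightarrow> ('x \<Rightarrow> complex) set \<Rightarrow> bool" where
  "circle_function_group X M \<longleftrightarrow>
     (\<lambda>_. 1) \<in> M \<and> (\<forall>f\<in>M. \<forall>g\<in>M. (\<lambda>x. f x * g x) \<in> M) \<and>
     (\<forall>f\<in>M. (\<lambda>x. cnj (f x)) \<in> M) \<and> (\<forall>f\<in>M. \<forall>x\<in>X. norm (f x) = 1)"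

lemma circle_function_groupD:
  assumes "circle_function_group X M"
  shows "(\<lambda>_. 1) \<in> M" "f \<in> M \<Longrightarrow> g \<in> M \<Longrightarrow> (\<lambda>x. f x * g x) \<in> M"
    "f \<in> M \<Longrightarrow> (\<lambda>x. cnj (f x)) \<in> M" "f \<in> M \<Longrightarrow> x \<in> X \<Longrightarrow> norm (f x) = 1"
  using assms by (auto simp: circle_function_group_def)

text \<open>A family of cocycles indexed by \<open>X\<close> is a single cocycle with values in the group \<open>M\<close> of
  functions on \<open>X\<close>; in this way the choice of a trivialising cochain can be made uniformly in the
  index.\<close>

definition symmetric_cocycle ::
  "'x set \<Rightarrow> ('x \<Rightarrow> complex) set \<Rightarrow> 'g::ab_group_add set \<Rightarrow> ('x \<Rightarrow> 'g \<Rightarrow> 'g \<Rightarrow> complex) \<Rightarrow> bool" where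
  "symmetric_cocycle X M A s \<longleftrightarrow>
     (\<forall>p\<in>A. \<forall>q\<in>A. (\<lambda>x. s x p q) \<in> M) \<and>
     (\<forall>x\<in>X. \<forall>p\<in>A. s x p 0 = 1) \<and>
     (\<forall>x\<in>X. \<forall>p\<in>A. \<forall>q\<in>A. s x p q = s x q p) \<and>
     (\<forall>x\<in>X. \<forall>p\<in>A. \<forall>q\<in>A. \<forall>r\<in>A. s x q r * s x p (q + r) = s x p q * s x (p + q) r)"

definition trivialises ::
  "'x set \<Rightarrow> ('x \<Rightarrow> complex) set \<Rightarrow> 'g::ab_group_add set \<Rightarrow>
   ('x \<Rightarrow> 'g \<Rightarrow> complex) \<Rightarrow> ('x \<Rightarrow> 'g \<Rightarrow> 'g \<Rightarrow> complex) \<Rightarrow> bool" where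
  "trivialises X M A f s \<longleftrightarrow>
     (\<forall>p\<in>A. (\<lambda>x. f x p) \<in> M) \<and>
     (\<forall>x\<in>X. \<forall>p\<in>A. \<forall>q\<in>A. f x (p + q) = f x p * f x q * s x p q)"

text \<open>With the generator as second argument and the normalisation \<open>g x 1 = 1\<close>,
  the coboundary equation becomes the recursion \<open>rec\<close>, which determines
  \<open>g\<close> on all integers. The cocycle identity with third argument \<open>a\<close> then
  carries the equation from the pair \<open>m\<close>, \<open>n\<close> to \<open>m\<close>,
  \<open>n + 1\<close> and back.\<close>

lemma trivialises_cyclic:
  fixes a :: "'g::ring_1"
  assumes M: "circle_function_group X M" and A: "additive_subgroup A" and a: "a \<in> A"
    and s: "symmetric_cocycle X M A s"
  obtains g where "\<And>n. (\<lambda>x. g x n) \<in> M"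
    "\<And>x m n. x \<in> X \<Longrightarrow> g x (m + n) = g x m * g x n * s x (of_int m * a) (of_int n * a)"
proof -
  note MD = circle_function_groupD[OF M]
  note mult = additive_subgroup_multiple[OF A a]
  have sM: "(\<lambda>x. s x p q) \<in> M" if "p \<in> A" "q \<in> A" for p q
    using s that by (auto simp: symmetric_cocycle_def)
  have prodM: "(\<lambda>x. \<Prod>i<(N::nat). h i x) \<in> M" if "\<And>i. h i \<in> M" for h N
  proof (induction N)
    case (Suc N)
    then show ?case using MD(2)[OF Suc that] by simp
  qed (use MD(1) in simp)
  \<comment> \<open>For negative \<open>n\<close> the recursion is solved backwards, with the
    conjugated factors at -1, ..., \<open>n\<close>; hence the offset
    \<open>- int i - 1\<close>.\<close>
  define g where "g x n = (if n \<ge> 0 then \<Prod>i<nat n. s x (of_int (int i) * a) a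
     else \<Prod>i<nat (- n). cnj (s x (of_int (- int i - 1) * a) a))" for x n
  have gM: "(\<lambda>x. g x n) \<in> M" for n
  proof (cases "n \<ge> 0")
    case True
    then show ?thesis
      unfolding g_def by (simp only: if_True) (rule prodM, rule sM[OF mult a])
  next
    case False
    then show ?thesis
      unfolding g_def by (simp only: if_False) (rule prodM, rule MD(3), rule sM[OF mult a])
  qed
  show thesis
  proof (rule that)
    show "(\<lambda>x. g x n) \<in> M" for n by (rule gM)
    fix x m n assume x: "x \<in> X"
    have nrm: "norm (s x p q) = 1" if "p \<in> A" "q \<in> A" for p q
      using MD(4)[OF sM[OF that] x] .
    have sn: "s x p 0 = 1" if "p \<in> A" for p
      using s x that by (auto simp: symmetric_cocycle_def)
    have co: "s x q r * s x p (q + r) = s x p q * s x (p + q) r"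
      if "p \<in> A" "q \<in> A" "r \<in> A" for p q r
      using s x that by (auto simp: symmetric_cocycle_def)
    have rec: "g x (n + 1) = g x n * s x (of_int n * a) a" for n
    proof (cases "n \<ge> 0")
      case True
      then have "nat (n + 1) = Suc (nat n)" by simp
      with True show ?thesis by (simp add: g_def)
    next
      case False
      define j where "j = nat (- n - 1)"
      have n: "n = - int j - 1" and j: "nat (- n) = Suc j" using False by (auto simp: j_def)
      have gn: "g x n = g x (n + 1) * cnj (s x (of_int n * a) a)"
        using False unfolding g_def j by (cases "j = 0") (auto simp: n)
      show ?thesis unfolding gn using circle_cnj(2)[OF nrm[OF mult[of n] a]] by (simp add: mult.assoc)
    qed
    \<comment> \<open>An equivalence is proved, since the integer induction below climbs from 0 in
      one case and descends in the other.\<close>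
    have step: "g x (m + (n + 1)) = g x m * g x (n + 1) * s x (of_int m * a) (of_int (n + 1) * a)
      \<longleftrightarrow> g x (m + n) = g x m * g x n * s x (of_int m * a) (of_int n * a)" for n
    proof -
      let ?u = "s x (of_int (m + n) * a) a" and ?v = "s x (of_int n * a) a"
      have nz: "?u \<noteq> 0" using nrm[OF mult[of "m + n"] a] by auto
      have c: "?v * s x (of_int m * a) (of_int (n + 1) * a) = s x (of_int m * a) (of_int n * a) * ?u"
        using co[OF mult[of m] mult[of n] a] by (simp add: algebra_simps)
      have "g x m * g x (n + 1) * s x (of_int m * a) (of_int (n + 1) * a)
        = g x m * g x n * (?v * s x (of_int m * a) (of_int (n + 1) * a))"
        by (simp add: rec)
      also have "\<dots> = g x m * g x n * s x (of_int m * a) (of_int n * a) * ?u"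
        unfolding c by simp
      finally have e: "g x m * g x (n + 1) * s x (of_int m * a) (of_int (n + 1) * a)
        = g x m * g x n * s x (of_int m * a) (of_int n * a) * ?u" .
      have "g x (m + (n + 1)) = g x (m + n) * ?u" using rec[of "m + n"] by (simp only: add.assoc)
      then show ?thesis unfolding e using nz by (simp only: mult_cancel_right simp_thms)
    qed
    show "g x (m + n) = g x m * g x n * s x (of_int m * a) (of_int n * a)"
    proof (induction n rule: int_induct[where k=0])
      case base
      have "g x 0 = 1" by (simp add: g_def)
      then show ?case using sn[OF mult[of m]] by simp
    next
      case (step1 i)
      then show ?case using step[of i] by simp
    next
      case (step2 i)
      then show ?case using step[of "i - 1"] by simp
    qed
  qed
qed

text \<open>The inductive step for a subgroup \<open>A\<close> that is the direct sum of the kernel of \<open>\<nu>\<close> and of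
  the cyclic group generated by \<open>a\<close>.\<close>

lemma trivialises_split:
  fixes a :: "'g::ring_1" and \<nu> :: "'g \<Rightarrow> int"
  assumes M: "circle_function_group X M" and A: "additive_subgroup A" and a: "a \<in> A" "\<nu> a = 1"
    and \<nu>: "\<And>p q. p \<in> A \<Longrightarrow> q \<in> A \<Longrightarrow> \<nu> (p + q) = \<nu> p + \<nu> q"
    and s: "symmetric_cocycle X M A s"
    and f: "trivialises X M {p \<in> A. \<nu> p = 0} f s"
  shows "\<exists>f. trivialises X M A f s"
proof -
  note MD = circle_function_groupD[OF M] and AD = additive_subgroupD[OF A]
  note mult = additive_subgroup_multiple[OF A a(1)]
  obtain g where gM: "\<And>n. (\<lambda>x. g x n) \<in> M"
    and g: "\<And>x m n. x \<in> X \<Longrightarrow> g x (m + n) = g x m * g x n * s x (of_int m * a) (of_int n * a)"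
    by (rule trivialises_cyclic[OF M A a(1) s]) blast
  have \<nu>0: "\<nu> 0 = 0" using \<nu>[OF AD(1) AD(1)] by simp
  have \<nu>mult: "\<nu> (of_int n * a) = n" for n
  proof (induction n rule: int_induct[where k=0])
    case (step1 i)
    then show ?case using \<nu>[OF mult[of i] a(1)] a(2) by (simp add: algebra_simps)
  next
    case (step2 i)
    then show ?case using \<nu>[OF mult[of "i - 1"] a(1)] a(2) by (simp add: algebra_simps)
  qed (simp add: \<nu>0)
  define t where "t p = of_int (\<nu> p) * a" for p
  define u where "u p = p - t p" for p
  have tA: "t p \<in> A" for p by (simp add: t_def mult)
  have uA: "u p \<in> A" if "p \<in> A" for p unfolding u_def using that tA AD(2) by blast
  have put: "u p + t p = p" for p by (simp add: u_def)
  have \<nu>u: "\<nu> (u p) = 0" if "p \<in> A" for p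
    using \<nu>[OF uA[OF that] tA[of p]] put[of p] by (simp add: t_def \<nu>mult)
  have tadd: "t (p + q) = t p + t q" if "p \<in> A" "q \<in> A" for p q
    using that by (simp add: t_def \<nu> algebra_simps)
  have uadd: "u (p + q) = u p + u q" if "p \<in> A" "q \<in> A" for p q
    using that by (simp add: u_def tadd)
  \<comment> \<open>The coboundary equation at \<open>p = u p + t p\<close> forces this formula: the
    values on the two summands are prescribed and \<open>s x (u p) (t p)\<close> glues them.\<close>
  define F where "F x p = f x (u p) * g x (\<nu> p) * s x (u p) (t p)" for x p
  have sM: "(\<lambda>x. s x p q) \<in> M" if "p \<in> A" "q \<in> A" for p q
    using s that by (auto simp: symmetric_cocycle_def)
  have FM: "(\<lambda>x. F x p) \<in> M" if "p \<in> A" for p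
    unfolding F_def using that f uA tA \<nu>u
    by (intro MD(2) gM sM) (auto simp: trivialises_def)
  have "F x (p + q) = F x p * F x q * s x p q" if x: "x \<in> X" and p: "p \<in> A" and q: "q \<in> A" for x p q
  proof -
    have co: "s x q r * s x p (q + r) = s x p q * s x (p + q) r"
      if "p \<in> A" "q \<in> A" "r \<in> A" for p q r
      using s x that by (auto simp: symmetric_cocycle_def)
    have sym: "s x p q = s x q p" if "p \<in> A" "q \<in> A" for p q
      using s x that by (auto simp: symmetric_cocycle_def)
    have f1: "f x (u p + u q) = f x (u p) * f x (u q) * s x (u p) (u q)"
      using f x p q \<nu>u uA unfolding trivialises_def by blast
    have g1: "g x (\<nu> (p + q)) = g x (\<nu> p) * g x (\<nu> q) * s x (t p) (t q)"
      using \<nu>[OF p q] g[OF x] by (simp add: t_def)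
    \<comment> \<open>Both sides are ways of adding up \<open>u p\<close>, \<open>u q\<close>,
      \<open>t p\<close>, \<open>t q\<close>. Four cocycle identities change the bracketing, and
      symmetry is used once, to exchange \<open>u q\<close> and \<open>t p\<close>.\<close>
    have "s x (u p) (u q) * (s x (t p) (t q) * s x (u p + u q) (t p + t q))
       = s x (u p) (u q) * s x (u p + u q) (t p) * s x (u p + u q + t p) (t q)"
      using co[OF AD(4)[OF uA[OF p] uA[OF q]] tA[of p] tA[of q]] by simp
    also have "\<dots> = s x (u q) (t p) * s x (u p) (u q + t p) * s x (u p + u q + t p) (t q)"
      using co[OF uA[OF p] uA[OF q] tA[of p]] by simp
    also have "\<dots> = s x (t p) (u q) * s x (u p) (t p + u q) * s x (u p + t p + u q) (t q)"
      using sym[OF uA[OF q] tA[of p]] by (simp add: ac_simps)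
    also have "\<dots> = s x (u p) (t p) * s x (u p + t p) (u q) * s x (u p + t p + u q) (t q)"
      using co[OF uA[OF p] tA[of p] uA[OF q]] by simp
    also have "\<dots> = s x (u p) (t p) * (s x (u q) (t q) * s x (u p + t p) (u q + t q))"
      using co[OF AD(4)[OF uA[OF p] tA[of p]] uA[OF q] tA[of q]] by simp
    also have "\<dots> = s x (u p) (t p) * s x (u q) (t q) * s x p q"
      by (simp add: put)
    finally have "s x (u p) (u q) * s x (t p) (t q) * s x (u p + u q) (t p + t q)
       = s x (u p) (t p) * s x (u q) (t q) * s x p q" by (simp add: mult.assoc)
    moreover have "F x (p + q) = f x (u p) * f x (u q) * g x (\<nu> p) * g x (\<nu> q) *
        (s x (u p) (u q) * s x (t p) (t q) * s x (u p + u q) (t p + t q))"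
      unfolding F_def uadd[OF p q] tadd[OF p q] f1 g1 by (simp add: mult_ac)
    ultimately show ?thesis unfolding F_def by (simp add: mult_ac)
  qed
  with FM have "trivialises X M A F s" unfolding trivialises_def by blast
  then show ?thesis by blast
qed

lemma trivialises_zero:
  assumes M: "circle_function_group X M"
    and s: "symmetric_cocycle X M {0} s"
  shows "\<exists>f. trivialises X M {0} f s"
  using assms
  by (intro exI[of _ "\<lambda>_ _. 1"])
    (auto simp: trivialises_def circle_function_group_def symmetric_cocycle_def)

section \<open>Bicharacters with a prescribed alternating commutator\<close>

definition alternating_bicharacter :: "'g::ab_group_add set \<Rightarrow> ('g \<Rightarrow> 'g \<Rightarrow> complex) \<Rightarrow> bool" where
  "alternating_bicharacter A \<kappa> \<longleftrightarrow> bicharacter A \<kappa> \<and> (\<forall>p\<in>A. \<kappa> p p = 1)"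

lemma bicharacterD:
  assumes "bicharacter A w"
  shows "p \<in> A \<Longrightarrow> q \<in> A \<Longrightarrow> norm (w p q) = 1"
    "p \<in> A \<Longrightarrow> p' \<in> A \<Longrightarrow> q \<in> A \<Longrightarrow> w (p + p') q = w p q * w p' q"
    "p \<in> A \<Longrightarrow> q \<in> A \<Longrightarrow> q' \<in> A \<Longrightarrow> w p (q + q') = w p q * w p q'"
  using assms by (auto simp: bicharacter_def)

lemma bicharacter_zero:
  assumes "bicharacter A w" "0 \<in> A" "p \<in> A"
  shows "w p 0 = 1" "w 0 p = 1"
  using bicharacterD(3)[OF assms(1,3,2,2)] bicharacterD(1)[OF assms(1,3,2)]
    bicharacterD(2)[OF assms(1,2,2,3)] bicharacterD(1)[OF assms(1,2,3)]
  by auto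

text \<open>Polarisation of \<open>\<kappa> (p + q) (p + q) = 1\<close>.\<close>

lemma alternating_bicharacter_swap:
  assumes A: "additive_subgroup A" and \<kappa>: "alternating_bicharacter A \<kappa>" and p: "p \<in> A" and q: "q \<in> A"
  shows "\<kappa> p q * \<kappa> q p = 1"
proof -
  have b: "bicharacter A \<kappa>" using \<kappa> by (simp add: alternating_bicharacter_def)
  have pq: "p + q \<in> A" using additive_subgroupD(4)[OF A p q] .
  have "1 = \<kappa> (p + q) (p + q)" using \<kappa> pq by (simp add: alternating_bicharacter_def)
  also have "\<dots> = \<kappa> p p * \<kappa> p q * (\<kappa> q p * \<kappa> q q)"
    using bicharacterD(2)[OF b p q pq] bicharacterD(3)[OF b p p q] bicharacterD(3)[OF b q p q] by simp
  finally show ?thesis using \<kappa> p q by (simp add: alternating_bicharacter_def)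
qed

lemma alternating_bicharacter_cyclic:
  fixes a :: "'g::ring_1"
  assumes A: "additive_subgroup A" and \<kappa>: "alternating_bicharacter A \<kappa>" and a: "a \<in> A"
  shows "\<kappa> (of_int n * a) (of_int m * a) = 1"
proof -
  have b: "bicharacter A \<kappa>" using \<kappa> by (simp add: alternating_bicharacter_def)
  note mult = additive_subgroup_multiple[OF A a] and z = bicharacter_zero[OF b additive_subgroupD(1)[OF A]]
  have 1: "\<kappa> (of_int n * a) a = 1" for n
  proof (induction n rule: int_induct[where k=0])
    case base
    then show ?case using z a by simp
  next
    case (step1 i)
    then show ?case using bicharacterD(2)[OF b mult[of i] a a] \<kappa> a
      by (simp add: alternating_bicharacter_def algebra_simps)
  next
    case (step2 i)
    then show ?case using bicharacterD(2)[OF b mult[of "i - 1"] a a] \<kappa> a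
      by (simp add: alternating_bicharacter_def algebra_simps)
  qed
  show ?thesis
  proof (induction m rule: int_induct[where k=0])
    case base
    then show ?case using z mult by simp
  next
    case (step1 i)
    then show ?case using bicharacterD(3)[OF b mult[of n] mult[of i] a] 1
      by (simp add: algebra_simps)
  next
    case (step2 i)
    then show ?case using bicharacterD(3)[OF b mult[of n] mult[of "i - 1"] a] 1
      by (simp add: algebra_simps)
  qed
qed

definition commutator_of ::
  "'g::ab_group_add set \<Rightarrow> ('g \<Rightarrow> 'g \<Rightarrow> complex) \<Rightarrow> ('g \<Rightarrow> 'g \<Rightarrow> complex) \<Rightarrow> bool" where
  "commutator_of A \<kappa> w \<longleftrightarrow> (\<forall>p\<in>A. \<forall>q\<in>A. w p q = \<kappa> p q * w q p)"

text \<open>All of the mixed part of \<open>\<kappa>\<close> is put on one side: \<open>W\<close>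
  carries \<open>\<kappa> (t p) (u q)\<close> but no term in \<open>u p\<close>, \<open>t q\<close>,
  like an upper triangular matrix with given antisymmetrisation. Between multiples of
  \<open>a\<close> nothing has to be added, because there \<open>\<kappa>\<close> is 1.\<close>

lemma commutator_of_split:
  fixes a :: "'g::ring_1" and \<nu> :: "'g \<Rightarrow> int"
  assumes A: "additive_subgroup A" and a: "a \<in> A" "\<nu> a = 1"
    and \<nu>: "\<And>p q. p \<in> A \<Longrightarrow> q \<in> A \<Longrightarrow> \<nu> (p + q) = \<nu> p + \<nu> q"
    and \<kappa>: "alternating_bicharacter A \<kappa>"
    and w: "bicharacter {p \<in> A. \<nu> p = 0} w" "commutator_of {p \<in> A. \<nu> p = 0} \<kappa> w"
  shows "\<exists>w. bicharacter A w \<and> commutator_of A \<kappa> w"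
proof -
  have b: "bicharacter A \<kappa>" using \<kappa> by (simp add: alternating_bicharacter_def)
  note AD = additive_subgroupD[OF A]
  note mult = additive_subgroup_multiple[OF A a(1)]
  have \<nu>0: "\<nu> 0 = 0" using \<nu>[OF AD(1) AD(1)] by simp
  have \<nu>mult: "\<nu> (of_int n * a) = n" for n
  proof (induction n rule: int_induct[where k=0])
    case (step1 i)
    then show ?case using \<nu>[OF mult[of i] a(1)] a(2) by (simp add: algebra_simps)
  next
    case (step2 i)
    then show ?case using \<nu>[OF mult[of "i - 1"] a(1)] a(2) by (simp add: algebra_simps)
  qed (simp add: \<nu>0)
  define t where "t p = of_int (\<nu> p) * a" for p
  define u where "u p = p - t p" for p
  have tA: "t p \<in> A" for p by (simp add: t_def mult)
  have uA: "u p \<in> A" if "p \<in> A" for p unfolding u_def using that tA AD(2) by blast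
  have put: "u p + t p = p" for p by (simp add: u_def)
  have \<nu>u: "\<nu> (u p) = 0" if "p \<in> A" for p
    using \<nu>[OF uA[OF that] tA[of p]] put[of p] by (simp add: t_def \<nu>mult)
  have tadd: "t (p + q) = t p + t q" if "p \<in> A" "q \<in> A" for p q
    using that by (simp add: t_def \<nu> algebra_simps)
  have uadd: "u (p + q) = u p + u q" if "p \<in> A" "q \<in> A" for p q
    using that by (simp add: u_def tadd)
  have uK: "u p \<in> {p \<in> A. \<nu> p = 0}" if "p \<in> A" for p using that uA \<nu>u by simp
  define W where "W p q = w (u p) (u q) * \<kappa> (t p) (u q)" for p q
  have "bicharacter A W"
    unfolding bicharacter_def
  proof (intro conjI ballI)
    fix p q assume "p \<in> A" "q \<in> A"
    then show "W p q \<in> sphere 0 1"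
      using bicharacterD(1)[OF w(1) uK uK] bicharacterD(1)[OF b tA uA]
      by (simp add: W_def norm_mult)
  next
    fix p p' q assume "p \<in> A" "p' \<in> A" "q \<in> A"
    then show "W (p + p') q = W p q * W p' q"
      using bicharacterD(2)[OF w(1) uK uK uK] bicharacterD(2)[OF b tA tA uA]
      by (simp add: W_def uadd tadd)
  next
    fix p q q' assume "p \<in> A" "q \<in> A" "q' \<in> A"
    then show "W p (q + q') = W p q * W p q'"
      using bicharacterD(3)[OF w(1) uK uK uK] bicharacterD(3)[OF b tA uA uA]
      by (simp add: W_def uadd tadd)
  qed
  moreover have "commutator_of A \<kappa> W"
    unfolding commutator_of_def
  proof (intro ballI)
    fix p q assume p: "p \<in> A" and q: "q \<in> A"
    have "\<kappa> p q = \<kappa> (u p + t p) (u q + t q)" by (simp add: put)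
    also have "\<dots> = \<kappa> (u p) (u q) * \<kappa> (u p) (t q) * (\<kappa> (t p) (u q) * \<kappa> (t p) (t q))"
      using bicharacterD(2)[OF b uA[OF p] tA AD(4)[OF uA[OF q] tA]]
        bicharacterD(3)[OF b uA[OF p] uA[OF q] tA] bicharacterD(3)[OF b tA uA[OF q] tA]
      by simp
    also have "\<kappa> (t p) (t q) = 1"
      unfolding t_def by (rule alternating_bicharacter_cyclic[OF A \<kappa> a(1)])
    finally have e: "\<kappa> p q = \<kappa> (u p) (u q) * \<kappa> (u p) (t q) * \<kappa> (t p) (u q)" by simp
    have sw: "\<kappa> (u p) (t q) * \<kappa> (t q) (u p) = 1"
      by (rule alternating_bicharacter_swap[OF A \<kappa> uA[OF p] tA])
    have c: "w (u p) (u q) = \<kappa> (u p) (u q) * w (u q) (u p)"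
      using w(2) uK p q unfolding commutator_of_def by blast
    have "\<kappa> p q * W q p = (\<kappa> (u p) (u q) * w (u q) (u p)) * \<kappa> (t p) (u q) * (\<kappa> (u p) (t q) * \<kappa> (t q) (u p))"
      unfolding e W_def by (simp add: mult_ac)
    then show "W p q = \<kappa> p q * W q p" unfolding sw c[symmetric] W_def by simp
  qed
  ultimately show ?thesis by blast
qed

lemma commutator_of_zero:
  assumes \<kappa>: "alternating_bicharacter {0} \<kappa>"
  shows "\<exists>w. bicharacter {0} w \<and> commutator_of {0} \<kappa> w"
  using assms
  by (intro exI[of _ "\<lambda>_ _. 1"])
    (auto simp: bicharacter_def commutator_of_def alternating_bicharacter_def)

section \<open>Induction over subgroups of Z^k\<close>

lemma of_int_fun: "(of_int n :: 'i \<Rightarrow> int) i = n"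
  by (induction n rule: int_induct[where k=0]) auto

text \<open>The coordinates \<open>p i\<close> of elements of \<open>A\<close> form the ideal
  generated by the least positive one, \<open>d\<close>; \<open>a\<close> attains \<open>d\<close>,
  and \<open>\<nu>\<close> divides the coordinate by \<open>d\<close>.\<close>

lemma additive_subgroup_coordinate_generator:
  fixes A :: "('i \<Rightarrow> int) set"
  assumes A: "additive_subgroup A" and nz: "\<exists>p\<in>A. p i \<noteq> 0"
  obtains a and \<nu> :: "('i \<Rightarrow> int) \<Rightarrow> int" where "a \<in> A" "\<nu> a = 1" "\<And>p q. p \<in> A \<Longrightarrow> q \<in> A \<Longrightarrow> \<nu> (p + q) = \<nu> p + \<nu> q"
    "\<And>p. p \<in> A \<Longrightarrow> \<nu> p = 0 \<longleftrightarrow> p i = 0"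
proof -
  note AD = additive_subgroupD[OF A]
  define d where "d = (LEAST n::nat. n > 0 \<and> (\<exists>p\<in>A. p i = int n))"
  have ex: "\<exists>n::nat. n > 0 \<and> (\<exists>p\<in>A. p i = int n)"
  proof -
    obtain p where p: "p \<in> A" "p i \<noteq> 0" using nz by blast
    show ?thesis
    proof (cases "p i > 0")
      case True
      then show ?thesis using p by (intro exI[of _ "nat (p i)"]) auto
    next
      case False
      then show ?thesis using p AD(3)[OF p(1)]
        by (intro exI[of _ "nat (- p i)"] conjI bexI[of _ "- p"]) auto
    qed
  qed
  have "d > 0 \<and> (\<exists>p\<in>A. p i = int d)" unfolding d_def by (rule LeastI_ex[OF ex])
  then obtain a where d: "d > 0" and a: "a \<in> A" "a i = int d" by blast
  have dv: "int d dvd p i" if p: "p \<in> A" for p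
  proof (rule ccontr)
    assume nd: "\<not> int d dvd p i"
    let ?r = "p - of_int (p i div int d) * a"
    have rA: "?r \<in> A" using AD(2)[OF p additive_subgroup_multiple[OF A a(1)]] .
    have ri: "?r i = p i mod int d"
      by (simp add: of_int_fun a(2) minus_div_mult_eq_mod[symmetric] mult.commute)
    have r0: "p i mod int d > 0" using nd d
      by (metis dvd_eq_mod_eq_0 of_nat_0_less_iff order_le_less pos_mod_sign)
    have rd: "p i mod int d < int d" using d by simp
    have "nat (p i mod int d) > 0 \<and> (\<exists>q\<in>A. q i = int (nat (p i mod int d)))"
      using rA ri r0 by (intro conjI bexI[of _ ?r]) auto
    then have "d \<le> nat (p i mod int d)" unfolding d_def by (rule Least_le)
    then show False using rd r0 by linarith
  qed
  show thesis
  proof (rule that[of a "\<lambda>p. p i div int d"])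
    show "a \<in> A" by (rule a)
    show "a i div int d = 1" using a d by simp
    show "(p + q) i div int d = p i div int d + q i div int d" if "p \<in> A" "q \<in> A" for p q
      using dv[OF that(1)] by (simp add: div_plus_div_distrib_dvd_left)
    show "p i div int d = 0 \<longleftrightarrow> p i = 0" if "p \<in> A" for p
      using dv[OF that] d by (auto simp: dvd_def)
  qed
qed

text \<open>Takes the place of a basis of the free group \<open>A\<close>: the coordinates are
  removed from the last one on, and a coordinate that vanishes on \<open>A\<close> costs no
  splitting step. \<open>Q\<close> is kept abstract because two extension problems run along the
  same kind of splitting.\<close>

lemma additive_subgroup_induct:
  fixes A :: "(nat \<Rightarrow> int) set"
  assumes A: "additive_subgroup A" and bound: "\<forall>p\<in>A. \<forall>i\<ge>k. p i = 0"
    and zero: "Q {0}"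
    and split: "\<And>A a \<nu>. additive_subgroup A \<Longrightarrow> a \<in> A \<Longrightarrow> \<nu> a = 1 \<Longrightarrow>
      (\<And>p q. p \<in> A \<Longrightarrow> q \<in> A \<Longrightarrow> \<nu> (p + q) = \<nu> p + \<nu> q) \<Longrightarrow> Q {p \<in> A. \<nu> p = (0::int)} \<Longrightarrow> Q A"
  shows "Q A"
  using A bound
proof (induction k arbitrary: A)
  case 0
  then have "A = {0}" using additive_subgroupD(1)[OF 0(1)] by (auto simp: fun_eq_iff)
  then show ?case using zero by simp
next
  case (Suc k)
  show ?case
  proof (cases "\<exists>p\<in>A. p k \<noteq> 0")
    case True
    obtain a and \<nu> :: "(nat \<Rightarrow> int) \<Rightarrow> int" where a: "a \<in> A" "\<nu> a = 1" "\<And>p q. p \<in> A \<Longrightarrow> q \<in> A \<Longrightarrow> \<nu> (p + q) = \<nu> p + \<nu> q"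
      and k: "\<And>p. p \<in> A \<Longrightarrow> \<nu> p = 0 \<longleftrightarrow> p k = 0"
      by (rule additive_subgroup_coordinate_generator[OF Suc.prems(1) True]) blast
    have e: "{p \<in> A. \<nu> p = 0} = {p \<in> A. p k = 0}" using k by blast
    have K: "additive_subgroup {p \<in> A. p k = 0}"
      using Suc.prems(1) unfolding additive_subgroup_def by simp
    have "\<forall>p\<in>{p \<in> A. p k = 0}. \<forall>i\<ge>k. p i = 0"
    proof (intro ballI allI impI)
      fix p i assume "p \<in> {p \<in> A. p k = 0}" "i \<ge> k"
      then show "p i = 0" using Suc.prems(2) by (cases "i = k") auto
    qed
    from Suc.IH[OF K this] have "Q {p \<in> A. \<nu> p = 0}" unfolding e .
    then show ?thesis using split[where \<nu>=\<nu>, OF Suc.prems(1) a(1,2)] a(3) by blast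
  next
    case False
    have "\<forall>p\<in>A. \<forall>i\<ge>k. p i = 0"
    proof (intro ballI allI impI)
      fix p i assume "p \<in> A" "i \<ge> k"
      then show "p i = 0" using Suc.prems(2) False by (cases "i = k") auto
    qed
    from Suc.IH[OF Suc.prems(1) this] show ?thesis .
  qed
qed

lemma symmetric_cocycle_trivial:
  fixes A :: "(nat \<Rightarrow> int) set"
  assumes A: "additive_subgroup A" and bound: "\<forall>p\<in>A. \<forall>i\<ge>k. p i = 0"
    and M: "circle_function_group X M" and s: "symmetric_cocycle X M A s"
  shows "\<exists>f. trivialises X M A f s"
proof -
  have "symmetric_cocycle X M A s \<longrightarrow> (\<exists>f. trivialises X M A f s)"
  proof (rule additive_subgroup_induct[OF A bound])
    show "symmetric_cocycle X M {0} s \<longrightarrow> (\<exists>f. trivialises X M {0} f s)"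
      using trivialises_zero[OF M] by blast
  next
    fix A a and \<nu> :: "(nat \<Rightarrow> int) \<Rightarrow> int"
    assume h: "additive_subgroup A" "a \<in> A" "\<nu> a = 1" "\<And>p q. p \<in> A \<Longrightarrow> q \<in> A \<Longrightarrow> \<nu> (p + q) = \<nu> p + \<nu> q"
      and IH: "symmetric_cocycle X M {p \<in> A. \<nu> p = 0} s \<longrightarrow> (\<exists>f. trivialises X M {p \<in> A. \<nu> p = 0} f s)"
    show "symmetric_cocycle X M A s \<longrightarrow> (\<exists>f. trivialises X M A f s)"
    proof
      assume s: "symmetric_cocycle X M A s"
      then have "symmetric_cocycle X M {p \<in> A. \<nu> p = 0} s" by (auto simp: symmetric_cocycle_def)
      then show "\<exists>f. trivialises X M A f s" using IH trivialises_split[OF M h s] by blast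
    qed
  qed
  then show ?thesis using s by blast
qed

lemma alternating_bicharacter_is_commutator:
  fixes A :: "(nat \<Rightarrow> int) set"
  assumes A: "additive_subgroup A" and bound: "\<forall>p\<in>A. \<forall>i\<ge>k. p i = 0"
    and \<kappa>: "alternating_bicharacter A \<kappa>"
  shows "\<exists>w. bicharacter A w \<and> commutator_of A \<kappa> w"
proof -
  have "alternating_bicharacter A \<kappa> \<longrightarrow> (\<exists>w. bicharacter A w \<and> commutator_of A \<kappa> w)"
  proof (rule additive_subgroup_induct[OF A bound])
    show "alternating_bicharacter {0} \<kappa> \<longrightarrow> (\<exists>w. bicharacter {0} w \<and> commutator_of {0} \<kappa> w)"
      using commutator_of_zero by blast
  next
    fix A a and \<nu> :: "(nat \<Rightarrow> int) \<Rightarrow> int"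
    assume h: "additive_subgroup A" "a \<in> A" "\<nu> a = 1" "\<And>p q. p \<in> A \<Longrightarrow> q \<in> A \<Longrightarrow> \<nu> (p + q) = \<nu> p + \<nu> q"
      and IH: "alternating_bicharacter {p \<in> A. \<nu> p = 0} \<kappa> \<longrightarrow>
        (\<exists>w. bicharacter {p \<in> A. \<nu> p = 0} w \<and> commutator_of {p \<in> A. \<nu> p = 0} \<kappa> w)"
    show "alternating_bicharacter A \<kappa> \<longrightarrow> (\<exists>w. bicharacter A w \<and> commutator_of A \<kappa> w)"
    proof
      assume \<kappa>: "alternating_bicharacter A \<kappa>"
      then have "alternating_bicharacter {p \<in> A. \<nu> p = 0} \<kappa>"
        by (auto simp: alternating_bicharacter_def bicharacter_def)
      then show "\<exists>w. bicharacter A w \<and> commutator_of A \<kappa> w"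
        using IH commutator_of_split[OF h \<kappa>] by blast
    qed
  qed
  then show ?thesis using \<kappa> by blast
qed

section \<open>Degrees\<close>

lemma Nk_simps [simp, intro]:
  "0 \<in> Nk k" "m \<in> Nk k \<Longrightarrow> n \<in> Nk k \<Longrightarrow> m + n \<in> Nk k" "m \<in> Nk k \<Longrightarrow> m - n \<in> Nk k"
  by (auto simp: Nk_def)

lemma Nk_leE:
  assumes "m \<le> n" "n \<in> Nk k"
  obtains j where "j \<in> Nk k" "n = m + j"
proof -
  have "n = m + (n - m)" using assms(1) by (auto simp: le_fun_def fun_eq_iff)
  moreover have "n - m \<in> Nk k" using assms(2) by simp
  ultimately show thesis using that by blast
qed

lemma nat_fun_arith [simp]:
  "m \<le> m + n" "n \<le> m + n" "(0::'i \<Rightarrow> nat) \<le> n" "m + n - m = n" "m - m = 0" "m - 0 = m"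
  "m + l \<le> m + n \<longleftrightarrow> l \<le> n" "l + m \<le> n + m \<longleftrightarrow> l \<le> n" "(m + n) - (m + l) = n - l"
  for m n l :: "'i \<Rightarrow> nat"
  by (auto simp: le_fun_def fun_eq_iff)

text \<open>\<open>lev m l l'\<close>: near an arrow \<open>(x, m, y)\<close>, the initial segments of degrees \<open>l\<close> of \<open>x\<close> and \<open>l'\<close>
  of \<open>y\<close> correspond to each other.\<close>

definition lev :: "nat \<Rightarrow> (nat \<Rightarrow> int) \<Rightarrow> (nat \<Rightarrow> nat) \<Rightarrow> (nat \<Rightarrow> nat) \<Rightarrow> bool" where
  "lev k m l l' \<longleftrightarrow> l \<in> Nk k \<and> l' \<in> Nk k \<and> zdiff l l' = m"

lemma levD: "lev k m l l' \<Longrightarrow> l \<in> Nk k" "lev k m l l' \<Longrightarrow> l' \<in> Nk k" "lev k m l l' \<Longrightarrow> zdiff l l' = m"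
  by (auto simp: lev_def)

lemma lev_add: "lev k m l l' \<Longrightarrow> n \<in> Nk k \<Longrightarrow> lev k m (l + n) (l' + n)"
  by (auto simp: lev_def zdiff_def)

lemma lev_trans: "lev k m l l' \<Longrightarrow> lev k n l' l'' \<Longrightarrow> lev k (m + n) l l''"
  by (auto simp: lev_def zdiff_def)

lemma lev_refl: "l \<in> Nk k \<Longrightarrow> lev k 0 l l"
  by (auto simp: lev_def zdiff_def)

lemma lev_unique: "lev k m l l' \<Longrightarrow> lev k m l l'' \<Longrightarrow> l' = l''"
  by (auto simp: lev_def zdiff_def fun_eq_iff) (smt (verit) of_nat_eq_iff)

lemma lev_leE:
  assumes "lev k m a b" "lev k m l l'" "a \<le> l"
  obtains n where "n \<in> Nk k" "l = a + n" "l' = b + n"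
proof -
  obtain n where n: "n \<in> Nk k" "l = a + n"
    using Nk_leE[OF assms(3) levD(1)[OF assms(2)]] by blast
  then have "l' = b + n" using assms lev_add[OF assms(1) n(1)] lev_unique by blast
  with n that show thesis by blast
qed

lemma lev_common:
  assumes "lev k m a b" "lev k n a' b'" "c \<in> Nk k"
  obtains L L' L'' where "lev k m L L'" "lev k n L' L''" "a \<le> L" "a' \<le> L'" "c \<le> L" "b \<le> L'"
proof (rule that)
  \<comment> \<open>Both pairs of degrees are translated until they share the middle degree
    \<open>b + a' + c\<close>.\<close>
  show "lev k m (a + a' + c) (b + a' + c)" "lev k n (b + a' + c) (b + b' + c)"
    using assms by (auto simp: lev_def zdiff_def fun_eq_iff)
qed (auto simp: le_fun_def)

section \<open>Unique factorisation and infinite paths\<close>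

locale kgraph =
  fixes k :: nat and \<Lambda> :: "'a graded_cat"
  assumes kg: "k_graph k \<Lambda>"
begin

abbreviation "N \<equiv> Nk k"
abbreviation "paths \<equiv> inf_paths k \<Lambda>"
abbreviation "G \<equiv> path_groupoid k \<Lambda>"
abbreviation "sh \<equiv> shift k"

lemma cat: "category \<Lambda>" using kg by (simp add: k_graph_def)

lemma mor_src_rng [simp, intro]:
  assumes "a \<in> mor \<Lambda>"
  shows "src \<Lambda> a \<in> mor \<Lambda>" "rng \<Lambda> a \<in> mor \<Lambda>"
  using cat assms by (auto simp: category_def)

lemma src_rng_simps [simp]:
  assumes "a \<in> mor \<Lambda>"
  shows "src \<Lambda> (src \<Lambda> a) = src \<Lambda> a" "rng \<Lambda> (src \<Lambda> a) = src \<Lambda> a"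
    "src \<Lambda> (rng \<Lambda> a) = rng \<Lambda> a" "rng \<Lambda> (rng \<Lambda> a) = rng \<Lambda> a"
    "cmp \<Lambda> (rng \<Lambda> a) a = a" "cmp \<Lambda> a (src \<Lambda> a) = a"
  using cat assms by (auto simp: category_def)

lemma cmp_simps [simp]:
  assumes "a \<in> mor \<Lambda>" "b \<in> mor \<Lambda>" "src \<Lambda> a = rng \<Lambda> b"
  shows "cmp \<Lambda> a b \<in> mor \<Lambda>" "rng \<Lambda> (cmp \<Lambda> a b) = rng \<Lambda> a" "src \<Lambda> (cmp \<Lambda> a b) = src \<Lambda> b"
  using cat assms unfolding category_def by blast+

lemma cmp_assoc:
  assumes "a \<in> mor \<Lambda>" "b \<in> mor \<Lambda>" "e \<in> mor \<Lambda>" "src \<Lambda> a = rng \<Lambda> b" "src \<Lambda> b = rng \<Lambda> e"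
  shows "cmp \<Lambda> (cmp \<Lambda> a b) e = cmp \<Lambda> a (cmp \<Lambda> b e)"
  using cat assms unfolding category_def by blast

lemma deg_functor: "is_functor \<Lambda> (monoid_cat N) (deg \<Lambda>)" using kg by (simp add: k_graph_def)

lemma deg_simps [simp]:
  assumes "a \<in> mor \<Lambda>"
  shows "deg \<Lambda> a \<in> N" "deg \<Lambda> (src \<Lambda> a) = 0" "deg \<Lambda> (rng \<Lambda> a) = 0"
  using deg_functor assms by (auto simp: is_functor_def monoid_cat_def)

lemma deg_cmp [simp]:
  assumes "a \<in> mor \<Lambda>" "b \<in> mor \<Lambda>" "src \<Lambda> a = rng \<Lambda> b"
  shows "deg \<Lambda> (cmp \<Lambda> a b) = deg \<Lambda> a + deg \<Lambda> b"
  using deg_functor assms by (auto simp: is_functor_def monoid_cat_def composable_def)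

lemma factorE:
  assumes "l \<in> mor \<Lambda>" "deg \<Lambda> l = m + n" "m \<in> N" "n \<in> N"
  obtains \<alpha> \<beta> where "\<alpha> \<in> mor \<Lambda>" "\<beta> \<in> mor \<Lambda>" "deg \<Lambda> \<alpha> = m" "deg \<Lambda> \<beta> = n" "src \<Lambda> \<alpha> = rng \<Lambda> \<beta>"
    "cmp \<Lambda> \<alpha> \<beta> = l"
proof -
  have "bij_betw (\<lambda>(\<mu>, \<nu>). cmp \<Lambda> \<mu> \<nu>)
          {(\<mu>, \<nu>) \<in> level \<Lambda> m \<times> level \<Lambda> n. src \<Lambda> \<mu> = rng \<Lambda> \<nu>} (level \<Lambda> (m + n))"
    using kg assms by (simp add: k_graph_def)
  moreover have "l \<in> level \<Lambda> (m + n)" using assms by (simp add: level_def)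
  ultimately have "l \<in> (\<lambda>(\<mu>, \<nu>). cmp \<Lambda> \<mu> \<nu>) `
      {(\<mu>, \<nu>) \<in> level \<Lambda> m \<times> level \<Lambda> n. src \<Lambda> \<mu> = rng \<Lambda> \<nu>}"
    by (simp add: bij_betw_def)
  then show thesis using that by (auto simp: level_def)
qed

lemma factor_unique:
  assumes "\<alpha> \<in> mor \<Lambda>" "\<beta> \<in> mor \<Lambda>" "\<alpha>' \<in> mor \<Lambda>" "\<beta>' \<in> mor \<Lambda>" "src \<Lambda> \<alpha> = rng \<Lambda> \<beta>" "src \<Lambda> \<alpha>' = rng \<Lambda> \<beta>'"
    "cmp \<Lambda> \<alpha> \<beta> = cmp \<Lambda> \<alpha>' \<beta>'" "deg \<Lambda> \<alpha> = deg \<Lambda> \<alpha>'"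
  shows "\<alpha> = \<alpha>' \<and> \<beta> = \<beta>'"
proof -
  let ?m = "deg \<Lambda> \<alpha>" and ?n = "deg \<Lambda> \<beta>"
  have "?m + ?n = ?m + deg \<Lambda> \<beta>'" using assms deg_cmp by metis
  then have d: "deg \<Lambda> \<beta>' = ?n" by simp
  have "bij_betw (\<lambda>(\<mu>, \<nu>). cmp \<Lambda> \<mu> \<nu>)
          {(\<mu>, \<nu>) \<in> level \<Lambda> ?m \<times> level \<Lambda> ?n. src \<Lambda> \<mu> = rng \<Lambda> \<nu>} (level \<Lambda> (?m + ?n))"
    using kg assms by (simp add: k_graph_def)
  then have "inj_on (\<lambda>(\<mu>, \<nu>). cmp \<Lambda> \<mu> \<nu>)
          {(\<mu>, \<nu>) \<in> level \<Lambda> ?m \<times> level \<Lambda> ?n. src \<Lambda> \<mu> = rng \<Lambda> \<nu>}"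
    by (simp add: bij_betw_def)
  from inj_onD[OF this, of "(\<alpha>, \<beta>)" "(\<alpha>', \<beta>')"] show ?thesis using assms d
    by (auto simp: level_def)
qed

lemma deg_0_object:
  assumes "l \<in> mor \<Lambda>" "deg \<Lambda> l = 0"
  shows "rng \<Lambda> l = l" "src \<Lambda> l = l"
  using factor_unique[of "rng \<Lambda> l" l l "src \<Lambda> l"] assms by auto

lemma paths_iff:
  "x \<in> paths \<longleftrightarrow> x \<in> extensional (mor (Omega k)) \<and>
     (\<forall>m\<in>N. \<forall>n\<in>N. m \<le> n \<longrightarrow> x (m, n) \<in> mor \<Lambda> \<and> src \<Lambda> (x (m, n)) = x (n, n) \<and>
        rng \<Lambda> (x (m, n)) = x (m, m) \<and> deg \<Lambda> (x (m, n)) = n - m) \<and>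
     (\<forall>m\<in>N. \<forall>n\<in>N. \<forall>p\<in>N. m \<le> n \<longrightarrow> n \<le> p \<longrightarrow> cmp \<Lambda> (x (m, n)) (x (n, p)) = x (m, p))"
  unfolding inf_paths_def is_functor_def composable_def Omega_def by (auto 0 3)

lemma path_seg [simp]:
  assumes "x \<in> paths" "m \<in> N" "n \<in> N" "m \<le> n"
  shows "x (m, n) \<in> mor \<Lambda>" "src \<Lambda> (x (m, n)) = x (n, n)" "rng \<Lambda> (x (m, n)) = x (m, m)"
    "deg \<Lambda> (x (m, n)) = n - m"
  using assms by (auto simp: paths_iff)

lemma path_cmp:
  assumes "x \<in> paths" "m \<in> N" "n \<in> N" "p \<in> N" "m \<le> n" "n \<le> p"
  shows "cmp \<Lambda> (x (m, n)) (x (n, p)) = x (m, p)"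
  using assms unfolding paths_iff by blast

text \<open>Unique factorisation, used twice: \<open>x (0, n)\<close> determines its initial segment
  \<open>x (0, m)\<close>, and this determines its final segment \<open>x (l, m)\<close>.\<close>

lemma path_seg_eq:
  assumes x: "x \<in> paths" and y: "y \<in> paths" and N: "l \<in> N" "m \<in> N" "n \<in> N" and le: "l \<le> m" "m \<le> n"
    and e: "x (0, n) = y (0, n)"
  shows "x (l, m) = y (l, m)"
proof -
  have *: "x (0, m) = y (0, m) \<and> x (m, n) = y (m, n)" if "m \<in> N" "m \<le> n" for m
    using x y N that e path_cmp[of x 0 m n] path_cmp[of y 0 m n]
    by (intro factor_unique) auto
  have "x (0, l) = y (0, l) \<and> x (l, m) = y (l, m)"
    using x y N le *[of m] path_cmp[of x 0 l m] path_cmp[of y 0 l m]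
    by (intro factor_unique) auto
  then show ?thesis by simp
qed

lemma path_extensional: "x \<in> paths \<Longrightarrow> x \<in> extensional (mor (Omega k))"
  by (simp add: inf_paths_def)

lemma path_eqI:
  assumes x: "x \<in> paths" and y: "y \<in> paths" and p: "p \<in> N"
    and e: "\<And>n. n \<in> N \<Longrightarrow> x (0, p + n) = y (0, p + n)"
  shows "x = y"
proof (rule extensionalityI)
  show "x \<in> extensional (mor (Omega k))" "y \<in> extensional (mor (Omega k))"
    using x y by (simp_all add: path_extensional)
  fix w assume "w \<in> mor (Omega k)"
  then obtain m n where w: "w = (m, n)" "m \<in> N" "n \<in> N" "m \<le> n" by (auto simp: Omega_def)
  show "x w = y w" unfolding w(1)
  proof (rule path_seg_eq[OF x y w(2,3) _ w(4) _ e[OF w(3)]])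
    show "p + n \<in> N" using p w(3) by (rule Nk_simps)
    show "n \<le> p + n" by (rule nat_fun_arith)
  qed
qed

text \<open>Left cancellation, a case of unique factorisation, makes the factor between
  \<open>u m\<close> and \<open>u n\<close> unique; functoriality of the chosen factors follows by
  comparing them with identities and composites.\<close>

lemma path_of_family:
  assumes u: "\<And>n. n \<in> N \<Longrightarrow> u n \<in> mor \<Lambda> \<and> deg \<Lambda> (u n) = n"
    and ext: "\<And>m n. m \<in> N \<Longrightarrow> n \<in> N \<Longrightarrow> m \<le> n \<Longrightarrow>
      \<exists>\<beta>\<in>mor \<Lambda>. src \<Lambda> (u m) = rng \<Lambda> \<beta> \<and> cmp \<Lambda> (u m) \<beta> = u n"
  obtains x where "x \<in> paths" "\<And>n. n \<in> N \<Longrightarrow> x (0, n) = u n"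
proof -
  define B where "B m n \<beta> \<longleftrightarrow> \<beta> \<in> mor \<Lambda> \<and> src \<Lambda> (u m) = rng \<Lambda> \<beta> \<and> cmp \<Lambda> (u m) \<beta> = u n" for m n \<beta>
  define x where "x = restrict (\<lambda>(m, n). SOME \<beta>. B m n \<beta>) (mor (Omega k))"
  have xB: "B m n (x (m, n))" if "m \<in> N" "n \<in> N" "m \<le> n" for m n
  proof -
    have "\<exists>\<beta>. B m n \<beta>" using ext[OF that] by (auto simp: B_def)
    then show ?thesis using that by (simp add: x_def Omega_def someI_ex)
  qed
  have Bu: "\<beta> = \<beta>'" if "B m n \<beta>" "B m n \<beta>'" "m \<in> N" for m n \<beta> \<beta>'
    using factor_unique[of "u m" \<beta> "u m" \<beta>'] that u[OF that(3)] by (auto simp: B_def)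
  have idB: "B m m (src \<Lambda> (u m))" if "m \<in> N" for m
    using u[OF that] by (simp add: B_def)
  have srcB: "src \<Lambda> \<beta> = src \<Lambda> (u n)" if "B m n \<beta>" "m \<in> N" for m n \<beta>
    using that cmp_simps(3)[of "u m" \<beta>] u[OF that(2)] by (auto simp: B_def)
  have xid: "x (m, m) = src \<Lambda> (u m)" if "m \<in> N" for m
    using Bu[OF xB idB] that by auto
  have cB: "B m p (cmp \<Lambda> \<beta> \<gamma>)" if "B m n \<beta>" "B n p \<gamma>" "m \<in> N" "n \<in> N" for m n p \<beta> \<gamma>
  proof -
    have s: "src \<Lambda> \<beta> = rng \<Lambda> \<gamma>" using srcB[OF that(1,3)] that(2) by (simp add: B_def)
    then have "cmp \<Lambda> (cmp \<Lambda> (u m) \<beta>) \<gamma> = cmp \<Lambda> (u m) (cmp \<Lambda> \<beta> \<gamma>)"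
      using that u by (intro cmp_assoc) (auto simp: B_def)
    then show ?thesis using that s by (auto simp: B_def)
  qed
  have degB: "deg \<Lambda> \<beta> = n - m" if "B m n \<beta>" "m \<in> N" "n \<in> N" for m n \<beta>
  proof -
    have "m + deg \<Lambda> \<beta> = n" using that u deg_cmp[of "u m" \<beta>] by (auto simp: B_def)
    then show ?thesis by auto
  qed
  have "x \<in> paths"
    unfolding paths_iff
  proof (intro conjI ballI impI)
    show "x \<in> extensional (mor (Omega k))" by (simp add: x_def)
  next
    fix m n assume mn: "m \<in> N" "n \<in> N" "m \<le> n"
    note b = xB[OF mn]
    show "x (m, n) \<in> mor \<Lambda>" "src \<Lambda> (x (m, n)) = x (n, n)" "rng \<Lambda> (x (m, n)) = x (m, m)"
      "deg \<Lambda> (x (m, n)) = n - m"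
      using b srcB[OF b] xid degB[OF b] mn by (auto simp: B_def)
  next
    fix m n p assume "m \<in> N" "n \<in> N" "p \<in> N" "m \<le> n" "n \<le> p"
    then show "cmp \<Lambda> (x (m, n)) (x (n, p)) = x (m, p)"
      by (intro Bu[OF cB[OF xB xB] xB]) (auto intro: order.trans)
  qed
  moreover have "x (0, n) = u n" if "n \<in> N" for n
  proof -
    \<comment> \<open>\<open>u 0\<close> has degree 0 and is thus an identity, so that the factor
      from \<open>u 0\<close> to \<open>u n\<close> is \<open>u n\<close> itself.\<close>
    have u0: "src \<Lambda> (u 0) = u 0" "rng \<Lambda> (u 0) = u 0" using deg_0_object[of "u 0"] u by auto
    have b: "B 0 n (x (0, n))" using xB that by simp
    then have "u 0 = rng \<Lambda> (x (0, n))" "x (0, n) \<in> mor \<Lambda>" "cmp \<Lambda> (u 0) (x (0, n)) = u n"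
      using u0 by (auto simp: B_def)
    then show ?thesis by simp
  qed
  ultimately show thesis using that by blast
qed

section \<open>Shifting a path and putting a morphism in front of it\<close>

lemma shift_apply [simp]:
  assumes "m \<in> N" "n \<in> N" "m \<le> n"
  shows "sh p x (m, n) = x (m + p, n + p)"
  using assms by (simp add: shift_def Omega_def)

lemma shift_path [simp, intro]:
  assumes x: "x \<in> paths" and p: "p \<in> N"
  shows "sh p x \<in> paths"
  unfolding paths_iff
proof (intro conjI ballI impI)
  show "sh p x \<in> extensional (mor (Omega k))" by (simp add: shift_def)
next
  fix m n assume "m \<in> N" "n \<in> N" "m \<le> n"
  then show "sh p x (m, n) \<in> mor \<Lambda>" "src \<Lambda> (sh p x (m, n)) = sh p x (n, n)"
    "rng \<Lambda> (sh p x (m, n)) = sh p x (m, m)" "deg \<Lambda> (sh p x (m, n)) = n - m"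
    using x p by (auto simp: fun_eq_iff)
next
  fix m n q assume "m \<in> N" "n \<in> N" "q \<in> N" "m \<le> n" "n \<le> q"
  then show "cmp \<Lambda> (sh p x (m, n)) (sh p x (n, q)) = sh p x (m, q)"
    using x p path_cmp[of x "m + p" "n + p" "q + p"] by (simp add: order.trans)
qed

lemma shift_shift: "sh p (sh q x) = sh (p + q) x" if "p \<in> N"
proof
  fix w
  show "sh p (sh q x) w = sh (p + q) x w"
  proof (cases "w \<in> mor (Omega k)")
    case True
    then obtain m n where w: "w = (m, n)" "m \<in> N" "n \<in> N" "m \<le> n" by (auto simp: Omega_def)
    then show ?thesis using that by (simp add: add.assoc)
  qed (simp add: shift_def)
qed

lemma shift_0 [simp]:
  assumes "x \<in> paths" shows "sh 0 x = x"
  by (rule path_eqI[of _ _ 0]) (use assms in auto)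

lemma path_split_eq:
  assumes "x \<in> paths" "y \<in> paths" "p \<in> N" "x (0, p) = y (0, p)" "sh p x = sh p y"
  shows "x = y"
proof (rule path_eqI[OF assms(1-3)])
  fix n assume n: "n \<in> N"
  have "x (p, p + n) = y (p, p + n)"
    using shift_apply[of 0 n p x] shift_apply[of 0 n p y] assms(5) n by (simp add: add.commute)
  then show "x (0, p + n) = y (0, p + n)"
    using path_cmp[of x 0 p "p + n"] path_cmp[of y 0 p "p + n"] assms n by simp
qed

text \<open>The composites \<open>w n\<close> of \<open>l\<close> with initial segments of
  \<open>x\<close> have the degrees \<open>deg \<Lambda> l + n\<close>, but a path needs initial
  segments of every degree, also those not above \<open>deg \<Lambda> l\<close>. They are obtained
  as the initial segments \<open>u n\<close> of \<open>w n\<close>.\<close>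

lemma prepend_exists:
  assumes l: "l \<in> mor \<Lambda>" and x: "x \<in> paths" and s: "path_range x = src \<Lambda> l"
  obtains z where "z \<in> paths" "z (0, deg \<Lambda> l) = l" "sh (deg \<Lambda> l) z = x"
proof -
  let ?d = "deg \<Lambda> l"
  have s0: "x (0, 0) = src \<Lambda> l" using s by (simp add: path_range_def)
  define w where "w n = cmp \<Lambda> l (x (0, n))" for n
  have w: "w n \<in> mor \<Lambda>" "deg \<Lambda> (w n) = ?d + n" "src \<Lambda> (w n) = x (n, n)" if "n \<in> N" for n
    using that l x s0 by (auto simp: w_def)
  have w_ext: "cmp \<Lambda> (w m) (x (m, n)) = w n" if "m \<in> N" "n \<in> N" "m \<le> n" for m n
    using that l x s0 path_cmp[of x 0 m n] unfolding w_def by (subst cmp_assoc) auto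
  define I where "I n \<alpha> \<longleftrightarrow> \<alpha> \<in> mor \<Lambda> \<and> deg \<Lambda> \<alpha> = n \<and>
     (\<exists>\<beta>\<in>mor \<Lambda>. src \<Lambda> \<alpha> = rng \<Lambda> \<beta> \<and> cmp \<Lambda> \<alpha> \<beta> = w n)" for n \<alpha>
  have ex: "\<exists>\<alpha>. I n \<alpha>" if n: "n \<in> N" for n
  proof -
    obtain \<alpha> \<beta> where "\<alpha> \<in> mor \<Lambda>" "\<beta> \<in> mor \<Lambda>" "deg \<Lambda> \<alpha> = n" "deg \<Lambda> \<beta> = ?d" "src \<Lambda> \<alpha> = rng \<Lambda> \<beta>"
      "cmp \<Lambda> \<alpha> \<beta> = w n"
    proof (rule factorE[of "w n" n ?d])
      show "w n \<in> mor \<Lambda>" "deg \<Lambda> (w n) = n + ?d" using w[OF n] by (simp_all add: add.commute)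
    qed (use l n in auto)
    then show ?thesis unfolding I_def by blast
  qed
  define u where "u n = (SOME \<alpha>. I n \<alpha>)" for n
  have u: "I n (u n)" if "n \<in> N" for n unfolding u_def using ex[OF that] by (rule someI_ex)
  have init: "\<exists>\<beta>\<in>mor \<Lambda>. src \<Lambda> (u m) = rng \<Lambda> \<beta> \<and> cmp \<Lambda> (u m) \<beta> = w n"
    if mn: "m \<in> N" "n \<in> N" "m \<le> n" for m n
  proof -
    obtain \<beta> where b: "\<beta> \<in> mor \<Lambda>" "src \<Lambda> (u m) = rng \<Lambda> \<beta>" "cmp \<Lambda> (u m) \<beta> = w m"
      and um: "u m \<in> mor \<Lambda>"
      using u[OF mn(1)] by (auto simp: I_def)
    have sb: "src \<Lambda> \<beta> = x (m, m)" using cmp_simps(3)[OF um b(1,2)] w(3)[OF mn(1)] b(3) by simp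
    then have "cmp \<Lambda> (u m) (cmp \<Lambda> \<beta> (x (m, n))) = w n"
      using w_ext[OF mn] b um x mn by (subst cmp_assoc[symmetric]) auto
    then show ?thesis using b sb x mn by (intro bexI[of _ "cmp \<Lambda> \<beta> (x (m, n))"]) auto
  qed
  \<comment> \<open>\<open>u n\<close> may be read off from any later \<open>w m\<close>, not only
    from \<open>w n\<close>; this makes the family \<open>u\<close> coherent.\<close>
  have uw: "u n = \<alpha>" if nm: "n \<in> N" "m \<in> N" "n \<le> m" and ab: "\<alpha> \<in> mor \<Lambda>" "deg \<Lambda> \<alpha> = n" "\<beta> \<in> mor \<Lambda>" "src \<Lambda> \<alpha> = rng \<Lambda> \<beta>"
    "cmp \<Lambda> \<alpha> \<beta> = w m" for n m \<alpha> \<beta>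
  proof -
    obtain \<gamma> where "\<gamma> \<in> mor \<Lambda>" "src \<Lambda> (u n) = rng \<Lambda> \<gamma>" "cmp \<Lambda> (u n) \<gamma> = w m"
      using init[OF nm] by blast
    moreover have "u n \<in> mor \<Lambda>" "deg \<Lambda> (u n) = n" using u[OF nm(1)] by (auto simp: I_def)
    ultimately show ?thesis using ab factor_unique[of "u n" \<gamma> \<alpha> \<beta>] by auto
  qed
  obtain z where z: "z \<in> paths" and zu: "\<And>n. n \<in> N \<Longrightarrow> z (0, n) = u n"
  proof (rule path_of_family[of u])
    show "u n \<in> mor \<Lambda> \<and> deg \<Lambda> (u n) = n" if "n \<in> N" for n
      using u[OF that] by (auto simp: I_def)
    show "\<exists>\<beta>\<in>mor \<Lambda>. src \<Lambda> (u m) = rng \<Lambda> \<beta> \<and> cmp \<Lambda> (u m) \<beta> = u n" if mn: "m \<in> N" "n \<in> N" "m \<le> n" for m n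
    proof -
      obtain \<gamma> where g: "\<gamma> \<in> mor \<Lambda>" "src \<Lambda> (u n) = rng \<Lambda> \<gamma>" "cmp \<Lambda> (u n) \<gamma> = w n"
        and un: "u n \<in> mor \<Lambda>" "deg \<Lambda> (u n) = n"
        using u[OF mn(2)] by (auto simp: I_def)
      obtain j where j: "j \<in> N" "n = m + j" using Nk_leE[OF mn(3,2)] by blast
      obtain \<alpha> \<beta> where ab: "\<alpha> \<in> mor \<Lambda>" "\<beta> \<in> mor \<Lambda>" "deg \<Lambda> \<alpha> = m" "src \<Lambda> \<alpha> = rng \<Lambda> \<beta>"
        "cmp \<Lambda> \<alpha> \<beta> = u n"
        by (rule factorE[OF un(1) _ mn(1) j(1)]) (use un j in auto)
      have "src \<Lambda> \<beta> = rng \<Lambda> \<gamma>" using ab g cmp_simps(3)[OF ab(1,2,4)] by simp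
      then have "cmp \<Lambda> \<alpha> (cmp \<Lambda> \<beta> \<gamma>) = w n" "cmp \<Lambda> \<beta> \<gamma> \<in> mor \<Lambda>" "src \<Lambda> \<alpha> = rng \<Lambda> (cmp \<Lambda> \<beta> \<gamma>)"
        using ab g cmp_assoc[of \<alpha> \<beta> \<gamma>] by auto
      then have "u m = \<alpha>" using uw[OF mn(1,2,3)] ab by blast
      then show ?thesis using ab by blast
    qed
  qed blast
  have zw: "z (0, ?d + n) = w n" if n: "n \<in> N" for n
  proof -
    have "cmp \<Lambda> (w n) (x (n, ?d + n)) = w (?d + n)" using w_ext[of n "?d + n"] n l by simp
    then have "u (?d + n) = w n"
      using n l x w by (intro uw[of "?d + n" "?d + n" "w n" "x (n, ?d + n)"]) auto
    then show ?thesis using zu n l by simp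
  qed
  have z0: "z (0, ?d) = l" using zw[of 0] l s0 by (simp add: w_def)
  have "sh ?d z = x"
  proof (rule path_eqI[of _ _ 0])
    fix n assume n: "n \<in> N"
    have "cmp \<Lambda> (z (0, ?d)) (z (?d, ?d + n)) = cmp \<Lambda> l (x (0, n))"
      using path_cmp[of z 0 ?d "?d + n"] z n l zw[OF n] by (simp add: w_def)
    moreover have "src \<Lambda> (z (0, ?d)) = rng \<Lambda> (z (?d, ?d + n))" using z l n by simp
    ultimately have "z (?d, ?d + n) = x (0, n)"
      using z0 z l n x s0 factor_unique[of "z (0, ?d)" "z (?d, ?d + n)" l "x (0, n)"] by simp
    then show "sh ?d z (0, 0 + n) = x (0, 0 + n)" using n by (simp add: add.commute)
  qed (use x z l in auto)
  with z z0 that show thesis by blast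
qed

text \<open>\<open>path_split_eq\<close> gives the uniqueness that the definite description asks
  for, so a prepended path is recognised by its initial segment and its tail.\<close>

lemma prepend_eqI:
  assumes "z \<in> paths" "n \<in> N" "z (0, n) = l" "sh n z = x"
  shows "prepend k \<Lambda> l x = z"
proof -
  have d: "deg \<Lambda> l = n" using assms by auto
  show ?thesis unfolding prepend_def d
    by (rule the_equality) (use assms path_split_eq in auto)
qed

lemma prepend:
  assumes l: "l \<in> mor \<Lambda>" and x: "x \<in> paths" and s: "path_range x = src \<Lambda> l"
  shows "prepend k \<Lambda> l x \<in> paths" "prepend k \<Lambda> l x (0, deg \<Lambda> l) = l" "sh (deg \<Lambda> l) (prepend k \<Lambda> l x) = x"
proof -
  obtain z where z: "z \<in> paths" "z (0, deg \<Lambda> l) = l" "sh (deg \<Lambda> l) z = x"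
    using prepend_exists[OF assms] .
  then have "prepend k \<Lambda> l x = z" using l by (intro prepend_eqI) auto
  with z show "prepend k \<Lambda> l x \<in> paths" "prepend k \<Lambda> l x (0, deg \<Lambda> l) = l"
    "sh (deg \<Lambda> l) (prepend k \<Lambda> l x) = x" by auto
qed

lemma shift_range [simp]:
  assumes "x \<in> paths" "n \<in> N"
  shows "path_range (sh n x) = x (n, n)"
  using assms by (simp add: path_range_def)

section \<open>Arrows and cylinder sets\<close>

lemma mor_G: "(x, m, y) \<in> mor G \<longleftrightarrow> x \<in> paths \<and> y \<in> paths \<and> (\<exists>l l'. lev k m l l' \<and> sh l x = sh l' y)"
  unfolding path_groupoid_def lev_def by auto

lemma G_simps [simp]:
  "src G (x, m, y) = (y, 0, y)" "rng G (x, m, y) = (x, 0, x)" "cmp G (x, m, y) (y', n, z) = (x, m + n, z)"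
  by (auto simp: path_groupoid_def)

text \<open>Membership becomes a condition on initial segments and tails of the two paths of the
  arrow itself, free of \<open>prepend\<close>.\<close>

lemma in_cylinder_iff:
  assumes "\<mu> \<in> mor \<Lambda>" "\<nu> \<in> mor \<Lambda>" "src \<Lambda> \<mu> = src \<Lambda> \<nu>"
  shows "(x, m, y) \<in> cylinder k \<Lambda> \<mu> \<nu> \<longleftrightarrow> x \<in> paths \<and> y \<in> paths \<and> m = zdiff (deg \<Lambda> \<mu>) (deg \<Lambda> \<nu>) \<and>
    x (0, deg \<Lambda> \<mu>) = \<mu> \<and> y (0, deg \<Lambda> \<nu>) = \<nu> \<and> sh (deg \<Lambda> \<mu>) x = sh (deg \<Lambda> \<nu>) y" (is "?L \<longleftrightarrow> ?R")
proof
  assume ?L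
  then obtain w where w: "w \<in> paths" "path_range w = src \<Lambda> \<mu>" "x = prepend k \<Lambda> \<mu> w"
    "m = zdiff (deg \<Lambda> \<mu>) (deg \<Lambda> \<nu>)" "y = prepend k \<Lambda> \<nu> w"
    unfolding cylinder_def by auto
  then show ?R using prepend[of \<mu> w] prepend[of \<nu> w] assms by auto
next
  assume R: ?R
  let ?w = "sh (deg \<Lambda> \<mu>) x"
  have "src \<Lambda> (x (0, deg \<Lambda> \<mu>)) = path_range ?w"
    using R assms path_seg(2)[of x 0 "deg \<Lambda> \<mu>"] shift_range[of x "deg \<Lambda> \<mu>"] by simp
  then have "path_range ?w = src \<Lambda> \<mu>" using R by metis
  moreover have "prepend k \<Lambda> \<mu> ?w = x" "prepend k \<Lambda> \<nu> ?w = y"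
    using R assms prepend_eqI[of x "deg \<Lambda> \<mu>" \<mu> ?w] prepend_eqI[of y "deg \<Lambda> \<nu>" \<nu> ?w] by simp_all
  ultimately show ?L using R assms unfolding cylinder_def by auto
qed

lemma cylinder_subset: 
  assumes "\<mu> \<in> mor \<Lambda>" "\<nu> \<in> mor \<Lambda>" "src \<Lambda> \<mu> = src \<Lambda> \<nu>"
  shows "cylinder k \<Lambda> \<mu> \<nu> \<subseteq> mor G"
proof
  fix g assume g: "g \<in> cylinder k \<Lambda> \<mu> \<nu>"
  obtain x m y where "g = (x, m, y)" by (cases g)
  moreover have "lev k (zdiff (deg \<Lambda> \<mu>) (deg \<Lambda> \<nu>)) (deg \<Lambda> \<mu>) (deg \<Lambda> \<nu>)"
    using assms by (simp add: lev_def)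
  ultimately show "g \<in> mor G" using g by (simp add: in_cylinder_iff[OF assms] mor_G) blast
qed

lemma shift_eq_obj:
  assumes "x \<in> paths" "y \<in> paths" "l \<in> N" "l' \<in> N" "sh l x = sh l' y"
  shows "x (l, l) = y (l', l')"
  using shift_range[of x l] shift_range[of y l'] assms by simp

text \<open>Basic neighbourhoods of \<open>g\<close> indexed by degrees instead of morphisms;
  raising the degrees shrinks them, see \<open>lcyl_mono\<close>.\<close>

definition lcyl :: "'a path_arrow \<Rightarrow> (nat \<Rightarrow> nat) \<Rightarrow> (nat \<Rightarrow> nat) \<Rightarrow> 'a path_arrow set" where
  "lcyl g l l' = cylinder k \<Lambda> (fst g (0, l)) (snd (snd g) (0, l'))"

text \<open>The tails of the two paths of \<open>g\<close> agree from these degrees on, which makes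
  \<open>lcyl g l l'\<close> an open set containing \<open>g\<close>.\<close>

definition compat :: "'a path_arrow \<Rightarrow> (nat \<Rightarrow> nat) \<Rightarrow> (nat \<Rightarrow> nat) \<Rightarrow> bool" where
  "compat g l l' \<longleftrightarrow> fst g \<in> paths \<and> snd (snd g) \<in> paths \<and> lev k (fst (snd g)) l l' \<and>
     sh l (fst g) = sh l' (snd (snd g))"

lemma compat_iff [simp]: "compat (x, m, y) l l' \<longleftrightarrow> x \<in> paths \<and> y \<in> paths \<and> lev k m l l' \<and> sh l x = sh l' y"
  by (simp add: compat_def)

lemma compat_exists: "g \<in> mor G \<Longrightarrow> \<exists>l l'. compat g l l'"
  by (cases g) (auto simp: mor_G)

lemma compat_mor: "compat g l l' \<Longrightarrow> g \<in> mor G"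
  by (cases g) (auto simp: mor_G)

lemma shift_eq_add:
  assumes "sh l x = sh l' y" "n \<in> N"
  shows "sh (l + n) x = sh (l' + n) y"
  using shift_shift[OF assms(2), of l x] shift_shift[OF assms(2), of l' y] assms(1)
  by (simp add: add.commute)

lemma compat_mono:
  assumes "compat g a b" "lev k (fst (snd g)) l l'" "a \<le> l"
  shows "compat g l l'"
proof -
  obtain x m y where g: "g = (x, m, y)" by (cases g)
  obtain n where "n \<in> N" "l = a + n" "l' = b + n"
    using assms g by (auto elim: lev_leE[of k m a b l l'])
  then show ?thesis using assms g shift_eq_add by auto
qed

lemma lcyl_iff:
  assumes "compat (x, m, y) l l'"
  shows "(x', m', y') \<in> lcyl (x, m, y) l l' \<longleftrightarrow>
    x' (0, l) = x (0, l) \<and> y' (0, l') = y (0, l') \<and> m' = m \<and> compat (x', m, y') l l'"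
proof -
  have N: "l \<in> N" "l' \<in> N" "zdiff l l' = m" using assms levD by auto
  have "x (l, l) = y (l', l')" using shift_eq_obj assms N by auto
  then have "(x', m', y') \<in> lcyl (x, m, y) l l' \<longleftrightarrow> x' \<in> paths \<and> y' \<in> paths \<and> m' = m \<and>
    x' (0, l) = x (0, l) \<and> y' (0, l') = y (0, l') \<and> sh l x' = sh l' y'"
    unfolding lcyl_def using assms N by (subst in_cylinder_iff) auto
  then show ?thesis using assms by auto
qed

lemma lcyl_self: "compat g l l' \<Longrightarrow> g \<in> lcyl g l l'"
  by (cases g) (auto simp: lcyl_iff)

lemma lcyl_openin:
  assumes "compat g l l'"
  shows "openin (path_groupoid_topology k \<Lambda>) (lcyl g l l')"
proof -
  obtain x m y where g: "g = (x, m, y)" by (cases g)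
  have N: "l \<in> N" "l' \<in> N" using assms g levD by auto
  have "x (l, l) = y (l', l')" using shift_eq_obj assms N g by auto
  then show ?thesis unfolding path_groupoid_topology_def lcyl_def g
    using assms g N by (intro topology_generated_by_Basis CollectI exI[of _ "x (0, l)"] exI[of _ "y (0, l')"]) auto
qed

lemma lcyl_mono:
  assumes "compat g a b" "lev k (fst (snd g)) l l'" "a \<le> l"
  shows "lcyl g l l' \<subseteq> lcyl g a b"
proof
  fix h assume h: "h \<in> lcyl g l l'"
  obtain x m y where g: "g = (x, m, y)" by (cases g)
  obtain x' m' y' where hh: "h = (x', m', y')" by (cases h)
  have c: "compat (x, m, y) l l'" using compat_mono[OF assms] g by simp
  have N: "a \<in> N" "b \<in> N" "l \<in> N" "l' \<in> N" using c assms g levD by auto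
  obtain n where n: "n \<in> N" "l = a + n" "l' = b + n"
    using assms g by (auto elim: lev_leE[of k m a b l l'])
  have e: "x' (0, l) = x (0, l)" "y' (0, l') = y (0, l')" "m' = m" and c': "compat (x', m, y') l l'"
    using h lcyl_iff[OF c] unfolding g hh by auto
  have P: "x \<in> paths" "x' \<in> paths" "y \<in> paths" "y' \<in> paths" using c c' by auto
  have le: "a \<le> l" "b \<le> l'" by (simp_all add: n)
  note ex = path_seg_eq[OF P(2,1) _ _ N(3) _ _ e(1)] and ey = path_seg_eq[OF P(4,3) _ _ N(4) _ _ e(2)]
  have e1: "x' (0, a) = x (0, a)" "x' (a, l) = x (a, l)"
    using ex[OF Nk_simps(1) N(1) _ le(1)] ex[OF N(1,3) le(1)] by simp_all
  have e2: "y' (0, b) = y (0, b)" "y' (b, l') = y (b, l')"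
    using ey[OF Nk_simps(1) N(2) _ le(2)] ey[OF N(2,4) le(2)] by simp_all
  \<comment> \<open>Agreement of the tails of \<open>h\<close> is known from \<open>l\<close>,
    \<open>l'\<close> on. It extends back to \<open>a\<close>, \<open>b\<close>, because the
    segments in between are those of \<open>g\<close>, whose tails agree already from
    \<open>a\<close>, \<open>b\<close> on.\<close>
  have "sh a x' = sh b y'"
  proof (rule path_split_eq[OF _ _ n(1)])
    have "sh a x (0, n) = sh b y (0, n)" using assms(1) g by simp
    then show "sh a x' (0, n) = sh b y' (0, n)" using e1 e2 n N by (simp add: add.commute)
    show "sh n (sh a x') = sh n (sh b y')" using c' n by (simp add: shift_shift add.commute)
  qed (use P N in auto)
  then show "h \<in> lcyl g a b" unfolding hh g
    using lcyl_iff[of x m y a b] assms(1) g e1 e2 e P by auto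
qed

lemma mor_G_topspace: "topspace (path_groupoid_topology k \<Lambda>) \<subseteq> mor G"
  unfolding path_groupoid_topology_def topology_generated_by_topspace using cylinder_subset by blast

lemma G_objects: "v \<in> objects G \<Longrightarrow> \<exists>x\<in>paths. v = (x, 0, x)"
  unfolding objects_def path_groupoid_def by auto

lemma composable_G: "(g, h) \<in> composable G \<longleftrightarrow>
   (\<exists>x m y n z. g = (x, m, y) \<and> h = (y, n, z) \<and> (x, m, y) \<in> mor G \<and> (y, n, z) \<in> mor G)"
  unfolding composable_def by (cases g; cases h) auto

lemma compat_cmp: "compat (x, m, y) l l' \<Longrightarrow> compat (y, n, z) l' l'' \<Longrightarrow> compat (x, m + n, z) l l''"
  using lev_trans by auto

lemma compat_common:
  assumes "compat (x, m, y) a b" "compat (y, n, z) a' b'" "c \<in> N"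
  obtains L L' L'' where "compat (x, m, y) L L'" "compat (y, n, z) L' L''" "a \<le> L" "a' \<le> L'" "c \<le> L" "b \<le> L'"
proof -
  obtain L L' L'' where L: "lev k m L L'" "lev k n L' L''" "a \<le> L" "a' \<le> L'" "c \<le> L" "b \<le> L'"
    by (rule lev_common[of k m a b n a' b' c]) (use assms in auto)
  have "compat (x, m, y) L L'" by (rule compat_mono[OF assms(1)]) (use L in simp_all)
  moreover have "compat (y, n, z) L' L''" by (rule compat_mono[OF assms(2)]) (use L in simp_all)
  ultimately show thesis by (rule that) (rule L)+
qed

lemma mor_G_cmp:
  assumes "(x, m, y) \<in> mor G" "(y, n, z) \<in> mor G"
  shows "(x, m + n, z) \<in> mor G"
proof -
  obtain a b a' b' where ab: "compat (x, m, y) a b" "compat (y, n, z) a' b'"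
    using compat_exists[OF assms(1)] compat_exists[OF assms(2)] by blast
  obtain L L' L'' where L: "compat (x, m, y) L L'" "compat (y, n, z) L' L''"
    by (rule compat_common[OF ab Nk_simps(1)])
  show ?thesis by (rule compat_mor[OF compat_cmp[OF L]])
qed

lemma mor_G_unit: "x \<in> paths \<Longrightarrow> (x, 0, x) \<in> mor G"
  using lev_refl[of 0 k] by (auto simp: mor_G)

section \<open>Locally constant functions of arrows and of composable pairs\<close>

definition loc_const :: "('a path_arrow \<Rightarrow> 'b) \<Rightarrow> bool" where
  "loc_const \<phi> \<longleftrightarrow> (\<forall>g\<in>mor G. \<exists>l l'. compat g l l' \<and> (\<forall>h\<in>lcyl g l l'. \<phi> h = \<phi> g))"

lemma loc_const_continuous:
  assumes "loc_const \<phi>" "\<And>g. g \<in> mor G \<Longrightarrow> norm (\<phi> g) = 1"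
  shows "continuous_map (path_groupoid_topology k \<Lambda>) (top_of_set (sphere (0::complex) 1)) \<phi>"
  unfolding continuous_map_openin_preimage_eq topology_eq
proof -
  let ?X = "path_groupoid_topology k \<Lambda>"
  show "\<phi> \<in> topspace ?X \<rightarrow> topspace (top_of_set (sphere 0 1)) \<and>
    (\<forall>U. openin (top_of_set (sphere 0 1)) U \<longrightarrow> openin ?X (topspace ?X \<inter> \<phi> -` U))"
  proof (intro conjI allI impI)
    show "\<phi> \<in> topspace ?X \<rightarrow> topspace (top_of_set (sphere 0 1))"
      using assms(2) mor_G_topspace by auto
    fix U :: "complex set"
    show "openin ?X (topspace ?X \<inter> \<phi> -` U)"
    proof (subst openin_subopen, intro ballI)
      fix g assume g: "g \<in> topspace ?X \<inter> \<phi> -` U"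
      then obtain l l' where l: "compat g l l'" "\<forall>h\<in>lcyl g l l'. \<phi> h = \<phi> g"
        using assms(1) mor_G_topspace unfolding loc_const_def by blast
      have "lcyl g l l' \<subseteq> topspace ?X \<inter> \<phi> -` U"
        using l(2) g openin_subset[OF lcyl_openin[OF l(1)]] by auto
      then show "\<exists>T. openin ?X T \<and> g \<in> T \<and> T \<subseteq> topspace ?X \<inter> \<phi> -` U"
        using lcyl_openin[OF l(1)] lcyl_self[OF l(1)] by blast
    qed
  qed
qed

text \<open>The cylinders around \<open>g\<close> and \<open>h\<close> share the middle degree
  \<open>l'\<close>; then composites of nearby pairs lie in the cylinder of the product with degrees
  \<open>l\<close>, \<open>l''\<close>, see \<open>lcyl_cmp\<close>.\<close>

definition loc_const2 :: "('a path_arrow \<Rightarrow> 'a path_arrow \<Rightarrow> 'b) \<Rightarrow> bool" where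
  "loc_const2 \<phi> \<longleftrightarrow> (\<forall>(g, h)\<in>composable G. \<exists>l l' l''. compat g l l' \<and> compat h l' l'' \<and>
     (\<forall>g'\<in>lcyl g l l'. \<forall>h'\<in>lcyl h l' l''. (g', h') \<in> composable G \<longrightarrow> \<phi> g' h' = \<phi> g h))"

lemma loc_const2_continuous:
  assumes "loc_const2 \<phi>" "\<And>g h. (g, h) \<in> composable G \<Longrightarrow> norm (\<phi> g h) = 1"
  shows "continuous_map (subtopology (prod_topology (path_groupoid_topology k \<Lambda>) (path_groupoid_topology k \<Lambda>))
    (composable G)) (top_of_set (sphere (0::complex) 1)) (\<lambda>(g, h). \<phi> g h)"
  unfolding continuous_map_openin_preimage_eq topology_eq
proof -
  let ?Y = "path_groupoid_topology k \<Lambda>"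
  let ?X = "subtopology (prod_topology ?Y ?Y) (composable G)" and ?f = "\<lambda>(g, h). \<phi> g h"
  show "?f \<in> topspace ?X \<rightarrow> topspace (top_of_set (sphere 0 1)) \<and>
    (\<forall>U. openin (top_of_set (sphere 0 1)) U \<longrightarrow> openin ?X (topspace ?X \<inter> ?f -` U))"
  proof (intro conjI allI impI)
    show "?f \<in> topspace ?X \<rightarrow> topspace (top_of_set (sphere 0 1))"
      using assms(2) by auto
    fix U :: "complex set"
    show "openin ?X (topspace ?X \<inter> ?f -` U)"
    proof (subst openin_subopen, intro ballI)
      fix w assume w: "w \<in> topspace ?X \<inter> ?f -` U"
      obtain g h where gh: "w = (g, h)" by (cases w)
      have c: "(g, h) \<in> composable G" using w gh by auto
      then obtain l l' l'' where l: "compat g l l'" "compat h l' l''"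
        "\<forall>g'\<in>lcyl g l l'. \<forall>h'\<in>lcyl h l' l''. (g', h') \<in> composable G \<longrightarrow> \<phi> g' h' = \<phi> g h"
        using assms(1) unfolding loc_const2_def by blast
      let ?T = "lcyl g l l' \<times> lcyl h l' l'' \<inter> composable G"
      have "openin (prod_topology ?Y ?Y) (lcyl g l l' \<times> lcyl h l' l'')"
        using lcyl_openin[OF l(1)] lcyl_openin[OF l(2)] by (simp add: openin_prod_Times_iff)
      then have o: "openin ?X ?T" by (rule openin_subtopology_Int)
      have "w \<in> ?T" using lcyl_self[OF l(1)] lcyl_self[OF l(2)] gh c by blast
      moreover have "\<phi> g h \<in> U" using w gh by simp
      then have "?T \<subseteq> topspace ?X \<inter> ?f -` U"
        using l(3) openin_subset[OF o] by auto
      ultimately show "\<exists>T. openin ?X T \<and> w \<in> T \<and> T \<subseteq> topspace ?X \<inter> ?f -` U"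
        using o by blast
    qed
  qed
qed

lemma lcyl_cmp:
  assumes "compat (x, m, y) l l'" "compat (y, n, z) l' l''"
    and g: "g' \<in> lcyl (x, m, y) l l'" "h' \<in> lcyl (y, n, z) l' l''" "(g', h') \<in> composable G"
  shows "cmp G g' h' \<in> lcyl (x, m + n, z) l l''"
proof -
  obtain x' m' y' n' z' where gh: "g' = (x', m', y')" "h' = (y', n', z')"
    using g(3) composable_G by blast
  show ?thesis using assms lcyl_iff[OF assms(1)] lcyl_iff[OF assms(2)]
    lcyl_iff[OF compat_cmp[OF assms(1,2)]] compat_cmp[of x' m y' l l' n z' l''] unfolding gh
    by auto
qed

end

section \<open>The cocycle on the path groupoid\<close>

locale kgraph_cocycle = kgraph +
  fixes c :: "'a \<Rightarrow> 'a \<Rightarrow> complex" and P :: "('a \<times> 'a) set"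
  assumes coc: "two_cocycle \<Lambda> c" and part: "cylinder_partition k \<Lambda> P"
begin

abbreviation "lab \<equiv> label k \<Lambda> P"
abbreviation "\<sigma> \<equiv> sigma_c k \<Lambda> P c"

lemma composable_GE:
  assumes "(g, h) \<in> composable G"
  obtains x m y n z where "g = (x, m, y)" "h = (y, n, z)" "g \<in> mor G" "h \<in> mor G"
  using iffD1[OF composable_G assms] that by auto

lemma composable_GI:
  "(x, m, y) \<in> mor G \<Longrightarrow> (y, n, z) \<in> mor G \<Longrightarrow> ((x, m, y), (y, n, z)) \<in> composable G"
  by (simp add: composable_def)

lemma c_norm:
  assumes "a \<in> mor \<Lambda>" "b \<in> mor \<Lambda>" "src \<Lambda> a = rng \<Lambda> b"
  shows "norm (c a b) = 1"
  using coc assms unfolding two_cocycle_def composable_def by auto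

lemma c_cmp:
  assumes m: "a \<in> mor \<Lambda>" "b \<in> mor \<Lambda>" "e \<in> mor \<Lambda>" "src \<Lambda> a = rng \<Lambda> b" "src \<Lambda> b = rng \<Lambda> e"
  shows "c a (cmp \<Lambda> b e) = c a b * c (cmp \<Lambda> a b) e * cnj (c b e)"
proof -
  have "c b e * c a (cmp \<Lambda> b e) = c a b * c (cmp \<Lambda> a b) e"
    using coc m unfolding two_cocycle_def composable_def by blast
  then have "(cnj (c b e) * c b e) * c a (cmp \<Lambda> b e) = c a b * c (cmp \<Lambda> a b) e * cnj (c b e)"
    by (simp add: ac_simps)
  then show ?thesis using circle_cnj(2)[OF c_norm[OF m(2,3,5)]] by simp
qed

lemma label_unique:
  assumes w: "w \<in> P" "g \<in> cylinder k \<Lambda> (fst w) (snd w)"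
  shows "lab g = w"
  unfolding label_def
proof (rule the_equality)
  fix v assume v: "v \<in> P \<and> g \<in> cylinder k \<Lambda> (fst v) (snd v)"
  have d: "disjoint_family_on (\<lambda>(\<mu>, \<nu>). cylinder k \<Lambda> \<mu> \<nu>) P"
    using part by (simp add: cylinder_partition_def)
  show "v = w"
  proof (rule ccontr)
    assume "v \<noteq> w"
    then have "cylinder k \<Lambda> (fst v) (snd v) \<inter> cylinder k \<Lambda> (fst w) (snd w) = {}"
      using d v w unfolding disjoint_family_on_def by (auto simp: case_prod_beta)
    then show False using v w by blast
  qed
qed (use w in simp)

lemma label_in:
  assumes "g \<in> mor G"
  shows "lab g \<in> P" "g \<in> cylinder k \<Lambda> (fst (lab g)) (snd (lab g))"
proof -
  have "g \<in> (\<Union>(\<mu>, \<nu>)\<in>P. cylinder k \<Lambda> \<mu> \<nu>)"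
    using assms part by (simp add: cylinder_partition_def)
  then obtain w where "w \<in> P" "g \<in> cylinder k \<Lambda> (fst w) (snd w)" by force
  then show "lab g \<in> P" "g \<in> cylinder k \<Lambda> (fst (lab g)) (snd (lab g))"
    using label_unique by auto
qed

definition dl :: "'a path_arrow \<Rightarrow> nat \<Rightarrow> nat" where "dl g = deg \<Lambda> (fst (lab g))"
definition dr :: "'a path_arrow \<Rightarrow> nat \<Rightarrow> nat" where "dr g = deg \<Lambda> (snd (lab g))"

lemma label_simps:
  assumes g: "g \<in> mor G"
  shows "fst (lab g) \<in> mor \<Lambda>" "snd (lab g) \<in> mor \<Lambda>" "src \<Lambda> (fst (lab g)) = src \<Lambda> (snd (lab g))"
    "dl g \<in> N" "dr g \<in> N" "compat g (dl g) (dr g)" "fst g (0, dl g) = fst (lab g)"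
    "snd (snd g) (0, dr g) = snd (lab g)"
proof -
  have "P \<subseteq> {(\<mu>, \<nu>) \<in> mor \<Lambda> \<times> mor \<Lambda>. src \<Lambda> \<mu> = src \<Lambda> \<nu>}"
    using part by (simp only: cylinder_partition_def)
  then have "lab g \<in> {(\<mu>, \<nu>) \<in> mor \<Lambda> \<times> mor \<Lambda>. src \<Lambda> \<mu> = src \<Lambda> \<nu>}"
    using label_in(1)[OF g] by (rule subsetD)
  then show m: "fst (lab g) \<in> mor \<Lambda>" "snd (lab g) \<in> mor \<Lambda>" "src \<Lambda> (fst (lab g)) = src \<Lambda> (snd (lab g))"
    by (auto simp: case_prod_beta)
  then show "dl g \<in> N" "dr g \<in> N" by (auto simp: dl_def dr_def)
  obtain x n y where xy: "g = (x, n, y)" by (cases g)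
  have "(x, n, y) \<in> cylinder k \<Lambda> (fst (lab g)) (snd (lab g))" using label_in(2)[OF g] xy by simp
  then show "compat g (dl g) (dr g)" "fst g (0, dl g) = fst (lab g)" "snd (snd g) (0, dr g) = snd (lab g)"
    unfolding in_cylinder_iff[OF m] dl_def[symmetric] dr_def[symmetric]
    using \<open>dl g \<in> N\<close> \<open>dr g \<in> N\<close> by (simp_all add: xy lev_def)
qed

lemma label_lcyl:
  assumes g: "g \<in> mor G" and h: "h \<in> lcyl g (dl g) (dr g)"
  shows "lab h = lab g"
  using h label_simps(7,8)[OF g] label_in(1)[OF g]
  by (intro label_unique) (auto simp: lcyl_def)

text \<open>Here the requirement that \<open>P\<close> contains all pairs
  \<open>(l, src \<Lambda> l)\<close> enters: with the vertex \<open>x (0, 0)\<close> for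
  \<open>l\<close>, both entries of the label of a unit are equal, and this normalises the
  cocycle.\<close>

lemma label_unit:
  assumes x: "x \<in> paths"
  shows "lab (x, 0, x) = (x (0, 0), x (0, 0))"
proof (rule label_unique)
  have m: "x (0, 0) \<in> mor \<Lambda>" "src \<Lambda> (x (0, 0)) = x (0, 0)" using x by auto
  then show "(x (0, 0), x (0, 0)) \<in> P" using part unfolding cylinder_partition_def by metis
  show "(x, 0, x) \<in> cylinder k \<Lambda> (fst (x (0, 0), x (0, 0))) (snd (x (0, 0), x (0, 0)))"
    using x m by (simp add: in_cylinder_iff zdiff_def fun_eq_iff)
qed

text \<open>One segment \<open>\<alpha>\<close> extends both entries of the label of
  \<open>g\<close>: the tails of \<open>x\<close> and \<open>y\<close> behind the label coincide, so
  the piece of \<open>x\<close> up to \<open>L\<close> is also the piece of \<open>y\<close> up to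
  \<open>L'\<close>.\<close>

lemma label_extend:
  assumes "compat (x, m, y) L L'" "dl (x, m, y) \<le> L"
  defines "g \<equiv> (x, m, y)"
  defines "\<alpha> \<equiv> x (dl g, L)"
  shows "\<alpha> \<in> mor \<Lambda>" "rng \<Lambda> \<alpha> = src \<Lambda> (fst (lab g))" "src \<Lambda> \<alpha> = x (L, L)"
    "cmp \<Lambda> (fst (lab g)) \<alpha> = x (0, L)" "cmp \<Lambda> (snd (lab g)) \<alpha> = y (0, L')"
proof -
  have g: "g \<in> mor G" using assms compat_mor by blast
  note ls = label_simps[OF g]
  have xy: "x \<in> paths" "y \<in> paths" "L \<in> N" "L' \<in> N" "lev k m L L'" using assms levD by auto
  have lv: "lev k m (dl g) (dr g)" and sh: "sh (dl g) x = sh (dr g) y" using ls(6) by (auto simp: g_def)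
  obtain n where n: "n \<in> N" "L = dl g + n" "L' = dr g + n"
    using lev_leE[OF lv xy(5)] assms by auto
  show "\<alpha> \<in> mor \<Lambda>" "src \<Lambda> \<alpha> = x (L, L)" using xy ls assms by (auto simp: \<alpha>_def g_def)
  have "src \<Lambda> (x (0, dl g)) = x (dl g, dl g)" using xy ls by simp
  then show "rng \<Lambda> \<alpha> = src \<Lambda> (fst (lab g))" using ls(7) xy ls(4) assms(2) by (simp add: \<alpha>_def g_def)
  show "cmp \<Lambda> (fst (lab g)) \<alpha> = x (0, L)"
    using path_cmp[of x 0 "dl g" L] xy ls(4,7) assms(2) by (simp add: \<alpha>_def g_def)
  have "sh (dl g) x (0, n) = sh (dr g) y (0, n)" using sh by simp
  then have "\<alpha> = y (dr g, L')" using n by (simp add: \<alpha>_def add.commute)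
  then show "cmp \<Lambda> (snd (lab g)) \<alpha> = y (0, L')"
    using path_cmp[of y 0 "dr g" L'] xy ls(5,8) n by (simp add: g_def)
qed

section \<open>Local primitives of the cocycle and change of degree\<close>

definition fval :: "'a path_arrow \<Rightarrow> (nat \<Rightarrow> nat) \<Rightarrow> complex" where
  "fval g l = c (fst (lab g)) (fst g (dl g, l)) * cnj (c (snd (lab g)) (fst g (dl g, l)))"

lemma fval_norm:
  assumes "compat g L L'" "dl g \<le> L"
  shows "norm (fval g L) = 1"
proof -
  obtain x m y where g: "g = (x, m, y)" by (cases g)
  note le = label_extend[OF assms[unfolded g]]
  note ls = label_simps[OF compat_mor[OF assms(1)]]
  show ?thesis using le ls c_norm by (simp add: fval_def g norm_mult)
qed

text \<open>By the cocycle identity for \<open>c\<close>, enlarging \<alpha> by a segment \<eta>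
  produces \<open>c \<alpha> \<eta>\<close> in both factors of \<open>fval\<close>, where it
  cancels. What remains refers to the end paths and no longer to the label, and can therefore be
  compared between different arrows.\<close>

lemma fval_add:
  assumes c: "compat (x, m, y) L L'" "dl (x, m, y) \<le> L" and n: "n \<in> N"
  shows "fval (x, m, y) (L + n) = fval (x, m, y) L *
    (c (x (0, L)) (x (L, L + n)) * cnj (c (y (0, L')) (x (L, L + n))))"
proof -
  let ?g = "(x, m, y)"
  let ?\<mu> = "fst (lab ?g)" and ?\<nu> = "snd (lab ?g)" and ?\<alpha> = "x (dl ?g, L)" and ?\<eta> = "x (L, L + n)"
  note le = label_extend[OF c]
  note ls = label_simps[OF compat_mor[OF c(1)]]
  have N: "x \<in> paths" "L \<in> N" using c levD by auto
  have e: "?\<eta> \<in> mor \<Lambda>" "rng \<Lambda> ?\<eta> = x (L, L)" using N n by auto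
  have s: "x (dl ?g, L + n) = cmp \<Lambda> ?\<alpha> ?\<eta>"
    using path_cmp[of x "dl ?g" L "L + n"] N n ls(4) c(2) by simp
  have nz: "cnj (c ?\<alpha> ?\<eta>) * c ?\<alpha> ?\<eta> = 1"
    using circle_cnj(2)[OF c_norm[of ?\<alpha> ?\<eta>]] le e by simp
  have "fval ?g (L + n) = c ?\<mu> ?\<alpha> * c (x (0, L)) ?\<eta> * cnj (c ?\<alpha> ?\<eta>) *
      cnj (c ?\<nu> ?\<alpha> * c (y (0, L')) ?\<eta> * cnj (c ?\<alpha> ?\<eta>))"
    unfolding fval_def fst_conv s
    using c_cmp[of ?\<mu> ?\<alpha> ?\<eta>] c_cmp[of ?\<nu> ?\<alpha> ?\<eta>] le ls e by simp
  also have "\<dots> = c ?\<mu> ?\<alpha> * cnj (c ?\<nu> ?\<alpha>) * (c (x (0, L)) ?\<eta> * cnj (c (y (0, L')) ?\<eta>)) *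
     (cnj (c ?\<alpha> ?\<eta>) * c ?\<alpha> ?\<eta>)"
    by (simp add: mult_ac)
  finally show ?thesis unfolding nz by (simp add: fval_def mult_ac)
qed

lemma fval_unit:
  assumes "x \<in> paths" "L \<in> N"
  shows "fval (x, 0, x) L = 1"
  using assms circle_cnj(1)[OF c_norm[of "x (0, 0)" "x (0, L)"]]
  by (simp add: fval_def label_unit dl_def)

lemma fval_lcyl:
  assumes g: "compat g L L'" "dl g \<le> L" and h: "h \<in> lcyl g L L'"
  shows "lab h = lab g" "fval h L = fval g L" "compat h L L'"
proof -
  obtain x m y where gg: "g = (x, m, y)" by (cases g)
  obtain x' m' y' where hh: "h = (x', m', y')" by (cases h)
  have gG: "g \<in> mor G" by (rule compat_mor[OF g(1)])
  note ls = label_simps[OF gG]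
  have lv: "lev k (fst (snd g)) L L'" using g gg by simp
  show l: "lab h = lab g"
    using label_lcyl[OF gG] lcyl_mono[OF ls(6) lv g(2)] h by blast
  have e: "x' (0, L) = x (0, L)" "m' = m" "compat (x', m, y') L L'"
    using h g(1) lcyl_iff[of x m y L L' x' m' y'] unfolding gg hh by auto
  then show "compat h L L'" by (simp add: hh)
  have "x' (dl g, L) = x (dl g, L)"
    by (rule path_seg_eq[of x' x "dl g" L L]) (use e g gg ls levD(1)[OF lv] in auto)
  then show "fval h L = fval g L" using l by (simp add: fval_def dl_def gg hh)
qed

text \<open>The degrees belong to the three paths visited by \<open>g\<close> and \<open>h\<close>,
  and lie behind the labels of \<open>g\<close>, \<open>h\<close> and their product, so that all
  three values in \<open>tri\<close> are meaningful.\<close>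

definition valid :: "'a path_arrow \<Rightarrow> 'a path_arrow \<Rightarrow> (nat \<Rightarrow> nat) \<Rightarrow> (nat \<Rightarrow> nat) \<Rightarrow> (nat \<Rightarrow> nat) \<Rightarrow> bool" where
  "valid g h L L' L'' \<longleftrightarrow> compat g L L' \<and> compat h L' L'' \<and> snd (snd g) = fst h \<and>
     dl g \<le> L \<and> dl h \<le> L' \<and> dl (cmp G g h) \<le> L"

definition tri :: "'a path_arrow \<Rightarrow> 'a path_arrow \<Rightarrow> (nat \<Rightarrow> nat) \<Rightarrow> (nat \<Rightarrow> nat) \<Rightarrow> complex" where
  "tri g h L L' = fval g L * fval h L' * cnj (fval (cmp G g h) L)"

lemma valid_cmp:
  assumes "valid g h L L' L''"
  shows "compat (cmp G g h) L L''"
proof -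
  obtain x m y where g: "g = (x, m, y)" by (cases g)
  obtain y' n z where h: "h = (y', n, z)" by (cases h)
  show ?thesis using assms compat_cmp unfolding valid_def g h by auto
qed

lemma compat_add: "compat g L L' \<Longrightarrow> n \<in> N \<Longrightarrow> compat g (L + n) (L' + n)"
  by (cases g) (auto intro: lev_add shift_eq_add)

text \<open>The boundary terms of \<open>fval_add\<close> cancel: each of the three paths occurs
  once with \<open>c\<close> and once with its conjugate, and with the same segment \<eta> since the
  tails agree.\<close>

lemma tri_add:
  assumes v: "valid g h L L' L''" and n: "n \<in> N"
  shows "tri g h (L + n) (L' + n) = tri g h L L'"
proof -
  obtain x m y where g: "g = (x, m, y)" by (cases g)
  obtain p z where h: "h = (y, p, z)" using v by (cases h) (auto simp: valid_def g)
  have gh: "cmp G g h = (x, m + p, z)" by (simp add: g h)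
  have cs: "compat (x, m, y) L L'" "compat (y, p, z) L' L''" "compat (x, m + p, z) L L''"
    using v valid_cmp[OF v] gh by (auto simp: valid_def g h)
  have ds: "dl (x, m, y) \<le> L" "dl (y, p, z) \<le> L'" "dl (x, m + p, z) \<le> L"
    using v gh by (auto simp: valid_def g h)
  let ?\<eta> = "x (L, L + n)"
  have N: "L \<in> N" "L' \<in> N" "L'' \<in> N" "x \<in> paths" "y \<in> paths" "z \<in> paths" using cs levD by auto
  have "sh L x (0, n) = sh L' y (0, n)" "sh L' y (0, n) = sh L'' z (0, n)" using cs by auto
  then have \<eta>: "y (L', L' + n) = ?\<eta>" "z (L'', L'' + n) = ?\<eta>" using n by (auto simp: add.commute)
  have "x (L, L) = y (L', L')" "y (L', L') = z (L'', L'')" using shift_eq_obj cs N by auto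
  then have nx: "norm (c (x (0, L)) ?\<eta>) = 1" and ny: "norm (c (y (0, L')) ?\<eta>) = 1"
    and nz: "norm (c (z (0, L'')) ?\<eta>) = 1"
    using N n by (auto intro!: c_norm)
  have "tri g h (L + n) (L' + n) = tri g h L L' *
    ((c (x (0, L)) ?\<eta> * cnj (c (x (0, L)) ?\<eta>)) * (c (y (0, L')) ?\<eta> * cnj (c (y (0, L')) ?\<eta>)) *
     (c (z (0, L'')) ?\<eta> * cnj (c (z (0, L'')) ?\<eta>)))"
    unfolding tri_def gh unfolding g h fval_add[OF cs(1) ds(1) n] fval_add[OF cs(2) ds(2) n]
      fval_add[OF cs(3) ds(3) n] \<eta> by (simp add: mult_ac)
  then show ?thesis by (simp only: circle_cnj[OF nx] circle_cnj[OF ny] circle_cnj[OF nz] mult_1_right)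
qed

text \<open>Adding \<open>K\<close> to the first triple and \<open>L\<close> to the second leads to
  the same degrees, for the middle path because \<open>zdiff L L' = zdiff K K'\<close>.\<close>

lemma tri_indep:
  assumes v: "valid g h L L' L''" and w: "valid g h K K' K''"
  shows "tri g h L L' = tri g h K K'"
proof -
  have l: "lev k (fst (snd g)) L L'" "lev k (fst (snd g)) K K'"
    using v w by (auto simp: valid_def compat_def)
  have N: "L \<in> N" "K \<in> N" using l levD by auto
  have "zdiff L L' = zdiff K K'" using l levD(3) by simp
  then have "int (L i) - int (L' i) = int (K i) - int (K' i)" for i
    by (simp add: zdiff_def fun_eq_iff)
  then have "L' i + K i = K' i + L i" for i
    by (simp add: algebra_simps flip: of_nat_add)
  then have "L' + K = K' + L" by (simp add: fun_eq_iff)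
  then show ?thesis
    using tri_add[OF v N(2)] tri_add[OF w N(1)] by (simp add: add.commute)
qed

lemma label_factor:
  assumes g: "g \<in> mor G" and \<alpha>: "\<alpha> \<in> mor \<Lambda>" "rng \<Lambda> \<alpha> = src \<Lambda> (fst (lab g))"
    and w: "w \<in> paths" "src \<Lambda> \<alpha> = path_range w"
    and e: "g = (prepend k \<Lambda> (cmp \<Lambda> (fst (lab g)) \<alpha>) w, m, prepend k \<Lambda> (cmp \<Lambda> (snd (lab g)) \<alpha>) w)"
  defines "L \<equiv> deg \<Lambda> (cmp \<Lambda> (fst (lab g)) \<alpha>)" and "L' \<equiv> deg \<Lambda> (cmp \<Lambda> (snd (lab g)) \<alpha>)"
  shows "compat g L L'" "dl g \<le> L" "\<alpha> = fst g (dl g, L)"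
proof -
  let ?\<mu> = "fst (lab g)" and ?\<nu> = "snd (lab g)"
  note ls = label_simps[OF g]
  obtain x y where xy: "g = (x, m, y)" "x = prepend k \<Lambda> (cmp \<Lambda> ?\<mu> \<alpha>) w" "y = prepend k \<Lambda> (cmp \<Lambda> ?\<nu> \<alpha>) w"
    using e by blast
  have m: "cmp \<Lambda> ?\<mu> \<alpha> \<in> mor \<Lambda>" "cmp \<Lambda> ?\<nu> \<alpha> \<in> mor \<Lambda>" "src \<Lambda> (cmp \<Lambda> ?\<mu> \<alpha>) = path_range w"
    "src \<Lambda> (cmp \<Lambda> ?\<nu> \<alpha>) = path_range w"
    using ls \<alpha> w by auto
  note px = prepend[OF m(1) w(1) m(3)[symmetric], folded xy L_def]
    and py = prepend[OF m(2) w(1) m(4)[symmetric], folded xy L'_def]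
  have d: "L = dl g + deg \<Lambda> \<alpha>" "L' = dr g + deg \<Lambda> \<alpha>"
    unfolding L_def L'_def dl_def dr_def using ls \<alpha> by auto
  then show le: "dl g \<le> L" by simp
  have lv: "lev k m (dl g) (dr g)" using ls(6) by (simp add: xy(1))
  show c: "compat g L L'"
    unfolding xy(1) compat_iff using px py lev_add[OF lv] d \<alpha> by simp
  have LN: "L \<in> N" using d ls \<alpha> by simp
  have "cmp \<Lambda> (x (0, dl g)) (x (dl g, L)) = cmp \<Lambda> ?\<mu> \<alpha>"
    using path_cmp[of x 0 "dl g" L] px ls le LN by simp
  then have "x (dl g, L) = \<alpha>"
    using factor_unique[of "x (0, dl g)" "x (dl g, L)" ?\<mu> \<alpha>] ls px le LN \<alpha>
    by (simp add: dl_def [symmetric])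
  then show "\<alpha> = fst g (dl g, L)" by (simp add: xy(1))
qed

text \<open>Resolves the definite description. Segments of the paths of \<open>g\<close> and
  \<open>h\<close> show that the value is attained; any other choice yields valid degrees by
  \<open>label_factor\<close>, and then \<open>tri_indep\<close> gives the same value.\<close>

lemma sigma_eq:
  assumes v: "valid g h L L' L''"
  shows "\<sigma> g h = tri g h L L'"
proof -
  obtain x m y where g: "g = (x, m, y)" by (cases g)
  obtain p z where h: "h = (y, p, z)" using v by (cases h) (auto simp: valid_def g)
  define gh where "gh = cmp G g h"
  have gh: "gh = (x, m + p, z)" by (simp add: g h gh_def)
  have cs: "compat g L L'" "compat h L' L''" "compat gh L L''"
    using v valid_cmp[OF v] by (auto simp: valid_def gh_def)
  have ds: "dl g \<le> L" "dl h \<le> L'" "dl gh \<le> L"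
    using v by (auto simp: valid_def gh_def)
  have mor: "g \<in> mor G" "h \<in> mor G" "gh \<in> mor G" using cs compat_mor by blast+
  note eg = label_extend[OF cs(1)[unfolded g] ds(1)[unfolded g], folded g]
    and eh = label_extend[OF cs(2)[unfolded h] ds(2)[unfolded h], folded h]
    and egh = label_extend[OF cs(3)[unfolded gh] ds(3)[unfolded gh], folded gh]
  define T where "T \<alpha> \<beta> \<gamma> = c (fst (lab g)) \<alpha> * cnj (c (snd (lab g)) \<alpha>) * c (fst (lab h)) \<beta> *
     cnj (c (snd (lab h)) \<beta>) * cnj (c (fst (lab gh)) \<gamma>) * c (snd (lab gh)) \<gamma>" for \<alpha> \<beta> \<gamma>
  have s: "\<sigma> g h = (THE t. \<exists>\<alpha> \<beta> \<gamma> w. factors k \<Lambda> P g h \<alpha> \<beta> \<gamma> w \<and> t = T \<alpha> \<beta> \<gamma>)"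
    unfolding sigma_c_def Let_def gh_def[symmetric] T_def by (simp add: case_prod_beta)
  have T: "T (x (dl g, K)) (y (dl h, K')) (x (dl gh, K)) = tri g h K K'" for K K'
    unfolding tri_def gh_def[symmetric] by (simp add: T_def fval_def g h gh)
  show ?thesis unfolding s
  proof (rule the_equality)
    \<comment> \<open>The path called \<open>y\<close> in \<open>factors\<close> is taken to be the
      common tail of all three paths.\<close>
    let ?w = "sh L x"
    have N: "x \<in> paths" "y \<in> paths" "z \<in> paths" "L \<in> N" "L' \<in> N" "L'' \<in> N"
      using cs levD by (auto simp: g h)
    have sw: "sh L' y = ?w" "sh L'' z = ?w" using cs by (auto simp: g h)
    have r: "path_range ?w = x (L, L)" "y (L', L') = x (L, L)"
      using N sw shift_eq_obj[of x y L L'] by auto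
    have pr: "prepend k \<Lambda> (x (0, L)) ?w = x" "prepend k \<Lambda> (y (0, L')) ?w = y" "prepend k \<Lambda> (z (0, L'')) ?w = z"
      using prepend_eqI N sw by auto
    have "factors k \<Lambda> P g h (x (dl g, L)) (y (dl h, L')) (x (dl gh, L)) ?w"
      unfolding factors_def Let_def gh_def[symmetric] case_prod_beta eg(4,5) eh(4,5) egh(4,5) pr
      using eg eh egh N r by (auto simp: g h gh degree_of_def)
    then show "\<exists>\<alpha> \<beta> \<gamma> w. factors k \<Lambda> P g h \<alpha> \<beta> \<gamma> w \<and> tri g h L L' = T \<alpha> \<beta> \<gamma>"
      using T by metis
  next
    fix t assume "\<exists>\<alpha> \<beta> \<gamma> w. factors k \<Lambda> P g h \<alpha> \<beta> \<gamma> w \<and> t = T \<alpha> \<beta> \<gamma>"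
    then obtain \<alpha> \<beta> \<gamma> w where f: "factors k \<Lambda> P g h \<alpha> \<beta> \<gamma> w" and t: "t = T \<alpha> \<beta> \<gamma>" by blast
    from f have abg: "\<alpha> \<in> mor \<Lambda>" "rng \<Lambda> \<alpha> = src \<Lambda> (fst (lab g))" "src \<Lambda> \<alpha> = path_range w"
      "\<beta> \<in> mor \<Lambda>" "rng \<Lambda> \<beta> = src \<Lambda> (fst (lab h))" "src \<Lambda> \<beta> = path_range w"
      "\<gamma> \<in> mor \<Lambda>" "rng \<Lambda> \<gamma> = src \<Lambda> (fst (lab gh))" "src \<Lambda> \<gamma> = path_range w"
      and w: "w \<in> paths"
      and cc: "cmp \<Lambda> (snd (lab g)) \<alpha> = cmp \<Lambda> (fst (lab h)) \<beta>" "cmp \<Lambda> (fst (lab g)) \<alpha> = cmp \<Lambda> (fst (lab gh)) \<gamma>"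
      and pg: "g = (prepend k \<Lambda> (cmp \<Lambda> (fst (lab g)) \<alpha>) w, degree_of g, prepend k \<Lambda> (cmp \<Lambda> (snd (lab g)) \<alpha>) w)"
      and ph: "h = (prepend k \<Lambda> (cmp \<Lambda> (fst (lab h)) \<beta>) w, degree_of h, prepend k \<Lambda> (cmp \<Lambda> (snd (lab h)) \<beta>) w)"
      and pgh: "gh = (prepend k \<Lambda> (cmp \<Lambda> (fst (lab gh)) \<gamma>) w, degree_of gh, prepend k \<Lambda> (cmp \<Lambda> (snd (lab gh)) \<gamma>) w)"
      unfolding factors_def Let_def gh_def[symmetric] case_prod_beta by blast+
    note fg = label_factor[OF mor(1) abg(1,2) w abg(3) pg]
      and fh = label_factor[OF mor(2) abg(4,5) w abg(6) ph]
      and fgh = label_factor[OF mor(3) abg(7,8) w abg(9) pgh]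
    let ?K = "deg \<Lambda> (cmp \<Lambda> (fst (lab g)) \<alpha>)" and ?K' = "deg \<Lambda> (cmp \<Lambda> (snd (lab g)) \<alpha>)"
      and ?K'' = "deg \<Lambda> (cmp \<Lambda> (snd (lab h)) \<beta>)"
    have v': "valid g h ?K ?K' ?K''"
      unfolding valid_def gh_def[symmetric]
      using fg(1,2) fh(1,2)[folded cc(1)] fgh(2)[folded cc(2)] by (simp only: g h) simp
    have "\<alpha> = x (dl g, ?K)" "\<beta> = y (dl h, ?K')" "\<gamma> = x (dl gh, ?K)"
      using fg(3) fh(3) fgh(3) cc by (auto simp: g h gh)
    then have "t = tri g h ?K ?K'" using t T by metis
    then show "t = tri g h L L'" using tri_indep[OF v v'] by simp
  qed
qed

lemma valid_exists:
  assumes "(g, h) \<in> composable G"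
  obtains L L' L'' where "valid g h L L' L''"
proof -
  obtain x m y n z where gh: "g = (x, m, y)" "h = (y, n, z)" and m: "g \<in> mor G" "h \<in> mor G"
    by (rule composable_GE[OF assms])
  have m2: "cmp G g h \<in> mor G" using m mor_G_cmp[of x m y n z] by (simp add: gh)
  obtain a b a' b' where ab: "compat (x, m, y) a b" "compat (y, n, z) a' b'"
    using compat_exists[OF m(1)] compat_exists[OF m(2)] unfolding gh by blast
  obtain L L' L'' where L: "compat (x, m, y) L L'" "compat (y, n, z) L' L''"
    by (rule compat_common[OF ab Nk_simps(1)])
  let ?n = "dl g + dl h + dl (cmp G g h)"
  have n: "?n \<in> N" using label_simps(4) m m2 by simp
  have "valid g h (L + ?n) (L' + ?n) (L'' + ?n)"
    unfolding valid_def using compat_add[OF L(1) n] compat_add[OF L(2) n] gh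
    by (auto simp: le_fun_def)
  then show thesis by (rule that)
qed

lemma sigma_norm:
  assumes "(g, h) \<in> composable G"
  shows "norm (\<sigma> g h) = 1"
proof -
  obtain L L' L'' where v: "valid g h L L' L''" using valid_exists[OF assms] .
  then have "norm (fval g L) = 1" "norm (fval h L') = 1" "norm (fval (cmp G g h) L) = 1"
    using fval_norm valid_cmp[OF v] unfolding valid_def by blast+
  then show ?thesis by (simp add: sigma_eq[OF v] tri_def norm_mult)
qed

text \<open>At degrees valid for all arrows involved, \<open>\<sigma>\<close> is the coboundary of
  \<open>fval\<close>, for which the identity is a cancellation. The work is to find such degrees
  for four composable pairs at once.\<close>

lemma sigma_two_cocycle: "two_cocycle G \<sigma>"
  unfolding two_cocycle_def
proof (intro conjI ballI allI impI)
  show "case w of (a, b) \<Rightarrow> \<sigma> a b \<in> sphere 0 1" if "w \<in> composable G" for w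
    using sigma_norm that by (cases w) simp
next
  fix g assume gG: "g \<in> mor G"
  obtain x m y where g: "g = (x, m, y)" by (cases g)
  have xy: "x \<in> paths" "y \<in> paths" using gG by (auto simp: g mor_G)
  have "(g, src G g) \<in> composable G" using gG mor_G_unit xy composable_GI unfolding g by simp
  then obtain L L' L'' where v: "valid g (src G g) L L' L''" using valid_exists by blast
  then have "compat g L L'" "dl g \<le> L" and "L' \<in> N" using levD by (auto simp: valid_def g)
  then have "fval g L * cnj (fval g L) = 1" "fval (src G g) L' = 1"
    using fval_norm circle_cnj fval_unit xy g by auto
  then show "\<sigma> g (src G g) = 1" unfolding sigma_eq[OF v] tri_def by (simp add: g)
  have "(rng G g, g) \<in> composable G" using gG mor_G_unit xy composable_GI unfolding g by simp
  then obtain L L' L'' where v: "valid (rng G g) g L L' L''" using valid_exists by blast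
  then have "compat g L' L''" "dl g \<le> L'" "lev k 0 L L'" using levD by (auto simp: valid_def g)
  moreover from this have "L' = L" using lev_unique lev_refl levD(1) by blast
  ultimately have "fval g L * cnj (fval g L) = 1" "fval (rng G g) L = 1" "L' = L"
    using fval_norm circle_cnj fval_unit xy g levD(1) by auto
  then show "\<sigma> (rng G g) g = 1" unfolding sigma_eq[OF v] tri_def by (simp add: g)
next
  fix g h e assume gh: "(g, h) \<in> composable G" and he: "(h, e) \<in> composable G"
  obtain x m y n z where g: "g = (x, m, y)" and h: "h = (y, n, z)" and gG: "g \<in> mor G" and hG: "h \<in> mor G"
    by (rule composable_GE[OF gh])
  obtain p u where e: "e = (z, p, u)" and eG: "e \<in> mor G"
    using composable_GE[OF he] unfolding h by (metis prod.inject)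
  define g1 where "g1 = cmp G g h"
  define h1 where "h1 = cmp G h e"
  have ghG: "g1 \<in> mor G" and heG: "h1 \<in> mor G"
    using gG hG eG mor_G_cmp by (simp_all add: g1_def h1_def g h e)
  have a: "cmp G g h1 = cmp G g1 e" by (simp add: g1_def h1_def g h e add.assoc)
  define f where "f = cmp G g1 e"
  have fG: "f \<in> mor G" using ghG eG mor_G_cmp by (simp add: f_def g1_def g h e)
  obtain K K' K'' where K: "compat g K K'" "compat h K' K''"
    using valid_exists[OF gh] unfolding valid_def by blast
  have "(g1, e) \<in> composable G" using ghG eG by (simp add: composable_GI g1_def g h e)
  then obtain J J'' J''' where J: "compat g1 J J''" "compat e J'' J'''"
    using valid_exists unfolding valid_def by blast
  have g1K: "compat g1 K K''" using K compat_cmp by (simp add: g1_def g h e)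
  have JN: "J \<in> N" "J'' \<in> N" "K \<in> N" "K'' \<in> N" using J g1K levD by (auto simp: compat_def)
  let ?n = "dl g + dl h + dl e + dl g1 + dl h1 + dl f"
  have n: "?n \<in> N" using label_simps(4) gG hG eG ghG heG fG by simp
  define L where "L = K + J + ?n"
  define L' where "L' = K' + J + ?n"
  define L'' where "L'' = K'' + J + ?n"
  define L''' where "L''' = J''' + K + ?n"
  \<comment> \<open>Degrees for \<open>g\<close>, \<open>h\<close> and for \<open>g1\<close>,
    \<open>e\<close> were found separately. Shifted by \<open>J\<close> and by \<open>K\<close> they
    start with the same degree on the first path, and hence agree on the path where \<open>h\<close>
    and \<open>e\<close> meet.\<close>
  have "K'' + J = J'' + K"
    using lev_unique[of k "fst (snd g1)" "K + J" "K'' + J" "J'' + K"] g1K J(1) JN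
      lev_add[of k "fst (snd g1)" K K'' J] lev_add[of k "fst (snd g1)" J J'' K]
    by (simp add: compat_def add.commute)
  then have C: "compat g L L'" "compat h L' L''" "compat e L'' L'''"
    using compat_add[OF compat_add[OF K(1) JN(1)] n] compat_add[OF compat_add[OF K(2) JN(1)] n]
      compat_add[OF compat_add[OF J(2) JN(3)] n]
    by (simp_all add: L_def L'_def L''_def L'''_def)
  have D: "dl g \<le> L" "dl g1 \<le> L" "dl f \<le> L" "dl h \<le> L'" "dl h1 \<le> L'" "dl e \<le> L''"
    by (auto simp: L_def L'_def L''_def le_fun_def)
  have v1: "valid g h L L' L''" using C D by (simp add: valid_def g1_def g h)
  have v2: "valid h e L' L'' L'''" using C D by (simp add: valid_def h1_def h e)
  have v3: "valid g1 e L L'' L'''"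
    using valid_cmp[OF v1] C D by (simp add: valid_def f_def g1_def g h e)
  have v4: "valid g h1 L L' L'''"
    using valid_cmp[OF v2] C D a by (simp add: valid_def f_def h1_def g h e)
  have n1: "norm (fval h1 L') = 1" using fval_norm valid_cmp[OF v2] D(5) h1_def by metis
  have n2: "norm (fval g1 L) = 1" using fval_norm valid_cmp[OF v1] D(2) g1_def by metis
  have "\<sigma> h e * \<sigma> g h1 = (fval h1 L' * cnj (fval h1 L')) * (fval g L * fval h L' * fval e L'' * cnj (fval f L))"
    unfolding sigma_eq[OF v2] sigma_eq[OF v4] tri_def a f_def[symmetric] h1_def[symmetric]
    by (simp add: mult_ac)
  also have "\<dots> = (fval g1 L * cnj (fval g1 L)) * (fval g L * fval h L' * fval e L'' * cnj (fval f L))"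
    by (simp only: circle_cnj[OF n1] circle_cnj[OF n2])
  also have "\<dots> = \<sigma> g h * \<sigma> g1 e"
    unfolding sigma_eq[OF v1] sigma_eq[OF v3] tri_def f_def[symmetric] g1_def[symmetric]
    by (simp add: mult_ac)
  finally show "\<sigma> h e * \<sigma> g (cmp G h e) = \<sigma> g h * \<sigma> (cmp G g h) e"
    by (simp add: g1_def h1_def)
qed

lemma sigma_locally:
  assumes v: "valid g h L L' L''" and g': "g' \<in> lcyl g L L'" and h': "h' \<in> lcyl h L' L''"
    and gh': "(g', h') \<in> composable G"
  shows "\<sigma> g' h' = \<sigma> g h"
proof -
  obtain x m y where g: "g = (x, m, y)" by (cases g)
  obtain p z where h: "h = (y, p, z)" using v by (cases h) (auto simp: valid_def g)
  have cs: "compat g L L'" "compat h L' L''" "dl g \<le> L" "dl h \<le> L'" "dl (cmp G g h) \<le> L"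
    using v by (auto simp: valid_def)
  have gh: "cmp G g' h' \<in> lcyl (cmp G g h) L L''"
    using lcyl_cmp[of x m y L L' p z L'' g' h'] cs g' h' gh' by (simp add: g h)
  note 1 = fval_lcyl[OF cs(1,3) g'] and 2 = fval_lcyl[OF cs(2,4) h']
    and 3 = fval_lcyl[OF valid_cmp[OF v] cs(5) gh]
  have "valid g' h' L L' L''"
    using 1 2 3 cs composable_GE[OF gh'] by (simp add: valid_def dl_def) (metis fst_conv snd_conv)
  then have "\<sigma> g' h' = tri g' h' L L'" by (rule sigma_eq)
  then show ?thesis unfolding sigma_eq[OF v] tri_def 1 2 3 .
qed

lemma sigma_loc_const2: "loc_const2 \<sigma>"
  unfolding loc_const2_def
proof (clarify)
  fix g h assume "(g, h) \<in> composable G"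
  then obtain L L' L'' where "valid g h L L' L''" by (rule valid_exists)
  then show "\<exists>l l' l''. compat g l l' \<and> compat h l' l'' \<and>
    (\<forall>g'\<in>lcyl g l l'. \<forall>h'\<in>lcyl h l' l''. (g', h') \<in> composable G \<longrightarrow> \<sigma> g' h' = \<sigma> g h)"
    using sigma_locally unfolding valid_def by blast
qed

lemma sigma_continuous: "continuous_two_cocycle G (path_groupoid_topology k \<Lambda>) \<sigma>"
  unfolding continuous_two_cocycle_def
  using sigma_two_cocycle loc_const2_continuous[OF sigma_loc_const2] sigma_norm by blast

section \<open>Multiplying the cocycle by a locally constant coboundary\<close>

lemma coboundary_perturbation:
  assumes b: "loc_const b" "\<And>g. g \<in> mor G \<Longrightarrow> norm (b g) = 1" "\<And>x. x \<in> paths \<Longrightarrow> b (x, 0, x) = 1"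
  defines "\<tau> \<equiv> \<lambda>g h. coboundary1 G b g h * \<sigma> g h"
  shows "continuous_two_cocycle G (path_groupoid_topology k \<Lambda>) \<tau>"
    "cohomologous G (path_groupoid_topology k \<Lambda>) \<tau> \<sigma>"
proof -
  have mor: "g \<in> mor G" "h \<in> mor G" "cmp G g h \<in> mor G" if "(g, h) \<in> composable G" for g h
    using that mor_G_cmp by (auto elim!: composable_GE)
  have nrm: "norm (\<tau> g h) = 1" if "(g, h) \<in> composable G" for g h
    using mor[OF that] b(2) sigma_norm[OF that] by (simp add: \<tau>_def coboundary1_def norm_mult)
  have "two_cocycle G \<tau>"
    unfolding two_cocycle_def
  proof (intro conjI ballI allI impI)
    show "case w of (a, b) \<Rightarrow> \<tau> a b \<in> sphere 0 1" if "w \<in> composable G" for w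
      using nrm that by (cases w) simp
  next
    fix g assume gG: "g \<in> mor G"
    obtain x m y where g: "g = (x, m, y)" by (cases g)
    have xy: "x \<in> paths" "y \<in> paths" using gG by (auto simp: g mor_G)
    have s: "\<sigma> g (src G g) = 1" "\<sigma> (rng G g) g = 1"
      using sigma_two_cocycle gG by (auto simp: two_cocycle_def)
    show "\<tau> g (src G g) = 1" "\<tau> (rng G g) g = 1"
      using s b(3) xy circle_cnj[OF b(2)[OF gG]] by (auto simp: \<tau>_def coboundary1_def g)
  next
    fix g h e assume gh: "(g, h) \<in> composable G" and he: "(h, e) \<in> composable G"
    have s: "\<sigma> h e * \<sigma> g (cmp G h e) = \<sigma> g h * \<sigma> (cmp G g h) e"
      using sigma_two_cocycle gh he unfolding two_cocycle_def by blast
    have a: "cmp G g (cmp G h e) = cmp G (cmp G g h) e"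
      using gh he by (auto elim!: composable_GE simp: add.assoc)
    have "\<tau> h e * \<tau> g (cmp G h e) = (b (cmp G h e) * cnj (b (cmp G h e))) *
      (b g * b h * b e * cnj (b (cmp G (cmp G g h) e))) * (\<sigma> h e * \<sigma> g (cmp G h e))"
      unfolding \<tau>_def coboundary1_def a by (simp add: mult_ac)
    also have "\<dots> = (b (cmp G g h) * cnj (b (cmp G g h))) *
      (b g * b h * b e * cnj (b (cmp G (cmp G g h) e))) * (\<sigma> g h * \<sigma> (cmp G g h) e)"
      unfolding s using circle_cnj(1)[OF b(2)[OF mor(3)[OF he]]] circle_cnj(1)[OF b(2)[OF mor(3)[OF gh]]]
      by simp
    also have "\<dots> = \<tau> g h * \<tau> (cmp G g h) e"
      unfolding \<tau>_def coboundary1_def by (simp add: mult_ac)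
    finally show "\<tau> h e * \<tau> g (cmp G h e) = \<tau> g h * \<tau> (cmp G g h) e" .
  qed
  moreover have "loc_const2 \<tau>"
    unfolding loc_const2_def
  proof (clarify)
    fix g h assume gh: "(g, h) \<in> composable G"
    obtain x m y n z where g: "g = (x, m, y)" and h: "h = (y, n, z)"
      by (rule composable_GE[OF gh])
    obtain K K' K'' where v: "valid g h K K' K''" by (rule valid_exists[OF gh])
    obtain l1 r1 where 1: "compat g l1 r1" "\<And>g'. g' \<in> lcyl g l1 r1 \<Longrightarrow> b g' = b g"
      using b(1) mor(1)[OF gh] unfolding loc_const_def by blast
    obtain l2 r2 where 2: "compat h l2 r2" "\<And>g'. g' \<in> lcyl h l2 r2 \<Longrightarrow> b g' = b h"
      using b(1) mor(2)[OF gh] unfolding loc_const_def by blast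
    obtain l3 r3 where 3: "compat (cmp G g h) l3 r3" "\<And>g'. g' \<in> lcyl (cmp G g h) l3 r3 \<Longrightarrow> b g' = b (cmp G g h)"
      using b(1) mor(3)[OF gh] unfolding loc_const_def by blast
    have lN: "l1 + l2 + l3 \<in> N" using 1 2 3 levD by (auto simp: compat_def)
    \<comment> \<open>Valid degrees are raised until the cylinders fit into those where
      \<open>b\<close> is constant near \<open>g\<close>, \<open>h\<close> and the product; for
      \<open>lcyl_mono\<close> it suffices to compare the first degrees.\<close>
    define L where "L = K + (l1 + l2 + l3)"
    define L' where "L' = K' + (l1 + l2 + l3)"
    define L'' where "L'' = K'' + (l1 + l2 + l3)"
    have C: "compat g K K'" "compat h K' K''" using v by (auto simp: valid_def)
    have L: "compat g L L'" "compat h L' L''"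
      using compat_add[OF C(1) lN] compat_add[OF C(2) lN] by (simp_all add: L_def L'_def L''_def)
    have le: "l1 \<le> L" "l2 \<le> L'" "l3 \<le> L" "K \<le> L" "K' \<le> L'"
      by (auto simp: L_def L'_def le_fun_def)
    have Lgh: "compat (cmp G g h) L L''" using L compat_cmp by (simp add: g h)
    have v': "valid g h L L' L''"
      using v L le unfolding valid_def by (auto intro: order.trans)
    have s1: "lcyl g L L' \<subseteq> lcyl g l1 r1" by (rule lcyl_mono[OF 1(1) _ le(1)]) (use L in \<open>simp add: compat_def\<close>)
    have s2: "lcyl h L' L'' \<subseteq> lcyl h l2 r2" by (rule lcyl_mono[OF 2(1) _ le(2)]) (use L in \<open>simp add: compat_def\<close>)
    have s3: "lcyl (cmp G g h) L L'' \<subseteq> lcyl (cmp G g h) l3 r3"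
      by (rule lcyl_mono[OF 3(1) _ le(3)]) (use Lgh in \<open>simp add: compat_def\<close>)
    have "\<tau> g' h' = \<tau> g h" if "g' \<in> lcyl g L L'" "h' \<in> lcyl h L' L''" "(g', h') \<in> composable G" for g' h'
    proof -
      have "cmp G g' h' \<in> lcyl (cmp G g h) L L''"
        using lcyl_cmp[of x m y L L' n z L'' g' h'] L that by (simp add: g h)
      then have "b (cmp G g' h') = b (cmp G g h)" "b g' = b g" "b h' = b h"
        using that s1 s2 s3 1(2) 2(2) 3(2) by blast+
      then show ?thesis unfolding \<tau>_def coboundary1_def using sigma_locally[OF v' that] by simp
    qed
    then show "\<exists>l l' l''. compat g l l' \<and> compat h l' l'' \<and>
      (\<forall>g'\<in>lcyl g l l'. \<forall>h'\<in>lcyl h l' l''. (g', h') \<in> composable G \<longrightarrow> \<tau> g' h' = \<tau> g h)"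
      using L by blast
  qed
  ultimately show c: "continuous_two_cocycle G (path_groupoid_topology k \<Lambda>) \<tau>"
    unfolding continuous_two_cocycle_def using loc_const2_continuous nrm by blast
  show "cohomologous G (path_groupoid_topology k \<Lambda>) \<tau> \<sigma>"
    unfolding cohomologous_def
  proof (intro conjI c sigma_continuous exI[of _ b] ballI)
    show "continuous_map (path_groupoid_topology k \<Lambda>) (top_of_set (sphere 0 1)) b"
      by (rule loc_const_continuous[OF b(1,2)])
    show "b v = 1" if "v \<in> objects G" for v using G_objects[OF that] b(3) by blast
    show "case w of (g, h) \<Rightarrow> \<tau> g h = coboundary1 G b g h * \<sigma> g h" for w
      by (simp add: \<tau>_def case_prod_beta)
  qed
qed

end

section \<open>Periodicity and the restriction to the isotropy\<close>

lemma composable_monoid [simp]: "composable (monoid_cat A) = A \<times> A"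
  by (auto simp: composable_def monoid_cat_def)

lemma cmp_monoid [simp]: "cmp (monoid_cat A) p q = p + q"
  by (simp add: monoid_cat_def)

lemma two_cocycle_monoid:
  "two_cocycle (monoid_cat A) s \<longleftrightarrow> (\<forall>p\<in>A. \<forall>q\<in>A. norm (s p q) = 1) \<and>
     (\<forall>p\<in>A. s p 0 = 1 \<and> s 0 p = 1) \<and>
     (\<forall>p\<in>A. \<forall>q\<in>A. \<forall>r\<in>A. s q r * s p (q + r) = s p q * s (p + q) r)"
  unfolding two_cocycle_def composable_monoid cmp_monoid by (auto simp: monoid_cat_def)

lemma discrete_two_cocycle:
  assumes "two_cocycle (monoid_cat A) s"
  shows "continuous_two_cocycle (monoid_cat A) (discrete_topology A) s"
  using assms unfolding continuous_two_cocycle_def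
  by (auto simp: two_cocycle_monoid simp flip: prod_topology_discrete_topology)

lemma bicharacter_two_cocycle:
  assumes A: "additive_subgroup A" and w: "bicharacter A w"
  shows "two_cocycle (monoid_cat A) w"
  unfolding two_cocycle_monoid
  using bicharacterD[OF w] bicharacter_zero[OF w] additive_subgroupD[OF A] by simp

text \<open>\<open>s p q * cnj (s q p)\<close> is the commutator of lifts of \<open>p\<close> and
  \<open>q\<close> to the central extension defined by \<open>s\<close>; the quotient being abelian,
  such commutators are central and hence bimultiplicative. Written out, this takes three instances
  of the cocycle identity.\<close>

lemma commutator_bicharacter:
  assumes A: "additive_subgroup A" and s: "two_cocycle (monoid_cat A) s"
  shows "alternating_bicharacter A (\<lambda>p q. s p q * cnj (s q p))"
proof -
  note AD = additive_subgroupD[OF A]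
  have nrm: "norm (s p q) = 1" if "p \<in> A" "q \<in> A" for p q
    using s that by (simp add: two_cocycle_monoid)
  have co: "s q r * s p (q + r) = s p q * s (p + q) r" if "p \<in> A" "q \<in> A" "r \<in> A" for p q r
    using s that by (simp add: two_cocycle_monoid)
  define \<kappa> where "\<kappa> p q = s p q * cnj (s q p)" for p q
  have add: "\<kappa> (p + p') q = \<kappa> p q * \<kappa> p' q" if p: "p \<in> A" and p': "p' \<in> A" and q: "q \<in> A" for p p' q
  proof -
    let ?t = "s p p'"
    have "?t * (s (p + p') q * (s q p * s q p')) = (s p' q * s p (p' + q)) * (s q p * s q p')"
      using co[OF p p' q] by (simp add: mult_ac)
    also have "\<dots> = s p' q * s q p * (s q p' * s p (q + p'))" by (simp add: ac_simps)
    also have "\<dots> = s p' q * s p q * (s q p * s (q + p) p')"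
      using co[OF p q p'] by (simp add: ac_simps)
    also have "\<dots> = ?t * (s q (p + p') * (s p q * s p' q))"
      using co[OF q p p'] by (simp add: mult_ac)
    finally have e: "s (p + p') q * (s q p * s q p') = s q (p + p') * (s p q * s p' q)"
      using nrm[OF p p'] by auto
    have c: "s a b * cnj (s a b) = 1" if "a \<in> A" "b \<in> A" for a b
      using circle_cnj(1) nrm that by blast
    have "\<kappa> (p + p') q = \<kappa> (p + p') q * ((s q p * cnj (s q p)) * (s q p' * cnj (s q p')))"
      by (simp only: c[OF q p] c[OF q p'] mult_1_right)
    also have "\<dots> = (s (p + p') q * (s q p * s q p')) * (cnj (s q p) * cnj (s q p') * cnj (s q (p + p')))"
      unfolding \<kappa>_def by (simp only: mult_ac)
    also have "\<dots> = (s q (p + p') * cnj (s q (p + p'))) * (\<kappa> p q * \<kappa> p' q)"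
      unfolding e \<kappa>_def by (simp add: mult_ac)
    finally show ?thesis using c[OF q AD(4)[OF p p']] by simp
  qed
  have swap: "\<kappa> p q = cnj (\<kappa> q p)" for p q by (simp add: \<kappa>_def)
  have "bicharacter A \<kappa>"
    unfolding bicharacter_def
  proof (intro conjI ballI)
    fix p q assume "p \<in> A" "q \<in> A"
    then show "\<kappa> p q \<in> sphere 0 1" using nrm by (simp add: \<kappa>_def norm_mult)
  next
    fix p p' q assume "p \<in> A" "p' \<in> A" "q \<in> A"
    then show "\<kappa> (p + p') q = \<kappa> p q * \<kappa> p' q" by (rule add)
  next
    fix p q q' assume pq: "p \<in> A" "q \<in> A" "q' \<in> A"
    show "\<kappa> p (q + q') = \<kappa> p q * \<kappa> p q'"
      unfolding swap[of p "q + q'"] swap[of p q] swap[of p q'] add[OF pq(2,3,1)] by simp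
  qed
  moreover have "\<forall>p\<in>A. \<kappa> p p = 1" using nrm circle_cnj by (simp add: \<kappa>_def)
  ultimately show ?thesis by (simp add: alternating_bicharacter_def \<kappa>_def [abs_def])
qed

locale cofinal_kgraph_cocycle = kgraph_cocycle +
  assumes cof: "cofinal_graph k \<Lambda>"
begin

section \<open>Periods seen from a vertex\<close>

abbreviation "Pr \<equiv> Per k \<Lambda>"

text \<open>Unlike the equivalence of two morphisms, this form of periodicity passes along a
  morphism from its range to its source (\<open>periodic_at_transfer\<close>), so that cofinality
  can bring it to any path.\<close>

definition periodic_at :: "'a \<Rightarrow> (nat \<Rightarrow> nat) \<Rightarrow> (nat \<Rightarrow> nat) \<Rightarrow> bool" where
  "periodic_at v l m \<longleftrightarrow> l \<in> N \<and> m \<in> N \<and> (\<forall>z\<in>paths. z (0, 0) = v \<longrightarrow> sh l z = sh m z)"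

lemma shift_commute: "l \<in> N \<Longrightarrow> m \<in> N \<Longrightarrow> sh l (sh m z) = sh m (sh l z)"
  by (simp add: shift_shift add.commute)

lemma periodic_at_PerI:
  assumes per: "periodic_at (z (0, 0)) l m" and z: "z \<in> paths"
  shows "zdiff l m \<in> Pr"
proof -
  have N: "l \<in> N" "m \<in> N" "l + m \<in> N" using per by (auto simp: periodic_at_def)
  \<comment> \<open>These have degrees \<open>l\<close> and \<open>m\<close>. A path
    \<open>w\<close> that begins with \<open>z (0, l + m)\<close> and continues with
    \<open>y\<close> has the shifts \<open>\<mu>y\<close> and \<open>\<nu>y\<close>, which
    periodicity at \<open>z (0, 0)\<close> identifies.\<close>
  let ?\<mu> = "z (m, l + m)" and ?\<nu> = "z (l, l + m)"
  have "path_equiv k \<Lambda> ?\<mu> ?\<nu>"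
    unfolding path_equiv_def
  proof (intro conjI ballI impI)
    show "?\<mu> \<in> mor \<Lambda>" "?\<nu> \<in> mor \<Lambda>" "src \<Lambda> ?\<mu> = src \<Lambda> ?\<nu>" using z N by auto
    fix y assume y: "y \<in> paths" "path_range y = src \<Lambda> ?\<mu>"
    let ?l = "z (0, l + m)"
    define w where "w = prepend k \<Lambda> ?l y"
    have l: "?l \<in> mor \<Lambda>" "path_range y = src \<Lambda> ?l" "deg \<Lambda> ?l = l + m" using z N y by auto
    note w = prepend[OF l(1) y(1) l(2), folded w_def, unfolded l(3)]
    have seg: "w (a, b) = z (a, b)" if "a \<in> N" "b \<in> N" "a \<le> b" "b \<le> l + m" for a b
      by (rule path_seg_eq[OF w(1) z that(1,2) N(3) that(3,4) w(2)])
    have "w (0, 0) = z (0, 0)" using seg[of 0 0] by simp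
    then have lm: "sh l w = sh m w" using per w(1) by (auto simp: periodic_at_def)
    have "sh m w (0, l) = ?\<mu>" "sh l w (0, m) = ?\<nu>"
      using seg[of m "l + m"] seg[of l "l + m"] N by (auto simp: add.commute)
    moreover have "sh l (sh m w) = y" "sh m (sh l w) = y"
      using w(3) N by (auto simp: shift_shift add.commute)
    ultimately have "prepend k \<Lambda> ?\<mu> y = sh m w" "prepend k \<Lambda> ?\<nu> y = sh l w"
      using prepend_eqI[OF shift_path[OF w(1)]] N by blast+
    then show "prepend k \<Lambda> ?\<mu> y = prepend k \<Lambda> ?\<nu> y" using lm by simp
  qed
  then have "zdiff (deg \<Lambda> ?\<mu>) (deg \<Lambda> ?\<nu>) \<in> Pr" unfolding Per_def by blast
  moreover have "deg \<Lambda> ?\<mu> = l" "deg \<Lambda> ?\<nu> = m" using z N by (auto simp: fun_eq_iff)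
  ultimately show ?thesis by simp
qed

text \<open>If \<open>w = \<mu>z = \<nu>z\<close>, then \<open>z\<close> is the shift of
  \<open>w\<close> by either degree; since shifts commute, shifting \<open>z\<close> by one degree
  or the other gives the shift of \<open>w\<close> by their sum.\<close>

lemma PerE:
  assumes "p \<in> Pr"
  obtains v l m where "v \<in> level \<Lambda> 0" "zdiff l m = p" "periodic_at v l m"
proof -
  obtain \<mu> \<nu> where e: "path_equiv k \<Lambda> \<mu> \<nu>" and p: "p = zdiff (deg \<Lambda> \<mu>) (deg \<Lambda> \<nu>)"
    using assms unfolding Per_def by blast
  let ?l = "deg \<Lambda> \<mu>" and ?m = "deg \<Lambda> \<nu>"
  have m: "\<mu> \<in> mor \<Lambda>" "\<nu> \<in> mor \<Lambda>" "src \<Lambda> \<mu> = src \<Lambda> \<nu>" using e by (auto simp: path_equiv_def)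
  have "periodic_at (src \<Lambda> \<mu>) ?l ?m"
    unfolding periodic_at_def
  proof (intro conjI ballI impI)
    fix z assume z: "z \<in> paths" "z (0, 0) = src \<Lambda> \<mu>"
    define w where "w = prepend k \<Lambda> \<mu> z"
    have r: "path_range z = src \<Lambda> \<mu>" "path_range z = src \<Lambda> \<nu>" using z m by (auto simp: path_range_def)
    then have "w = prepend k \<Lambda> \<nu> z" using e z by (auto simp: path_equiv_def w_def)
    then have "sh ?l w = z" "sh ?m w = z"
      using prepend(3)[OF m(1) z(1) r(1)] prepend(3)[OF m(2) z(1) r(2)] w_def by auto
    then show "sh ?l z = sh ?m z" using shift_commute[of ?l ?m w] m by auto
  qed (use m in auto)
  moreover have "src \<Lambda> \<mu> \<in> level \<Lambda> 0" using m by (simp add: level_def)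
  ultimately show thesis using that p by blast
qed

lemma periodic_at_transfer:
  assumes per: "periodic_at (rng \<Lambda> \<alpha>) l m" and \<alpha>: "\<alpha> \<in> mor \<Lambda>"
  shows "periodic_at (src \<Lambda> \<alpha>) l m"
proof -
  have N: "l \<in> N" "m \<in> N" using per by (auto simp: periodic_at_def)
  have "sh l y = sh m y" if y: "y \<in> paths" "y (0, 0) = src \<Lambda> \<alpha>" for y
  proof -
    have r: "path_range y = src \<Lambda> \<alpha>" using y by (simp add: path_range_def)
    define w where "w = prepend k \<Lambda> \<alpha> y"
    note w = prepend[OF \<alpha> y(1) r, folded w_def]
    have "rng \<Lambda> (w (0, deg \<Lambda> \<alpha>)) = w (0, 0)" using w(1) \<alpha> by simp
    then have "sh l w = sh m w" using per w by (auto simp: periodic_at_def)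
    then show ?thesis using w(3) shift_commute N deg_simps(1)[OF \<alpha>] by metis
  qed
  then show ?thesis using N by (simp add: periodic_at_def)
qed

text \<open>Cofinality joins the vertex at which \<open>p\<close> is a period to some vertex of
  \<open>x\<close>, and the period is transferred along the joining morphism.\<close>

lemma Per_on_path:
  assumes x: "x \<in> paths" and p: "p \<in> Pr"
  obtains n l m where "n \<in> N" "zdiff l m = p" "periodic_at (x (n, n)) l m"
proof -
  obtain v l m where v: "v \<in> level \<Lambda> 0" "zdiff l m = p" "periodic_at v l m" using PerE[OF p] .
  obtain n \<alpha> where "n \<in> N" "\<alpha> \<in> mor \<Lambda>" "rng \<Lambda> \<alpha> = v" "src \<Lambda> \<alpha> = x (n, n)"
    using cof x v(1) unfolding cofinal_graph_def by blast
  then show thesis using that v periodic_at_transfer by metis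
qed

text \<open>The vertex \<open>x (n, n)\<close> at which \<open>p\<close> is a period is seen in an
  initial segment of \<open>x\<close>, so the relation between the shifts holds for all paths near
  \<open>x\<close>. Openness of the isotropy over Per rests on this.\<close>

lemma Per_locally:
  assumes x: "x \<in> paths" and p: "p \<in> Pr"
  obtains l m where "lev k p l m" "\<And>x'. x' \<in> paths \<Longrightarrow> x' (0, l) = x (0, l) \<Longrightarrow> sh l x' = sh m x'"
proof -
  obtain n l m where n: "n \<in> N" and lm: "zdiff l m = p" "periodic_at (x (n, n)) l m"
    using Per_on_path[OF assms] .
  have N: "l \<in> N" "m \<in> N" using lm by (auto simp: periodic_at_def)
  show thesis
  proof (rule that[of "l + n" "m + n"])
    show "lev k p (l + n) (m + n)" using N n lm by (auto simp: lev_def zdiff_def)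
    fix x' assume x': "x' \<in> paths" "x' (0, l + n) = x (0, l + n)"
    have "x' (n, n) = x (n, n)"
      using path_seg_eq[of x' x n n "l + n"] x x' n N by simp
    then have "sh l (sh n x') = sh m (sh n x')"
      using lm x' n by (auto simp: periodic_at_def)
    then show "sh (l + n) x' = sh (m + n) x'" using N by (simp add: shift_shift)
  qed
qed

text \<open>Both periods are moved along a path to the common vertex
  \<open>x (n + n', n + n')\<close>, where the two relations between shifts can be composed.\<close>

lemma Per_subgroup:
  assumes "paths \<noteq> {}"
  shows "additive_subgroup Pr"
proof -
  obtain x where x: "x \<in> paths" using assms by blast
  have "periodic_at (x (0, 0)) 0 0" by (simp add: periodic_at_def)
  then have "zdiff 0 0 \<in> Pr" using x by (rule periodic_at_PerI)
  then have "0 \<in> Pr" by (simp add: zdiff_def zero_fun_def)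
  moreover have "p - q \<in> Pr" if p: "p \<in> Pr" and q: "q \<in> Pr" for p q
  proof -
    obtain n l m where n: "n \<in> N" and lm: "zdiff l m = p" "periodic_at (x (n, n)) l m"
      using Per_on_path[OF x p] .
    obtain n' l' m' where n': "n' \<in> N" and lm': "zdiff l' m' = q" "periodic_at (x (n', n')) l' m'"
      using Per_on_path[OF x q] .
    let ?v = "x (n + n', n + n')"
    have 1: "periodic_at ?v l m"
      using periodic_at_transfer[of "x (n, n + n')" l m] lm x n n' by simp
    have 2: "periodic_at ?v l' m'"
      using periodic_at_transfer[of "x (n', n + n')" l' m'] lm' x n n' by simp
    have N: "l \<in> N" "m \<in> N" "l' \<in> N" "m' \<in> N" using lm lm' by (auto simp: periodic_at_def)
    have "sh (l + m') z = sh (m + l') z" if "z \<in> paths" "z (0, 0) = ?v" for z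
    proof -
      have e: "sh l z = sh m z" "sh l' z = sh m' z" using 1 2 that by (auto simp: periodic_at_def)
      have "sh (l + m') z = sh m' (sh l z)" using N by (simp add: shift_shift add.commute)
      also have "\<dots> = sh m (sh l' z)" unfolding e using N by (simp add: shift_commute)
      finally show ?thesis using N by (simp add: shift_shift)
    qed
    then have "periodic_at ?v (l + m') (m + l')" using N by (simp add: periodic_at_def)
    then have "zdiff (l + m') (m + l') \<in> Pr"
      using periodic_at_PerI[of "sh (n + n') x"] x n n' by simp
    moreover have "zdiff (l + m') (m + l') = p - q"
      using lm(1)[symmetric] lm'(1)[symmetric] by (auto simp: zdiff_def fun_eq_iff)
    ultimately show ?thesis by simp
  qed
  ultimately show ?thesis by (simp add: additive_subgroup_def)
qed

lemma Per_bound: "\<forall>p\<in>Pr. \<forall>i\<ge>k. p i = 0"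
proof (intro ballI allI impI)
  fix p and i :: nat
  assume "p \<in> Pr" "i \<ge> k"
  then show "p i = 0" by (auto elim!: PerE simp: periodic_at_def Nk_def zdiff_def)
qed

section \<open>Isotropy arrows over Per and their dependence on the path\<close>

lemma Per_isotropy:
  assumes x: "x \<in> paths" and p: "p \<in> Pr"
  shows "(x, p, x) \<in> mor G"
proof -
  obtain l m where "lev k p l m" "\<And>x'. x' \<in> paths \<Longrightarrow> x' (0, l) = x (0, l) \<Longrightarrow> sh l x' = sh m x'"
    using Per_locally[OF assms] by blast
  then show ?thesis using x by (intro compat_mor[of _ l m]) simp
qed

lemma Per_composable:
  "x \<in> paths \<Longrightarrow> p \<in> Pr \<Longrightarrow> q \<in> Pr \<Longrightarrow> ((x, p, x), (x, q, x)) \<in> composable G"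
  by (simp add: composable_GI Per_isotropy)

text \<open>The coefficient group for cochains on Per; membership is what later makes the cochain on
  the groupoid locally constant.\<close>

definition locM :: "(((nat \<Rightarrow> nat) \<times> (nat \<Rightarrow> nat) \<Rightarrow> 'a) \<Rightarrow> complex) set" where
  "locM = {\<phi>. (\<forall>x\<in>paths. norm (\<phi> x) = 1) \<and>
     (\<forall>x\<in>paths. \<exists>n\<in>N. \<forall>x'\<in>paths. x' (0, n) = x (0, n) \<longrightarrow> \<phi> x' = \<phi> x)}"

lemma init_mono:
  assumes "x \<in> paths" "x' \<in> paths" "n \<in> N" "m \<in> N" "m \<le> n" "x' (0, n) = x (0, n)"
  shows "x' (0, m) = x (0, m)"
  by (rule path_seg_eq[OF assms(2,1) _ assms(4,3) _ assms(5,6)]) simp_all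

lemma locM_group: "circle_function_group paths locM"
  unfolding circle_function_group_def
proof (intro conjI ballI)
  show "(\<lambda>_. 1) \<in> locM" unfolding locM_def by (auto intro: Nk_simps(1))
next
  fix \<phi> \<psi> assume "\<phi> \<in> locM" "\<psi> \<in> locM"
  then have nrm: "\<forall>x\<in>paths. norm (\<phi> x) = 1" "\<forall>x\<in>paths. norm (\<psi> x) = 1"
    and loc: "\<forall>x\<in>paths. \<exists>n\<in>N. \<forall>x'\<in>paths. x' (0, n) = x (0, n) \<longrightarrow> \<phi> x' = \<phi> x"
    "\<forall>x\<in>paths. \<exists>n\<in>N. \<forall>x'\<in>paths. x' (0, n) = x (0, n) \<longrightarrow> \<psi> x' = \<psi> x"
    by (simp_all add: locM_def)
  show "(\<lambda>x. \<phi> x * \<psi> x) \<in> locM"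
    unfolding locM_def
  proof (intro CollectI conjI ballI)
    fix x assume x: "x \<in> paths"
    then show "norm (\<phi> x * \<psi> x) = 1" using nrm by (simp add: norm_mult)
    obtain n where n: "n \<in> N" "\<forall>x'\<in>paths. x' (0, n) = x (0, n) \<longrightarrow> \<phi> x' = \<phi> x"
      by (rule bexE[OF bspec[OF loc(1) x]])
    obtain m where m: "m \<in> N" "\<forall>x'\<in>paths. x' (0, m) = x (0, m) \<longrightarrow> \<psi> x' = \<psi> x"
      by (rule bexE[OF bspec[OF loc(2) x]])
    show "\<exists>n\<in>N. \<forall>x'\<in>paths. x' (0, n) = x (0, n) \<longrightarrow> \<phi> x' * \<psi> x' = \<phi> x * \<psi> x"
    proof (intro bexI[of _ "n + m"] ballI impI)
      fix x' assume x': "x' \<in> paths" "x' (0, n + m) = x (0, n + m)"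
      have "x' (0, n) = x (0, n)" "x' (0, m) = x (0, m)"
        using init_mono[of x x' "n + m" n] init_mono[of x x' "n + m" m] x x' n(1) m(1) by simp_all
      then show "\<phi> x' * \<psi> x' = \<phi> x * \<psi> x" using n m x' by simp
    qed (use n m in simp)
  qed
next
  fix \<phi> assume "\<phi> \<in> locM"
  then show "(\<lambda>x. cnj (\<phi> x)) \<in> locM" by (simp add: locM_def)
next
  fix \<phi> x assume "\<phi> \<in> locM" "x \<in> paths"
  then show "norm (\<phi> x) = 1" by (simp add: locM_def)
qed

abbreviation "\<sigma>x x p q \<equiv> \<sigma> (x, p, x) (x, q, x)"

lemma Per_lcyl:
  assumes x: "x \<in> paths" and x': "x' \<in> paths" and c: "compat (x, p, x) L L'"
    and lm: "lev k p l m" "l \<le> L" "sh l x' = sh m x'"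
    and e: "x' (0, L) = x (0, L)" "x' (0, L') = x (0, L')"
  shows "(x', p, x') \<in> lcyl (x, p, x) L L'"
proof -
  have "compat (x', p, x') l m" using lm x' by simp
  moreover have "lev k (fst (snd (x', p, x'))) L L'" using c by simp
  ultimately have "compat (x', p, x') L L'" using lm(2) by (rule compat_mono)
  then show ?thesis unfolding lcyl_iff[OF c] using e by blast
qed

lemma valid_add:
  assumes "valid g h L L' L''" "n \<in> N"
  shows "valid g h (L + n) (L' + n) (L'' + n)"
  using assms compat_add unfolding valid_def by (auto simp: le_fun_def intro: trans_le_add1)

lemma sigma_locM:
  assumes p: "p \<in> Pr" and q: "q \<in> Pr"
  shows "(\<lambda>x. \<sigma>x x p q) \<in> locM"
  unfolding locM_def
proof (intro CollectI conjI ballI)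
  fix x assume x: "x \<in> paths"
  show "norm (\<sigma>x x p q) = 1" by (rule sigma_norm[OF Per_composable[OF x p q]])
  obtain l1 m1 where 1: "lev k p l1 m1" "\<And>x'. x' \<in> paths \<Longrightarrow> x' (0, l1) = x (0, l1) \<Longrightarrow> sh l1 x' = sh m1 x'"
    using Per_locally[OF x p] by blast
  obtain l2 m2 where 2: "lev k q l2 m2" "\<And>x'. x' \<in> paths \<Longrightarrow> x' (0, l2) = x (0, l2) \<Longrightarrow> sh l2 x' = sh m2 x'"
    using Per_locally[OF x q] by blast
  obtain K K' K'' where K: "valid (x, p, x) (x, q, x) K K' K''"
    using valid_exists[OF Per_composable[OF x p q]] .
  define L where "L = K + (l1 + l2)"
  define L' where "L' = K' + (l1 + l2)"
  define L'' where "L'' = K'' + (l1 + l2)"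
  have lN: "l1 \<in> N" "l2 \<in> N" using 1 2 levD by auto
  then have v: "valid (x, p, x) (x, q, x) L L' L''"
    unfolding L_def L'_def L''_def by (intro valid_add[OF K]) simp
  have c: "compat (x, p, x) L L'" "compat (x, q, x) L' L''" using v by (auto simp: valid_def)
  have LN: "L \<in> N" "L' \<in> N" "L'' \<in> N" using c levD by auto
  have le: "l1 \<le> L" "l2 \<le> L'" by (auto simp: L_def L'_def le_fun_def)
  \<comment> \<open>In a pair of isotropy arrows one path serves as range, middle and source, so
    \<open>x'\<close> must agree with \<open>x\<close> up to all three degrees.\<close>
  let ?n = "L + L' + L''"
  have n: "?n \<in> N" using LN by simp
  have nle: "L \<le> ?n" "L' \<le> ?n" "L'' \<le> ?n" by (auto simp: le_fun_def)
  then have lle: "l1 \<le> ?n" "l2 \<le> ?n" using le order.trans by blast+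
  show "\<exists>n\<in>N. \<forall>x'\<in>paths. x' (0, n) = x (0, n) \<longrightarrow> \<sigma>x x' p q = \<sigma>x x p q"
  proof (intro bexI[OF _ n] ballI impI)
    fix x' assume x': "x' \<in> paths" "x' (0, ?n) = x (0, ?n)"
    note im = init_mono[OF x x'(1) n _ _ x'(2)]
    show "\<sigma>x x' p q = \<sigma>x x p q"
    proof (rule sigma_locally[OF v])
      show "(x', p, x') \<in> lcyl (x, p, x) L L'"
        by (rule Per_lcyl[OF x x'(1) c(1) 1(1) le(1) 1(2)[OF x'(1) im[OF lN(1) lle(1)]] im[OF LN(1) nle(1)] im[OF LN(2) nle(2)]])
      show "(x', q, x') \<in> lcyl (x, q, x) L' L''"
        by (rule Per_lcyl[OF x x'(1) c(2) 2(1) le(2) 2(2)[OF x'(1) im[OF lN(2) lle(2)]] im[OF LN(2) nle(2)] im[OF LN(3) nle(3)]])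
      show "((x', p, x'), (x', q, x')) \<in> composable G" by (rule Per_composable[OF x'(1) p q])
    qed
  qed
qed

lemma sigma_at_cocycle:
  assumes x: "x \<in> paths"
  shows "two_cocycle (monoid_cat Pr) (sigma_c_at k \<Lambda> P c x)"
  unfolding two_cocycle_monoid sigma_c_at_def
proof (intro conjI ballI)
  fix p q assume "p \<in> Pr" "q \<in> Pr"
  then show "norm (\<sigma>x x p q) = 1" using sigma_norm Per_composable x by blast
next
  fix p assume p: "p \<in> Pr"
  have "\<sigma> (x, p, x) (src G (x, p, x)) = 1" "\<sigma> (rng G (x, p, x)) (x, p, x) = 1"
    using sigma_two_cocycle Per_isotropy[OF x p] unfolding two_cocycle_def by blast+
  then show "\<sigma>x x p 0 = 1" "\<sigma>x x 0 p = 1" by simp_all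
next
  fix p q r assume "p \<in> Pr" "q \<in> Pr" "r \<in> Pr"
  then have "((x, p, x), (x, q, x)) \<in> composable G" "((x, q, x), (x, r, x)) \<in> composable G"
    using Per_composable x by blast+
  then have "\<sigma> (x, q, x) (x, r, x) * \<sigma> (x, p, x) (cmp G (x, q, x) (x, r, x)) =
    \<sigma> (x, p, x) (x, q, x) * \<sigma> (cmp G (x, p, x) (x, q, x)) (x, r, x)"
    using sigma_two_cocycle unfolding two_cocycle_def by blast
  then show "\<sigma>x x q r * \<sigma>x x p (q + r) = \<sigma>x x p q * \<sigma>x x (p + q) r" by simp
qed

text \<open>Conjugation by an arrow \<open>(x, m, y)\<close> carries the isotropy of \<open>y\<close> to that of \<open>x\<close>, and a
  commutator does not see the scalars that the cocycle introduces.\<close>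

lemma commutator_invariant:
  assumes g: "(x, m, y) \<in> mor G" and p: "p \<in> Pr" and q: "q \<in> Pr"
  shows "\<sigma>x x p q * \<sigma>x y q p = \<sigma>x x q p * \<sigma>x y p q"
proof -
  have xy: "x \<in> paths" "y \<in> paths" using g by (auto simp: mor_G)
  let ?g = "(x, m, y)"
  let ?u = "\<lambda>p. (x, p, x)" and ?v = "\<lambda>p. (y, p, y)" and ?h = "\<lambda>p. (x, p + m, y)"
  have co: "\<sigma> b e * \<sigma> a (cmp G b e) = \<sigma> a b * \<sigma> (cmp G a b) e"
    if "(a, b) \<in> composable G" "(b, e) \<in> composable G" for a b e
    using sigma_two_cocycle that unfolding two_cocycle_def by blast
  have mu: "?u p \<in> mor G" "?v p \<in> mor G" if "p \<in> Pr" for p using Per_isotropy xy that by auto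
  have mh: "?h p \<in> mor G" if "p \<in> Pr" for p using mor_G_cmp[OF mu(1)[OF that] g] .
  have nz: "\<sigma> a b \<noteq> 0" if "(a, b) \<in> composable G" for a b using sigma_norm[OF that] by auto
  \<comment> \<open>Three instances of the cocycle identity: two isotropy arrows to the left of
    \<open>?g\<close>, two to the right, and one on each side. They are linked by
    \<open>?h p\<close>, which is both \<open>?u p\<close> times \<open>?g\<close> and
    \<open>?g\<close> times \<open>?v p\<close>.\<close>
  have c1: "\<sigma> (?u p') ?g * \<sigma> (?u p) (?h p') = \<sigma> (?u p) (?u p') * \<sigma> (x, p + p', x) ?g"
    if "p \<in> Pr" "p' \<in> Pr" for p p'
    using co[of "?u p" "?u p'" ?g] mu that g by (simp add: composable_GI)
  have c2: "\<sigma> (?v p) (?v p') * \<sigma> ?g (y, p + p', y) = \<sigma> ?g (?v p) * \<sigma> (?h p) (?v p')"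
    if "p \<in> Pr" "p' \<in> Pr" for p p'
    using co[of ?g "?v p" "?v p'"] mu that g by (simp add: composable_GI add.commute)
  have c3: "\<sigma> ?g (?v p') * \<sigma> (?u p) (?h p') = \<sigma> (?u p) ?g * \<sigma> (?h p) (?v p')"
    if "p \<in> Pr" "p' \<in> Pr" for p p'
    using co[of "?u p" ?g "?v p'"] mu that g by (simp add: composable_GI add.commute)
  define W where "W = \<sigma> (x, p + q, x) ?g"
  define Z where "Z = \<sigma> ?g (y, p + q, y)"
  have W: "\<sigma> (?u q) ?g * \<sigma> (?u p) (?h q) = \<sigma>x x p q * W"
    "\<sigma> (?u p) ?g * \<sigma> (?u q) (?h p) = \<sigma>x x q p * W"
    using c1[OF p q] c1[OF q p] by (simp_all add: W_def add.commute)
  have Z: "\<sigma>x y p q * Z = \<sigma> ?g (?v p) * \<sigma> (?h p) (?v q)"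
    "\<sigma>x y q p * Z = \<sigma> ?g (?v q) * \<sigma> (?h q) (?v p)"
    using c2[OF p q] c2[OF q p] by (simp_all add: Z_def add.commute)
  have "(\<sigma>x x p q * \<sigma>x y q p) * (W * Z) = (\<sigma>x x p q * W) * (\<sigma>x y q p * Z)" by (simp add: mult_ac)
  also have "\<dots> = \<sigma> (?u q) ?g * (\<sigma> ?g (?v q) * \<sigma> (?u p) (?h q)) * \<sigma> (?h q) (?v p)"
    unfolding W[symmetric] Z by (simp add: mult_ac)
  also have "\<dots> = \<sigma> (?u p) ?g * (\<sigma> (?u q) ?g * \<sigma> (?h q) (?v p)) * \<sigma> (?h p) (?v q)"
    unfolding c3[OF p q] by (simp add: mult_ac)
  also have "\<dots> = (\<sigma>x x q p * W) * (\<sigma>x y p q * Z)"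
    unfolding W[symmetric] Z c3[OF q p, symmetric] by (simp add: mult_ac)
  also have "\<dots> = (\<sigma>x x q p * \<sigma>x y p q) * (W * Z)" by (simp add: mult_ac)
  finally have "(\<sigma>x x p q * \<sigma>x y q p) * (W * Z) = (\<sigma>x x q p * \<sigma>x y p q) * (W * Z)" .
  moreover have "W \<noteq> 0"
  proof -
    have "(x, p + q, x) \<in> mor G" using mor_G_cmp mu p q by blast
    then show ?thesis unfolding W_def using g by (intro nz composable_GI)
  qed
  moreover have "Z \<noteq> 0"
  proof -
    have "(y, p + q, y) \<in> mor G" using mor_G_cmp mu p q by blast
    then show ?thesis unfolding Z_def using g by (intro nz composable_GI)
  qed
  ultimately show ?thesis by simp
qed

definition commut :: "((nat \<Rightarrow> nat) \<times> (nat \<Rightarrow> nat) \<Rightarrow> 'a) \<Rightarrow> (nat \<Rightarrow> int) \<Rightarrow> (nat \<Rightarrow> int) \<Rightarrow> complex" where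
  "commut x p q = \<sigma>x x p q * cnj (\<sigma>x x q p)"

lemma commut_orbit:
  assumes g: "(x, m, y) \<in> mor G" and p: "p \<in> Pr" and q: "q \<in> Pr"
  shows "commut x p q = commut y p q"
proof -
  have xy: "x \<in> paths" "y \<in> paths" using g by (auto simp: mor_G)
  have n: "norm (\<sigma>x x q p) = 1" "norm (\<sigma>x y q p) = 1" using sigma_norm Per_composable xy p q by auto
  have "commut x p q = (\<sigma>x x p q * \<sigma>x y q p) * cnj (\<sigma>x y q p) * cnj (\<sigma>x x q p)"
    using circle_cnj(1)[OF n(2)] by (simp add: commut_def mult.assoc)
  also have "\<dots> = (\<sigma>x x q p * cnj (\<sigma>x x q p)) * commut y p q"
    unfolding commutator_invariant[OF g p q] commut_def by (simp add: mult_ac)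
  finally show ?thesis using circle_cnj(1)[OF n(1)] by simp
qed

lemma commut_constant:
  assumes x: "x \<in> paths" and z: "z \<in> paths" and p: "p \<in> Pr" and q: "q \<in> Pr"
  shows "commut x p q = commut z p q"
proof -
  have "(\<lambda>x. commut x p q) \<in> locM"
    unfolding commut_def
    by (rule circle_function_groupD(2)[OF locM_group sigma_locM[OF p q]
          circle_function_groupD(3)[OF locM_group sigma_locM[OF q p]]])
  then obtain n where n: "n \<in> N" "\<And>x'. x' \<in> paths \<Longrightarrow> x' (0, n) = z (0, n) \<Longrightarrow> commut x' p q = commut z p q"
    using z unfolding locM_def by blast
  have "z (n, n) \<in> level \<Lambda> 0" using z n by (simp add: level_def)
  then obtain n' \<alpha> where \<alpha>: "n' \<in> N" "\<alpha> \<in> mor \<Lambda>" "rng \<Lambda> \<alpha> = z (n, n)" "src \<Lambda> \<alpha> = x (n', n')"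
    using cof x unfolding cofinal_graph_def by blast
  \<comment> \<open>Density of the orbit of \<open>x\<close>, made explicit: the path
    \<open>w\<close> runs along \<open>z\<close> up to \<open>n\<close>, then along \<alpha>, and
    continues as a tail of \<open>x\<close>; so it is near \<open>z\<close> and in the orbit of
    \<open>x\<close>.\<close>
  let ?l = "cmp \<Lambda> (z (0, n)) \<alpha>"
  have l: "?l \<in> mor \<Lambda>" "deg \<Lambda> ?l = n + deg \<Lambda> \<alpha>" "src \<Lambda> ?l = x (n', n')" using \<alpha> z n by auto
  have s: "sh n' x \<in> paths" "path_range (sh n' x) = src \<Lambda> ?l" using x \<alpha> l by auto
  define w where "w = prepend k \<Lambda> ?l (sh n' x)"
  note w = prepend[OF l(1) s, folded w_def, unfolded l(2)]
  have "cmp \<Lambda> (w (0, n)) (w (n, n + deg \<Lambda> \<alpha>)) = ?l"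
    using path_cmp[of w 0 n "n + deg \<Lambda> \<alpha>"] w n \<alpha> by simp
  then have "w (0, n) = z (0, n)"
    using factor_unique[of "w (0, n)" "w (n, n + deg \<Lambda> \<alpha>)" "z (0, n)" \<alpha>] w z n \<alpha> by simp
  then have 1: "commut w p q = commut z p q" using n w by blast
  have "compat (w, zdiff (n + deg \<Lambda> \<alpha>) n', x) (n + deg \<Lambda> \<alpha>) n'"
    using w x n \<alpha> by (simp add: lev_def)
  then have "commut w p q = commut x p q" using commut_orbit[OF compat_mor p q] by blast
  with 1 show ?thesis by simp
qed

text \<open>The assumption \<open>sym\<close> says, without division, that the bicharacter has the
  commutators of the cocycle at every \<open>x\<close>; this makes the quotient \<open>s\<close>
  symmetric. Both claims of the theorem are reduced to this lemma.\<close>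

lemma isotropy_trivialisation:
  assumes ne: "paths \<noteq> {}" and \<omega>: "bicharacter Pr \<omega>"
    and sym: "\<And>x p q. x \<in> paths \<Longrightarrow> p \<in> Pr \<Longrightarrow> q \<in> Pr \<Longrightarrow> \<sigma>x x p q * \<omega> q p = \<sigma>x x q p * \<omega> p q"
  shows "\<exists>b. (\<forall>p\<in>Pr. (\<lambda>x. b x p) \<in> locM) \<and> (\<forall>x\<in>paths. b x 0 = 1) \<and>
    (\<forall>x\<in>paths. \<forall>p\<in>Pr. \<forall>q\<in>Pr. b x p * b x q * cnj (b x (p + q)) * \<sigma>x x p q = \<omega> p q)"
proof -
  note A = Per_subgroup[OF ne]
  note AD = additive_subgroupD[OF A] and MD = circle_function_groupD[OF locM_group]
  have w: "norm (\<omega> p q) = 1" if "p \<in> Pr" "q \<in> Pr" for p q using bicharacterD(1)[OF \<omega> that] .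
  define s where "s x p q = \<sigma>x x p q * cnj (\<omega> p q)" for x p q
  have co: "two_cocycle (monoid_cat Pr) (\<sigma>x x)" if "x \<in> paths" for x
    using sigma_at_cocycle[OF that] by (simp add: sigma_c_at_def [abs_def])
  have cow: "two_cocycle (monoid_cat Pr) \<omega>" by (rule bicharacter_two_cocycle[OF A \<omega>])
  have "symmetric_cocycle paths locM Pr s"
    unfolding symmetric_cocycle_def
  proof (intro conjI ballI)
    fix p q assume "p \<in> Pr" "q \<in> Pr"
    moreover from this have "(\<lambda>_. cnj (\<omega> p q)) \<in> locM"
      using w by (auto simp: locM_def intro: Nk_simps(1))
    ultimately show "(\<lambda>x. s x p q) \<in> locM" unfolding s_def using MD(2) sigma_locM by blast
  next
    fix x p assume "x \<in> paths" "p \<in> Pr"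
    then show "s x p 0 = 1" using co cow by (simp add: s_def two_cocycle_monoid)
  next
    fix x p q assume xpq: "x \<in> paths" "p \<in> Pr" "q \<in> Pr"
    have "s x p q = (\<sigma>x x p q * \<omega> q p) * cnj (\<omega> q p) * cnj (\<omega> p q)"
      using circle_cnj(1)[OF w[OF xpq(3,2)]] by (simp add: s_def mult.assoc)
    also have "\<dots> = s x q p * (\<omega> p q * cnj (\<omega> p q))"
      unfolding sym[OF xpq] by (simp add: s_def mult_ac)
    finally show "s x p q = s x q p" using circle_cnj(1)[OF w[OF xpq(2,3)]] by simp
  next
    fix x p q r assume xpq: "x \<in> paths" "p \<in> Pr" "q \<in> Pr" "r \<in> Pr"
    have 1: "\<sigma>x x q r * \<sigma>x x p (q + r) = \<sigma>x x p q * \<sigma>x x (p + q) r"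
      using co[OF xpq(1)] xpq unfolding two_cocycle_monoid by blast
    have 2: "\<omega> q r * \<omega> p (q + r) = \<omega> p q * \<omega> (p + q) r"
      using cow xpq unfolding two_cocycle_monoid by blast
    have "s x q r * s x p (q + r) = (\<sigma>x x q r * \<sigma>x x p (q + r)) * cnj (\<omega> q r * \<omega> p (q + r))"
      by (simp add: s_def mult_ac)
    also have "\<dots> = s x p q * s x (p + q) r" unfolding 1 2 by (simp add: s_def mult_ac)
    finally show "s x q r * s x p (q + r) = s x p q * s x (p + q) r" .
  qed
  then obtain f where f: "trivialises paths locM Pr f s"
    using symmetric_cocycle_trivial[OF A Per_bound locM_group] by blast
  have fM: "(\<lambda>x. f x p) \<in> locM" if "p \<in> Pr" for p using f that by (simp add: trivialises_def)
  have fn: "norm (f x p) = 1" if "x \<in> paths" "p \<in> Pr" for x p using MD(4)[OF fM[OF that(2)] that(1)] .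
  have fa: "f x (p + q) = f x p * f x q * s x p q" if "x \<in> paths" "p \<in> Pr" "q \<in> Pr" for x p q
    using f that by (simp add: trivialises_def)
  show ?thesis
  proof (intro exI[of _ f] conjI ballI)
    show "(\<lambda>x. f x p) \<in> locM" if "p \<in> Pr" for p by (rule fM[OF that])
    show "f x 0 = 1" if x: "x \<in> paths" for x
    proof -
      have "s x 0 0 = 1" using co[OF x] cow AD(1) by (simp add: s_def two_cocycle_monoid)
      then have "f x 0 = f x 0 * f x 0" using fa[OF x AD(1) AD(1)] by simp
      moreover have "f x 0 \<noteq> 0" using fn[OF x AD(1)] by auto
      ultimately show ?thesis by simp
    qed
    fix x p q assume xpq: "x \<in> paths" "p \<in> Pr" "q \<in> Pr"
    have "f x p * f x q * cnj (f x (p + q)) * \<sigma>x x p q =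
       (f x p * cnj (f x p)) * (f x q * cnj (f x q)) * (\<sigma>x x p q * cnj (\<sigma>x x p q)) * \<omega> p q"
      unfolding fa[OF xpq] s_def by (simp add: mult_ac)
    then show "f x p * f x q * cnj (f x (p + q)) * \<sigma>x x p q = \<omega> p q"
      by (simp only: circle_cnj(1)[OF sigma_norm[OF Per_composable[OF xpq]]]
        circle_cnj(1)[OF fn[OF xpq(1,2)]] circle_cnj(1)[OF fn[OF xpq(1,3)]] mult_1_left)
  qed
qed

text \<open>The path \<open>x'\<close> inherits the periodicity of \<open>x\<close>, so its tail
  from \<open>m + j\<close> on is that of \<open>y'\<close>. It is known up to \<open>l + j\<close>
  only, but periodicity copies \<open>x' (l, l + j)\<close> to \<open>x' (m, m + j)\<close>, so it
  agrees with \<open>y'\<close> up to \<open>m + j\<close> as well; the bound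
  \<open>m \<le> j\<close> ensures that the part up to \<open>m\<close> is known.\<close>

lemma isotropy_cylinder:
  assumes x: "x \<in> paths" and lm: "lev k p l m" and sh: "\<And>x'. x' \<in> paths \<Longrightarrow> x' (0, l) = x (0, l) \<Longrightarrow> sh l x' = sh m x'"
    and j: "j \<in> N" "m \<le> j" and h: "(x', q, y') \<in> lcyl (x, p, x) (l + j) (m + j)"
  shows "q = p \<and> x' = y' \<and> x' (0, l + j) = x (0, l + j)"
proof -
  have N: "l \<in> N" "m \<in> N" using lm levD by auto
  have "compat (x, p, x) l m" using x lm sh[OF x] by simp
  from lcyl_iff[OF compat_add[OF this j(1)]] h
  have e: "x' (0, l + j) = x (0, l + j)" "y' (0, m + j) = x (0, m + j)" "q = p"
    and c: "x' \<in> paths" "y' \<in> paths" "sh (l + j) x' = sh (m + j) y'" by auto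
  have seg: "x' (a, b) = x (a, b)" if "a \<in> N" "b \<in> N" "a \<le> b" "b \<le> l + j" for a b
    using path_seg_eq[of x' x a b "l + j"] c x that e N j by simp
  have s': "sh l x' = sh m x'" using sh c seg[of 0 l] N by simp
  have "x' (m, m + j) = sh m x' (0, j)" using j by (simp add: add.commute)
  also have "\<dots> = x' (l, l + j)" unfolding s'[symmetric] using j by (simp add: add.commute)
  also have "\<dots> = sh l x (0, j)" using seg[of l "l + j"] N j by (simp add: add.commute)
  also have "\<dots> = x (m, m + j)" unfolding sh[OF x refl] using j by (simp add: add.commute)
  finally have 1: "x' (m, m + j) = x (m, m + j)" .
  have "m \<le> l + j" using order.trans[OF j(2), of "l + j"] by simp
  then have "x' (0, m) = x (0, m)" using seg[of 0 m] N by simp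
  then have "x' (0, m + j) = x (0, m + j)"
    using path_cmp[of x' 0 m "m + j"] path_cmp[of x 0 m "m + j"] 1 c x N j by simp
  then have 2: "x' (0, m + j) = y' (0, m + j)" using e by simp
  have "sh (m + j) x' = sh (l + j) x'" by (rule shift_eq_add[OF s'[symmetric] j(1)])
  then have "sh (m + j) x' = sh (m + j) y'" using c by simp
  then have "x' = y'" using path_split_eq[of x' y' "m + j"] c 2 N j by simp
  then show ?thesis using e by simp
qed

text \<open>Since the isotropy over \<open>Per\<close> is open and closed, a locally constant function on it may be
  extended by 1.\<close>

lemma isotropy_extension_loc_const:
  assumes b: "\<And>p. p \<in> Pr \<Longrightarrow> (\<lambda>x. b x p) \<in> locM"
  shows "loc_const (\<lambda>(x, p, y). if x = y \<and> p \<in> Pr then b x p else 1)" (is "loc_const ?B")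
  unfolding loc_const_def
proof
  fix g assume gG: "g \<in> mor G"
  obtain x p y where g: "g = (x, p, y)" by (cases g)
  have xy: "x \<in> paths" "y \<in> paths" using gG by (auto simp: g mor_G)
  obtain l0 m0 where c0: "compat g l0 m0" using compat_exists[OF gG] by blast
  have N0: "l0 \<in> N" "m0 \<in> N" using c0 levD by (auto simp: g)
  show "\<exists>l l'. compat g l l' \<and> (\<forall>h\<in>lcyl g l l'. ?B h = ?B g)"
  proof (cases "x = y \<and> p \<in> Pr")
    case True
    then have p: "p \<in> Pr" and yx: "y = x" by auto
    obtain l m where lm: "lev k p l m" and sh: "\<And>x'. x' \<in> paths \<Longrightarrow> x' (0, l) = x (0, l) \<Longrightarrow> sh l x' = sh m x'"
      using Per_locally[OF xy(1) p] by blast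
    have N: "l \<in> N" "m \<in> N" using lm levD by auto
    have "\<exists>n\<in>N. \<forall>x'\<in>paths. x' (0, n) = x (0, n) \<longrightarrow> b x' p = b x p"
      using b[OF p] xy(1) by (simp add: locM_def)
    then obtain n where n: "n \<in> N" "\<forall>x'\<in>paths. x' (0, n) = x (0, n) \<longrightarrow> b x' p = b x p" by (rule bexE)
    \<comment> \<open>The summand \<open>m\<close> is there for the bound in
      \<open>isotropy_cylinder\<close>, \<open>n\<close> for the constancy of
      \<open>b x' p\<close>.\<close>
    let ?j = "m + n"
    have j: "?j \<in> N" "m \<le> ?j" "n \<le> l + ?j" using N n by (auto simp: le_fun_def)
    have c: "compat (x, p, x) (l + ?j) (m + ?j)"
      using compat_add[of "(x, p, x)" l m ?j] lm sh[OF xy(1)] xy(1) j by simp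
    have "?B h = ?B g" if h: "h \<in> lcyl (x, p, x) (l + ?j) (m + ?j)" for h
    proof -
      obtain x' q y' where hh: "h = (x', q, y')" by (cases h)
      have e: "q = p" "x' = y'" "x' (0, l + ?j) = x (0, l + ?j)"
        using isotropy_cylinder[OF xy(1) lm sh j(1,2) h[unfolded hh]] by auto
      have "x' \<in> paths" using h lcyl_iff[OF c] by (simp add: hh)
      moreover from this have "x' (0, n) = x (0, n)"
        using init_mono[of x x' "l + ?j" n] xy e N n j by simp
      ultimately have "b x' p = b x p" using n(2) by blast
      then show ?thesis using e p by (simp add: hh g yx)
    qed
    then show ?thesis using c unfolding g yx by blast
  next
    case False
    show ?thesis
    proof (cases "p \<in> Pr")
      case False
      \<comment> \<open>The degree is constant on a cylinder, so no arrow of this one has its degree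
        in Per.\<close>
      have "?B h = ?B g" if h: "h \<in> lcyl g l0 m0" for h
      proof -
        obtain x' q y' where hh: "h = (x', q, y')" by (cases h)
        have "q = p" using h lcyl_iff[OF c0[unfolded g]] by (simp add: hh g)
        then show ?thesis using False by (simp add: hh g)
      qed
      then show ?thesis using c0 by blast
    next
      case True
      with \<open>\<not> (x = y \<and> p \<in> Pr)\<close> have "x \<noteq> y" by simp
      \<comment> \<open>Distinct paths differ at some finite degree; a cylinder that fixes both
        paths that far contains no isotropy arrow.\<close>
      then obtain n where n: "n \<in> N" "x (0, n) \<noteq> y (0, n)"
        using path_eqI[OF xy Nk_simps(1)] by auto
      have c: "compat (x, p, y) (l0 + n) (m0 + n)" using compat_add[OF c0 n(1)] by (simp add: g)
      have "?B h = ?B g" if h: "h \<in> lcyl g (l0 + n) (m0 + n)" for h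
      proof -
        obtain x' q y' where hh: "h = (x', q, y')" by (cases h)
        have e: "x' (0, l0 + n) = x (0, l0 + n)" "y' (0, m0 + n) = y (0, m0 + n)" "x' \<in> paths" "y' \<in> paths"
          using h lcyl_iff[OF c] by (simp_all add: hh g)
        have "x' (0, n) = x (0, n)" "y' (0, n) = y (0, n)"
          using init_mono[of x x' "l0 + n" n] init_mono[of y y' "m0 + n" n] e xy n(1) N0 by simp_all
        then have "x' \<noteq> y'" using n by auto
        then show ?thesis using \<open>x \<noteq> y\<close> by (simp add: hh g)
      qed
      then show ?thesis using c unfolding g by blast
    qed
  qed
qed

lemma bicharacter_exists:
  assumes ne: "paths \<noteq> {}"
  shows "\<exists>\<omega>. bicharacter Pr \<omega> \<and> (\<forall>x\<in>paths.
    cohomologous (monoid_cat Pr) (discrete_topology Pr) (sigma_c_at k \<Lambda> P c x) \<omega>)"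
proof -
  note A = Per_subgroup[OF ne]
  obtain z where z: "z \<in> paths" using ne by blast
  have "alternating_bicharacter Pr (commut z)"
    using commutator_bicharacter[OF A sigma_at_cocycle[OF z]]
    by (simp add: commut_def [abs_def] sigma_c_at_def)
  then obtain \<omega> where \<omega>: "bicharacter Pr \<omega>" and cm: "commutator_of Pr (commut z) \<omega>"
    using alternating_bicharacter_is_commutator[OF A Per_bound] by blast
  have sym: "\<sigma>x x p q * \<omega> q p = \<sigma>x x q p * \<omega> p q" if x: "x \<in> paths" and p: "p \<in> Pr" and q: "q \<in> Pr" for x p q
  proof -
    have w: "\<omega> p q = commut x p q * \<omega> q p"
      using cm p q unfolding commut_constant[OF x z p q] commutator_of_def by blast
    have "\<sigma>x x q p * \<omega> p q = (\<sigma>x x q p * cnj (\<sigma>x x q p)) * (\<sigma>x x p q * \<omega> q p)"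
      unfolding w commut_def by (simp only: mult_ac)
    then show ?thesis
      by (simp only: circle_cnj(1)[OF sigma_norm[OF Per_composable[OF x q p]]] mult_1_left)
  qed
  have "\<exists>b. (\<forall>p\<in>Pr. (\<lambda>x. b x p) \<in> locM) \<and> (\<forall>x\<in>paths. b x 0 = 1) \<and>
    (\<forall>x\<in>paths. \<forall>p\<in>Pr. \<forall>q\<in>Pr. b x p * b x q * cnj (b x (p + q)) * \<sigma>x x p q = \<omega> p q)"
    by (rule isotropy_trivialisation[OF ne \<omega> sym])
  then obtain b where bM: "\<And>p. p \<in> Pr \<Longrightarrow> (\<lambda>x. b x p) \<in> locM" and b0: "\<And>x. x \<in> paths \<Longrightarrow> b x 0 = 1"
    and b: "\<And>x p q. x \<in> paths \<Longrightarrow> p \<in> Pr \<Longrightarrow> q \<in> Pr \<Longrightarrow> b x p * b x q * cnj (b x (p + q)) * \<sigma>x x p q = \<omega> p q"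
    by blast
  have "cohomologous (monoid_cat Pr) (discrete_topology Pr) (sigma_c_at k \<Lambda> P c x) \<omega>" if x: "x \<in> paths" for x
    unfolding cohomologous_def
  \<comment> \<open>The coboundary of \<open>b x\<close> turns the cocycle into
    \<open>\<omega>\<close>; the definition of \<open>cohomologous\<close> asks for the opposite
    direction, hence the conjugate.\<close>
  proof (intro conjI exI[of _ "\<lambda>p. cnj (b x p)"])
    have n: "norm (b x p) = 1" if "p \<in> Pr" for p
      using circle_function_groupD(4)[OF locM_group bM[OF that] x] .
    show "continuous_two_cocycle (monoid_cat Pr) (discrete_topology Pr) (sigma_c_at k \<Lambda> P c x)"
      by (rule discrete_two_cocycle[OF sigma_at_cocycle[OF x]])
    show "continuous_two_cocycle (monoid_cat Pr) (discrete_topology Pr) \<omega>"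
      by (rule discrete_two_cocycle[OF bicharacter_two_cocycle[OF A \<omega>]])
    show "continuous_map (discrete_topology Pr) (top_of_set (sphere 0 1)) (\<lambda>p. cnj (b x p))"
      using n by simp
    show "\<forall>v\<in>objects (monoid_cat Pr). cnj (b x v) = 1"
      using b0[OF x] by (auto simp: objects_def monoid_cat_def)
    show "\<forall>(p, q)\<in>composable (monoid_cat Pr).
      sigma_c_at k \<Lambda> P c x p q = coboundary1 (monoid_cat Pr) (\<lambda>p. cnj (b x p)) p q * \<omega> p q"
    proof (clarsimp)
      fix p q assume p: "p \<in> Pr" and q: "q \<in> Pr"
      have "coboundary1 (monoid_cat Pr) (\<lambda>p. cnj (b x p)) p q * \<omega> p q =
        (b x p * cnj (b x p)) * (b x q * cnj (b x q)) * (b x (p + q) * cnj (b x (p + q))) * \<sigma>x x p q"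
        unfolding b[OF x p q, symmetric] coboundary1_def cmp_monoid complex_cnj_cnj by (simp only: mult_ac)
      also have "\<dots> = \<sigma>x x p q"
        by (simp only: circle_cnj(1)[OF n[OF p]] circle_cnj(1)[OF n[OF q]]
          circle_cnj(1)[OF n[OF additive_subgroupD(4)[OF A p q]]] mult_1_left)
      finally show "sigma_c_at k \<Lambda> P c x p q = coboundary1 (monoid_cat Pr) (\<lambda>p. cnj (b x p)) p q * \<omega> p q"
        by (simp add: sigma_c_at_def)
    qed
  qed
  with \<omega> show ?thesis by blast
qed

lemma cocycle_adjustment:
  assumes ne: "paths \<noteq> {}" and \<omega>: "bicharacter Pr \<omega>"
    and coh: "\<And>x. x \<in> paths \<Longrightarrow> cohomologous (monoid_cat Pr) (discrete_topology Pr) (sigma_c_at k \<Lambda> P c x) \<omega>"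
  shows "\<exists>\<tau>. continuous_two_cocycle G (path_groupoid_topology k \<Lambda>) \<tau> \<and>
    cohomologous G (path_groupoid_topology k \<Lambda>) \<tau> \<sigma> \<and>
    (\<forall>x\<in>paths. \<forall>p\<in>Pr. \<forall>q\<in>Pr. \<tau> (x, p, x) (x, q, x) = \<omega> p q)"
proof -
  note A = Per_subgroup[OF ne]
  have sym: "\<sigma>x x p q * \<omega> q p = \<sigma>x x q p * \<omega> p q" if x: "x \<in> paths" and p: "p \<in> Pr" and q: "q \<in> Pr" for x p q
  proof -
    \<comment> \<open>The cochains given for the individual \<open>x\<close> need not be related.
      They only serve to show that \<open>\<omega>\<close> and the cocycle have equal commutators,
      coboundaries on an abelian group being symmetric; a cochain that is locally constant in
      \<open>x\<close> is found anew below.\<close>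
    obtain b where "\<forall>(p, q)\<in>Pr \<times> Pr. sigma_c_at k \<Lambda> P c x p q = coboundary1 (monoid_cat Pr) b p q * \<omega> p q"
      using coh[OF x] unfolding cohomologous_def composable_monoid by blast
    then have b: "\<sigma>x x p q = b p * b q * cnj (b (p + q)) * \<omega> p q" "\<sigma>x x q p = b q * b p * cnj (b (q + p)) * \<omega> q p"
      using p q by (auto simp: coboundary1_def sigma_c_at_def)
    show ?thesis unfolding b by (simp add: ac_simps)
  qed
  have "\<exists>b. (\<forall>p\<in>Pr. (\<lambda>x. b x p) \<in> locM) \<and> (\<forall>x\<in>paths. b x 0 = 1) \<and>
    (\<forall>x\<in>paths. \<forall>p\<in>Pr. \<forall>q\<in>Pr. b x p * b x q * cnj (b x (p + q)) * \<sigma>x x p q = \<omega> p q)"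
    by (rule isotropy_trivialisation[OF ne \<omega> sym])
  then obtain b where bM: "\<And>p. p \<in> Pr \<Longrightarrow> (\<lambda>x. b x p) \<in> locM" and b0: "\<And>x. x \<in> paths \<Longrightarrow> b x 0 = 1"
    and b: "\<And>x p q. x \<in> paths \<Longrightarrow> p \<in> Pr \<Longrightarrow> q \<in> Pr \<Longrightarrow> b x p * b x q * cnj (b x (p + q)) * \<sigma>x x p q = \<omega> p q"
    by blast
  define B where "B = (\<lambda>(x, p, y). if x = y \<and> p \<in> Pr then b x p else 1)"
  have Bn: "norm (B g) = 1" if "g \<in> mor G" for g
    using that circle_function_groupD(4)[OF locM_group bM] by (cases g) (auto simp: B_def mor_G)
  have B0: "B (x, 0, x) = 1" if "x \<in> paths" for x using b0[OF that] by (simp add: B_def)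
  have Bl: "loc_const B" unfolding B_def by (rule isotropy_extension_loc_const[OF bM])
  let ?t = "\<lambda>g h. coboundary1 G B g h * \<sigma> g h"
  have "?t (x, p, x) (x, q, x) = \<omega> p q" if "x \<in> paths" "p \<in> Pr" "q \<in> Pr" for x p q
    using b[OF that] that additive_subgroupD(4)[OF A that(2,3)] by (simp add: coboundary1_def B_def)
  then show ?thesis using coboundary_perturbation[OF Bl Bn B0] by (intro exI[of _ ?t]) simp
qed

text \<open>Without paths the groupoid is empty, and \<open>\<sigma>\<close> itself is the cocycle
  sought.\<close>

lemma no_paths:
  assumes "paths = {}"
  shows "continuous_two_cocycle G (path_groupoid_topology k \<Lambda>) \<sigma> \<and>
    cohomologous G (path_groupoid_topology k \<Lambda>) \<sigma> \<sigma>"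
proof -
  have e: "mor G = {}" using assms mor_G by auto
  then have "composable G = {}" by (auto simp: composable_def)
  moreover have "continuous_map (path_groupoid_topology k \<Lambda>) (top_of_set (sphere 0 1)) (\<lambda>_. 1::complex)"
    by simp
  ultimately show ?thesis
    using sigma_continuous e unfolding cohomologous_def
    by (intro conjI exI[of _ "\<lambda>_. 1"]) (auto simp: objects_def)
qed

end

theorem proposition3p1:
  fixes k :: nat and \<Lambda> :: "'a graded_cat" and c :: "'a \<Rightarrow> 'a \<Rightarrow> complex" and P :: "('a \<times> 'a) set"
  assumes "k_graph k \<Lambda>" and "row_finite_no_sources k \<Lambda>" and "cofinal_graph k \<Lambda>"
    and "two_cocycle \<Lambda> c"
    and "cylinder_partition k \<Lambda> P"
  shows "(\<exists>\<omega>. bicharacter (Per k \<Lambda>) \<omega> \<and>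
            (\<forall>x\<in>inf_paths k \<Lambda>.
               cohomologous (monoid_cat (Per k \<Lambda>)) (discrete_topology (Per k \<Lambda>))
                 (sigma_c_at k \<Lambda> P c x) \<omega>)) \<and>
         (\<forall>\<omega>. bicharacter (Per k \<Lambda>) \<omega> \<longrightarrow>
            (\<forall>x\<in>inf_paths k \<Lambda>.
               cohomologous (monoid_cat (Per k \<Lambda>)) (discrete_topology (Per k \<Lambda>))
                 (sigma_c_at k \<Lambda> P c x) \<omega>) \<longrightarrow>
            (\<exists>\<sigma>. continuous_two_cocycle (path_groupoid k \<Lambda>) (path_groupoid_topology k \<Lambda>) \<sigma> \<and>
                 cohomologous (path_groupoid k \<Lambda>) (path_groupoid_topology k \<Lambda>)
                   \<sigma> (sigma_c k \<Lambda> P c) \<and>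
                 (\<forall>x\<in>inf_paths k \<Lambda>. \<forall>p\<in>Per k \<Lambda>. \<forall>q\<in>Per k \<Lambda>.
                    \<sigma> (x, p, x) (x, q, x) = \<omega> p q)))"
proof -
  interpret cofinal_kgraph_cocycle k \<Lambda> c P
    by unfold_locales (use assms in auto)
  show ?thesis
  proof (cases "inf_paths k \<Lambda> = {}")
    case True
    \<comment> \<open>With no path, the conditions at the paths are vacuous, and the constant 1 is a
      bicharacter on any set.\<close>
    have "bicharacter (Per k \<Lambda>) (\<lambda>_ _. 1)" by (simp add: bicharacter_def)
    then show ?thesis using no_paths[OF True] unfolding True by blast
  next
    case False
    show ?thesis using bicharacter_exists[OF False] cocycle_adjustment[OF False] by blast
  qed
qed

end
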